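(* Let $M$ be a compact, connected three-manifold with boundary. Let $\rho \colon \pi_1(M) \to \mathrm{PSL}(2,\mathbb{C})$ be a representation and let $\mathcal{T}$ be an ideal triangulation of $M$. Then the following are equivalent: (1) there is an anchoring $L$ of $\rho$ such that $\mathcal{T}$ is $L$-essential; (2) there is a solution $Z$ of Thurston's gluing equations on $\mathcal{T}$ so that $\rho_Z$ is conjugate to $\rho$.
   Context: An ideal triangulation $\mathcal{T}$ of $M$ is a collection of model tetrahedra with affine face pairings (every model face glued to exactly one other model face) together with a homeomorphism from the quotient space minus all of its vertices to $M - \partial M$. Let $\widetilde{\mathcal{T}}$ be the induced ideal triangulation of the universal cover $\widetilde{M}$. Let $\Delta_M$ be the set of components of $\partial\widetilde{M}$, with the action of $\pi_1(M)$ by deck transformations; the ideal vertices of $\widetilde{\mathcal{T}}$ correspond bijectively to $\Delta_M$. An anchoring of $\rho$ is a function $L \colon \Delta_M \to \partial_\infty\mathbb{H}^3 = \mathbb{CP}^1$ with $L(\gamma(c)) = \rho(\gamma)(L(c))$ for all $\gamma \in \pi_1(M)$ and $c \in \Delta_M$. The triangulation $\mathcal{T}$ is $L$-essential if every edge of $\widetilde{\mathcal{T}}$, with ends $u, v \in \Delta_M$, has $L(u) \neq L(v)$. Gluing equations. A shape for a tetrahedron is an injective map from its vertices to $\mathbb{CP}^1$, up to the action of $\mathrm{PSL}(2,\mathbb{C})$; equivalently a cross-ratio in $\mathbb{C} - \{0,1\}$ of its four ordered vertices. Given a shape, a directed edge $(v_0, v_1)$ of the tetrahedron, and an ordering $(v_2,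 v_3)$ of the other two vertices, the corresponding parameter is the image of $v_3$ under the projective transformation sending $v_0, v_1, v_2$ to $0, \infty, 1$. A choice $Z$ of shapes for all tetrahedra of $\mathcal{T}$ solves Thurston's gluing equations if, for each edge $e$ of $\mathcal{T}$ (with a direction and a sense of rotation around it), the product of the parameters of the tetrahedra cyclically arranged around $e$ is $1$. (Completeness equations are not imposed.) A solution $Z$ determines a map $\partial D_Z \colon \Delta_M \to \mathbb{CP}^1$ (the pseudo-developing map at infinity), unique up to post-composition by $\mathrm{PSL}(2,\mathbb{C})$, sending the vertices of each tetrahedron of $\widetilde{\mathcal{T}}$ to four distinct points realising the given shape, and a representation $\rho_Z \colon \pi_1(M) \to \mathrm{PSL}(2,\mathbb{C})$, unique up to conjugation, with $\partial D_Z(\gamma \cdot c) = \rho_Z(\gamma)(\partial D_Z(c))$ for all $\gamma \in \pi_1(M)$ and $c \in \Delta_M$. *)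

theory Defs
  imports "HOL-Analysis.Analysis" "HOL-Algebra.Coset"
begin

section \<open>Three-manifolds with boundary\<close>

definition half_space :: "(real^3) set" where
  "half_space = {y. 0 \<le> y $ 1}"

definition half_space_chart ::
    "'a::topological_space set \<Rightarrow> 'a set \<Rightarrow> ('a \<Rightarrow> real^3) \<Rightarrow> bool" where
  "half_space_chart M U f \<longleftrightarrow>
     openin (top_of_set M) U \<and>
     (\<exists>V g. openin (top_of_set half_space) V \<and> homeomorphism U V f g)"

definition three_manifold :: "'a::topological_space set \<Rightarrow> bool" where
  "three_manifold M \<longleftrightarrow>
     Hausdorff_space (top_of_set M) \<and> second_countable (top_of_set M) \<and>
     (\<forall>x\<in>M. \<exists>U f. x \<in> U \<and> half_space_chart M U f)"

definition manifold_boundary :: "'a::topological_space set \<Rightarrow> 'a set" where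
  "manifold_boundary M = {x \<in> M. \<exists>U f. x \<in> U \<and> half_space_chart M U f \<and> f x $ 1 = 0}"


section \<open>Fundamental group, universal cover and deck transformations\<close>

definition fundamental_group ::
    "'a::topological_space set \<Rightarrow> 'a \<Rightarrow> (real \<Rightarrow> 'a) set monoid" where
  "fundamental_group M x =
     \<lparr>carrier = {Collect (homotopic_paths M f) | f.
                   path f \<and> path_image f \<subseteq> M \<and> pathstart f = x \<and> pathfinish f = x},
      monoid.mult = (\<lambda>X Y. {k. \<exists>f\<in>X. \<exists>g\<in>Y. homotopic_paths M (f +++ g) k}),
      monoid.one = Collect (homotopic_paths M (\<lambda>_. x))\<rparr>"

definition universal_cover ::
    "'b::topological_space set \<Rightarrow> ('b \<Rightarrow> 'a::topological_space) \<Rightarrow> 'a set \<Rightarrow> bool" where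
  "universal_cover C p M \<longleftrightarrow> covering_space C p M \<and> simply_connected C"

text \<open>The class \<open>\<gamma>\<close> acts on the universal cover \<open>C\<close> by the deck transformation taking
  the base point \<open>x\<close> of \<open>C\<close> to the end of the lift at \<open>x\<close> of a loop in \<open>\<gamma>\<close>.  Since the
  product of the fundamental group is concatenation from left to right, this is a left action.
  The choice operator leaves values outside \<open>C\<close> unspecified.\<close>

definition deck_of ::
    "'b::topological_space set \<Rightarrow> ('b \<Rightarrow> 'a::topological_space) \<Rightarrow> 'b \<Rightarrow> (real \<Rightarrow> 'a) set
      \<Rightarrow> 'b \<Rightarrow> 'b" where
  "deck_of C p x \<gamma> = (SOME g.
     (\<exists>g'. homeomorphism C C g g') \<and> (\<forall>y\<in>C. p (g y) = p y) \<and>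
     (\<exists>f. path f \<and> path_image f \<subseteq> C \<and> pathstart f = x \<and> p \<circ> f \<in> \<gamma> \<and> g x = pathfinish f))"

text \<open>The set \<open>\<Delta>\<^sub>M\<close>, as a function of the universal cover.\<close>

definition Delta :: "'b::topological_space set \<Rightarrow> 'b set set" where
  "Delta C = components (manifold_boundary C)"


section \<open>The projective line and \<open>PSL(2,\<complex>)\<close>\<close>

definition CP1 :: "(complex^2) set set" where
  "CP1 = {vec.span {v} | v. v \<noteq> 0}"

definition cp1_of :: "complex \<Rightarrow> (complex^2) set" where
  "cp1_of z = vec.span {vector [z, 1]}"

definition cp1_inf :: "(complex^2) set" where
  "cp1_inf = vec.span {vector [1, 0]}"

definition SL2C :: "(complex^2^2) monoid" where
  "SL2C = \<lparr>carrier = {A. det A = 1}, monoid.mult = (**), monoid.one = mat 1\<rparr>"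

definition PSL2C :: "(complex^2^2) set monoid" where
  "PSL2C = SL2C Mod {mat 1, - mat 1}"

text \<open>The members of a coset all have the same image of a line, so the union is that image.\<close>

definition psl_act :: "(complex^2^2) set \<Rightarrow> (complex^2) set \<Rightarrow> (complex^2) set" where
  "psl_act X l = (\<Union>A\<in>X. (*v) A ` l)"

definition conjugate_reps :: "'g monoid \<Rightarrow> ('g \<Rightarrow> (complex^2^2) set) \<Rightarrow>
    ('g \<Rightarrow> (complex^2^2) set) \<Rightarrow> bool" where
  "conjugate_reps G \<rho>' \<rho> \<longleftrightarrow>
     (\<exists>g\<in>carrier PSL2C. \<forall>\<gamma>\<in>carrier G.
        \<rho>' \<gamma> = g \<otimes>\<^bsub>PSL2C\<^esub> \<rho> \<gamma> \<otimes>\<^bsub>PSL2C\<^esub> inv\<^bsub>PSL2C\<^esub> g)"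


section \<open>Ideal triangulations\<close>

text \<open>Tetrahedra have vertices indexed by the four-element type \<open>4\<close>.  If \<open>glue T (i, a) = (j, \<sigma>)\<close>,
  then the face of \<open>i\<close> opposite \<open>a\<close> is glued to the face of \<open>j\<close> opposite \<open>\<sigma> a\<close>, by the affine
  map given on vertices by \<open>\<sigma>\<close>.\<close>

record 't triangulation =
  tets :: "'t set"
  glue :: "'t \<times> 4 \<Rightarrow> 't \<times> (4 \<Rightarrow> 4)"

definition face_pairing :: "'t triangulation \<Rightarrow> bool" where
  "face_pairing T \<longleftrightarrow> finite (tets T) \<and>
     (\<forall>i\<in>tets T. \<forall>a j \<sigma>. glue T (i, a) = (j, \<sigma>) \<longrightarrow>
        j \<in> tets T \<and> bij \<sigma> \<and> (j, \<sigma> a) \<noteq> (i, a) \<and> glue T (j, \<sigma> a) = (i, inv_into UNIV \<sigma>))"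

definition std_simplex :: "(real^4) set" where
  "std_simplex = {x. (\<forall>k. 0 \<le> x $ k) \<and> (\<Sum>k\<in>UNIV. x $ k) = 1}"

definition std_vertex :: "4 \<Rightarrow> real^4" where
  "std_vertex a = axis a 1"

definition ideal_simplex :: "(real^4) set" where
  "ideal_simplex = std_simplex - range std_vertex"

definition simplex_map :: "(4 \<Rightarrow> 4) \<Rightarrow> real^4 \<Rightarrow> real^4" where
  "simplex_map \<sigma> x = (\<chi> k. x $ inv_into UNIV \<sigma> k)"

definition glue_step :: "'t triangulation \<Rightarrow> (('t \<times> (real^4)) \<times> ('t \<times> (real^4))) set" where
  "glue_step T = {((i, x), (j, simplex_map \<sigma> x)) | i x j \<sigma>.
     i \<in> tets T \<and> x \<in> std_simplex \<and> (\<exists>a. x $ a = 0 \<and> glue T (i, a) = (j, \<sigma>))}"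

text \<open>For a face pairing, \<open>glue_step\<close> is symmetric, so its reflexive transitive closure is
  the equivalence relation generated by the gluing.\<close>

definition point_class :: "'t triangulation \<Rightarrow> 't \<times> (real^4) \<Rightarrow> ('t \<times> (real^4)) set" where
  "point_class T y = (glue_step T)\<^sup>* `` {y}"

definition quotient_topology :: "'a topology \<Rightarrow> ('a \<Rightarrow> 'b) \<Rightarrow> 'b topology" where
  "quotient_topology X f =
     topology (\<lambda>V. V \<subseteq> f ` topspace X \<and> openin X {x \<in> topspace X. f x \<in> V})"

lemma openin_quotient_topology:
  "openin (quotient_topology X f) V \<longleftrightarrow>
     V \<subseteq> f ` topspace X \<and> openin X {x \<in> topspace X. f x \<in> V}"
proof -
  have "istopology (\<lambda>V. V \<subseteq> f ` topspace X \<and> openin X {x \<in> topspace X. f x \<in> V})"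
    unfolding istopology_def
  proof (intro conjI allI impI)
    fix S T
    assume S: "S \<subseteq> f ` topspace X \<and> openin X {x \<in> topspace X. f x \<in> S}"
      and T: "T \<subseteq> f ` topspace X \<and> openin X {x \<in> topspace X. f x \<in> T}"
    show "S \<inter> T \<subseteq> f ` topspace X" using S by blast
    have "openin X ({x \<in> topspace X. f x \<in> S} \<inter> {x \<in> topspace X. f x \<in> T})"
      by (rule openin_Int[OF conjunct2[OF S] conjunct2[OF T]])
    also have "{x \<in> topspace X. f x \<in> S} \<inter> {x \<in> topspace X. f x \<in> T} =
        {x \<in> topspace X. f x \<in> S \<inter> T}"
      by blast
    finally show "openin X {x \<in> topspace X. f x \<in> S \<inter> T}" .
  next
    fix K
    assume K: "\<forall>S\<in>K. S \<subseteq> f ` topspace X \<and> openin X {x \<in> topspace X. f x \<in> S}"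
    show "\<Union>K \<subseteq> f ` topspace X" using K by blast
    have "openin X {x \<in> topspace X. f x \<in> S}" if "S \<in> K" for S
      by (rule conjunct2[OF bspec[OF K that]])
    then have "openin X (\<Union>S\<in>K. {x \<in> topspace X. f x \<in> S})"
      by (intro openin_Union) (elim imageE, simp)
    also have "(\<Union>S\<in>K. {x \<in> topspace X. f x \<in> S}) = {x \<in> topspace X. f x \<in> \<Union>K}"
      by blast
    finally show "openin X {x \<in> topspace X. f x \<in> \<Union>K}" .
  qed
  then show ?thesis
    by (simp only: quotient_topology_def topology_inverse')
qed

lemma topspace_quotient_topology: "topspace (quotient_topology X f) = f ` topspace X"
proof
  show "topspace (quotient_topology X f) \<subseteq> f ` topspace X"
    by (rule conjunct1[OF iffD1[OF openin_quotient_topology openin_topspace]])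
  have "{x \<in> topspace X. f x \<in> f ` topspace X} = topspace X"
    by blast
  then have "openin (quotient_topology X f) (f ` topspace X)"
    by (simp only: openin_quotient_topology openin_topspace order_refl)
  then show "f ` topspace X \<subseteq> topspace (quotient_topology X f)"
    by (rule openin_subset)
qed

lemma quotient_map_quotient_topology: "quotient_map X (quotient_topology X f) f"
  by (simp add: quotient_map_def topspace_quotient_topology openin_quotient_topology)

definition quotient_space :: "'t triangulation \<Rightarrow> ('t \<times> (real^4)) set topology" where
  "quotient_space T =
     quotient_topology (prod_topology (discrete_topology (tets T)) (top_of_set std_simplex))
       (point_class T)"

definition quotient_vertices :: "'t triangulation \<Rightarrow> ('t \<times> (real^4)) set set" where
  "quotient_vertices T = point_class T ` (tets T \<times> range std_vertex)"

definition ideal_triangulation ::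
    "'a::topological_space set \<Rightarrow> 't triangulation \<Rightarrow> (('t \<times> (real^4)) set \<Rightarrow> 'a) \<Rightarrow> bool" where
  "ideal_triangulation M T h \<longleftrightarrow> face_pairing T \<and>
     homeomorphic_map
       (subtopology (quotient_space T) (topspace (quotient_space T) - quotient_vertices T))
       (top_of_set (M - manifold_boundary M)) h"


section \<open>The induced triangulation of the universal cover\<close>

text \<open>The tetrahedra of the induced triangulation are the lifts \<open>\<tau>\<close> of the characteristic maps
  of the tetrahedra \<open>i\<close> of \<open>T\<close>.\<close>

definition lifted_tet :: "'b::topological_space set \<Rightarrow> ('b \<Rightarrow> 'a::topological_space) \<Rightarrow>
    't triangulation \<Rightarrow> (('t \<times> (real^4)) set \<Rightarrow> 'a) \<Rightarrow> 't \<Rightarrow> (real^4 \<Rightarrow> 'b) \<Rightarrow> bool" where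
  "lifted_tet C p T h i \<tau> \<longleftrightarrow> i \<in> tets T \<and>
     continuous_on ideal_simplex \<tau> \<and> \<tau> ` ideal_simplex \<subseteq> C \<and>
     (\<forall>x\<in>ideal_simplex. p (\<tau> x) = h (point_class T (i, x)))"

text \<open>The component of the boundary of \<open>C\<close> corresponding to the ideal vertex \<open>a\<close> of a lifted
  tetrahedron \<open>\<tau>\<close>: for every neighbourhood \<open>N\<close> of the boundary of \<open>M\<close>, near its vertex \<open>a\<close> the
  tetrahedron lies in the same component of the preimage of \<open>N\<close> as that boundary component.
  A limit point of \<open>\<tau> x\<close> as \<open>x\<close> tends to the vertex need not exist, because no regularity of
  the homeomorphism \<open>h\<close> near the boundary is assumed.\<close>

definition ideal_end :: "'a::topological_space set \<Rightarrow> 'b::topological_space set \<Rightarrow> ('b \<Rightarrow> 'a) \<Rightarrow>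
    (real^4 \<Rightarrow> 'b) \<Rightarrow> 4 \<Rightarrow> 'b set" where
  "ideal_end M C p \<tau> a = (THE c. c \<in> Delta C \<and>
     (\<forall>N. openin (top_of_set M) N \<and> manifold_boundary M \<subseteq> N \<longrightarrow>
        (\<exists>K\<in>components (C \<inter> p -` N). c \<subseteq> K \<and>
           (\<forall>\<^sub>F x in at (std_vertex a) within ideal_simplex. \<tau> x \<in> K))))"

text \<open>The components \<open>u\<close> and \<open>v\<close> are the ends of an edge of the induced triangulation; each such
  edge is an edge of some lifted tetrahedron.\<close>

definition lifted_edge_ends :: "'a::topological_space set \<Rightarrow> 'b::topological_space set \<Rightarrow>
    ('b \<Rightarrow> 'a) \<Rightarrow> 't triangulation \<Rightarrow> (('t \<times> (real^4)) set \<Rightarrow> 'a) \<Rightarrow> 'b set \<Rightarrow> 'b set \<Rightarrow> bool" where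
  "lifted_edge_ends M C p T h u v \<longleftrightarrow>
     (\<exists>i \<tau> a b. lifted_tet C p T h i \<tau> \<and> a \<noteq> b \<and>
        u = ideal_end M C p \<tau> a \<and> v = ideal_end M C p \<tau> b)"


section \<open>Anchorings\<close>

definition anchoring :: "'a::topological_space set \<Rightarrow> 'b::topological_space set \<Rightarrow> ('b \<Rightarrow> 'a) \<Rightarrow>
    'b \<Rightarrow> ((real \<Rightarrow> 'a) set \<Rightarrow> (complex^2^2) set) \<Rightarrow> ('b set \<Rightarrow> (complex^2) set) \<Rightarrow> bool" where
  "anchoring M C p x \<rho> L \<longleftrightarrow> L \<in> Delta C \<rightarrow> CP1 \<and>
     (\<forall>\<gamma>\<in>carrier (fundamental_group M (p x)). \<forall>c\<in>Delta C.
        L (deck_of C p x \<gamma> ` c) = psl_act (\<rho> \<gamma>) (L c))"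

definition L_essential :: "'a::topological_space set \<Rightarrow> 'b::topological_space set \<Rightarrow>
    ('b \<Rightarrow> 'a) \<Rightarrow> 't triangulation \<Rightarrow> (('t \<times> (real^4)) set \<Rightarrow> 'a) \<Rightarrow>
    ('b set \<Rightarrow> (complex^2) set) \<Rightarrow> bool" where
  "L_essential M C p T h L \<longleftrightarrow> (\<forall>u v. lifted_edge_ends M C p T h u v \<longrightarrow> L u \<noteq> L v)"


section \<open>Shapes and the gluing equations\<close>

definition shape_of :: "(4 \<Rightarrow> (complex^2) set) \<Rightarrow> (4 \<Rightarrow> (complex^2) set) set" where
  "shape_of f = {\<lambda>k. psl_act g (f k) | g. g \<in> carrier PSL2C}"

definition shapes :: "(4 \<Rightarrow> (complex^2) set) set set" where
  "shapes = {shape_of f | f. inj f \<and> range f \<subseteq> CP1}"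

definition shape_parameter ::
    "(4 \<Rightarrow> (complex^2) set) set \<Rightarrow> 4 \<Rightarrow> 4 \<Rightarrow> 4 \<Rightarrow> 4 \<Rightarrow> complex" where
  "shape_parameter S a b c d = (THE z. \<exists>f\<in>S. \<exists>g\<in>carrier PSL2C.
     psl_act g (f a) = cp1_of 0 \<and> psl_act g (f b) = cp1_inf \<and>
     psl_act g (f c) = cp1_of 1 \<and> psl_act g (f d) = cp1_of z)"

text \<open>A flag \<open>(i, a, b, c, d)\<close> is a tetrahedron \<open>i\<close> with directed edge \<open>(a, b)\<close> and an ordering
  \<open>(c, d)\<close> of the other vertices, that is, a sense of rotation from the face \<open>abc\<close> to the face
  \<open>abd\<close>.  Rotation leaves \<open>i\<close> through the face \<open>abd\<close>, which is the face opposite \<open>c\<close>.  The flags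
  in an orbit correspond to the tetrahedra arranged around an edge, one flag for each time
  a tetrahedron occurs.\<close>

definition flags :: "'t triangulation \<Rightarrow> ('t \<times> 4 \<times> 4 \<times> 4 \<times> 4) set" where
  "flags T = {(i, a, b, c, d). i \<in> tets T \<and> distinct [a, b, c, d]}"

definition rotate_flag ::
    "'t triangulation \<Rightarrow> 't \<times> 4 \<times> 4 \<times> 4 \<times> 4 \<Rightarrow> 't \<times> 4 \<times> 4 \<times> 4 \<times> 4" where
  "rotate_flag T = (\<lambda>(i, a, b, c, d).
     case glue T (i, c) of (j, \<sigma>) \<Rightarrow> (j, \<sigma> a, \<sigma> b, \<sigma> d, \<sigma> c))"

definition solves_gluing_equations ::
    "'t triangulation \<Rightarrow> ('t \<Rightarrow> (4 \<Rightarrow> (complex^2) set) set) \<Rightarrow> bool" where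
  "solves_gluing_equations T Z \<longleftrightarrow> (\<forall>i\<in>tets T. Z i \<in> shapes) \<and>
     (\<forall>F\<in>flags T.
        (\<Prod>(i, a, b, c, d)\<in>{(rotate_flag T ^^ n) F | n. True}. shape_parameter (Z i) a b c d) = 1)"

definition pseudo_developing :: "'a::topological_space set \<Rightarrow> 'b::topological_space set \<Rightarrow>
    ('b \<Rightarrow> 'a) \<Rightarrow> 't triangulation \<Rightarrow> (('t \<times> (real^4)) set \<Rightarrow> 'a) \<Rightarrow>
    ('t \<Rightarrow> (4 \<Rightarrow> (complex^2) set) set) \<Rightarrow> ('b set \<Rightarrow> (complex^2) set) \<Rightarrow> bool" where
  "pseudo_developing M C p T h Z D \<longleftrightarrow> D \<in> Delta C \<rightarrow> CP1 \<and>
     (\<forall>i \<tau>. lifted_tet C p T h i \<tau> \<longrightarrow> (\<lambda>a. D (ideal_end M C p \<tau> a)) \<in> Z i)"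

text \<open>The holonomy of a solution \<open>Z\<close> is only defined up to conjugation, so it is given as a
  relation: \<open>\<rho>'\<close> is a representative of it.\<close>

definition holonomy_rep :: "'a::topological_space set \<Rightarrow> 'b::topological_space set \<Rightarrow>
    ('b \<Rightarrow> 'a) \<Rightarrow> 'b \<Rightarrow> 't triangulation \<Rightarrow> (('t \<times> (real^4)) set \<Rightarrow> 'a) \<Rightarrow>
    ('t \<Rightarrow> (4 \<Rightarrow> (complex^2) set) set) \<Rightarrow> ((real \<Rightarrow> 'a) set \<Rightarrow> (complex^2^2) set) \<Rightarrow> bool" where
  "holonomy_rep M C p x T h Z \<rho>' \<longleftrightarrow> \<rho>' \<in> hom (fundamental_group M (p x)) PSL2C \<and>
     (\<exists>D. pseudo_developing M C p T h Z D \<and>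
        (\<forall>\<gamma>\<in>carrier (fundamental_group M (p x)). \<forall>c\<in>Delta C.
           D (deck_of C p x \<gamma> ` c) = psl_act (\<rho>' \<gamma>) (D c)))"

end

theory Submission
  imports Defs
begin

text \<open>An \<open>L\<close>-essential anchoring sends the ideal vertices of each tetrahedron of the universal cover
  to four distinct points, and its equivariance makes their shape depend only on the tetrahedron of
  \<open>T\<close>.  Around an edge with ends \<open>u\<close> and \<open>v\<close>, normalise \<open>L u = 0\<close> and \<open>L v = \<infinity>\<close>: the parameters are
  then the quotients of the images of consecutive link vertices.  Their product telescopes to \<open>1\<close>
  because the cycle of lifted tetrahedra closes up, so \<open>L\<close> itself is a pseudo-developing map.
  Conversely a pseudo-developing map, translated by the conjugating element, is an anchoring, and it
  is essential because shapes are injective.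

  The topological content is that an ideal vertex determines exactly one boundary component of
  the universal cover, compatibly with deck transformations and face pairings.\<close>

section \<open>Lifting in covering spaces of arbitrary topological spaces\<close>

text \<open>The homeomorphism \<open>h\<close> is given only on the interior of \<open>M\<close>, so
  the tip of a tetrahedron may wander along the boundary without approaching any point of it. Its
  end is therefore read off from neighbourhoods \<open>N\<close> of the boundary. Compactness of
  \<open>M\<close> forces the tip to lie over every \<open>N\<close>; being connected, it stays in
  one component of the preimage of \<open>N\<close>. Two kinds of \<open>N\<close> turn this into a
  single boundary component: one so small that no component of the preimage contains two boundary
  components, and ones built from half-balls centred on the boundary, for which every component of
  the preimage contains at least one. Almost everything else about the cover comes from uniqueness
  of lifts on connected sets. It makes the deck group transitive on the lifts of one tetrahedron,
  makes neighbouring lifts agree on a whole face once they agree at one point of it, and makes the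
  cycle of lifts around an edge close up in \<open>C\<close> itself rather than up to a deck
  transformation.\<close>

lemma continuous_on_locallyI:
  assumes "\<And>x. x \<in> A \<Longrightarrow> \<exists>B. openin (top_of_set A) B \<and> x \<in> B \<and> continuous_on B f"
  shows "continuous_on A f"
  unfolding continuous_on_def
proof
  fix x assume x: "x \<in> A"
  obtain B where B: "openin (top_of_set A) B" "x \<in> B" "continuous_on B f" using assms[OF x] by blast
  then obtain V where V: "open V" "B = A \<inter> V" by (auto simp: openin_open)
  have "at x within A = at x within B"
    by (rule at_within_nhd[of x V]) (use V B in auto)
  then show "(f \<longlongrightarrow> f x) (at x within A)"
    using B by (simp add: continuous_on_def)
qed

text \<open>The lifting theorems of \<open>HOL-Analysis\<close> assume that both spaces lie in normed vector spaces.\<close>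

lemma covering_lifts_agree_openin:
  assumes cov: "covering_space C p S"
    and g1: "continuous_on T g1" "g1 ` T \<subseteq> C" and g2: "continuous_on T g2" "g2 ` T \<subseteq> C"
    and eq: "\<And>x. x \<in> T \<Longrightarrow> p (g1 x) = p (g2 x)"
  shows "openin (top_of_set T) {x \<in> T. g1 x = g2 x}"
proof (subst openin_subopen, clarify)
  fix z assume z: "z \<in> T" "g1 z = g2 z"
  have "g1 z \<in> C" using g1 z by auto
  then obtain V W q where V: "g1 z \<in> V" "openin (top_of_set C) V" "homeomorphism V W p q"
    using covering_space_local_homeomorphism[OF cov] by metis
  have "openin (top_of_set T) ((T \<inter> g1 -` V) \<inter> (T \<inter> g2 -` V))"
    using g1 g2 V by (intro openin_Int continuous_openin_preimage[where T = C]) auto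
  moreover have "(T \<inter> g1 -` V) \<inter> (T \<inter> g2 -` V) \<subseteq> {x \<in> T. g1 x = g2 x}"
    using eq V(3) by (auto simp: homeomorphism_def) metis
  ultimately show "\<exists>U. openin (top_of_set T) U \<and> z \<in> U \<and> U \<subseteq> {x \<in> T. g1 x = g2 x}"
    using z V(1) by (intro exI[of _ "(T \<inter> g1 -` V) \<inter> (T \<inter> g2 -` V)"]) auto
qed

text \<open>Two different points over the same base point lie in different sheets over an evenly
  covered set, and these sheets are disjoint. So the agreement set of two lifts is closed as well as
  open, which is what uniqueness on connected sets requires.\<close>

lemma covering_lifts_differ_openin:
  assumes cov: "covering_space C p S"
    and g1: "continuous_on T g1" "g1 ` T \<subseteq> C" and g2: "continuous_on T g2" "g2 ` T \<subseteq> C"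
    and eq: "\<And>x. x \<in> T \<Longrightarrow> p (g1 x) = p (g2 x)"
  shows "openin (top_of_set T) {x \<in> T. g1 x \<noteq> g2 x}"
proof (subst openin_subopen, clarify)
  fix z assume z: "z \<in> T" "g1 z \<noteq> g2 z"
  have zC: "g1 z \<in> C" "g2 z \<in> C" using g1 g2 z by auto
  then have "p (g1 z) \<in> S" using cov by (auto simp: covering_space_def)
  then obtain W v where W: "p (g1 z) \<in> W" "\<Union>v = C \<inter> p -` W" "\<forall>u\<in>v. openin (top_of_set C) u"
      "pairwise disjnt v" "\<forall>u\<in>v. \<exists>q. homeomorphism u W p q"
    using cov unfolding covering_space_def by metis
  have "g1 z \<in> \<Union>v" "g2 z \<in> \<Union>v" using W zC eq[OF z(1)] by auto
  then obtain u1 u2 where u: "u1 \<in> v" "g1 z \<in> u1" "u2 \<in> v" "g2 z \<in> u2" by blast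
  have "u1 \<noteq> u2"
  proof
    assume "u1 = u2"
    then obtain q where "homeomorphism u1 W p q" using W u by blast
    then show False using eq[OF z(1)] z(2) u \<open>u1 = u2\<close> by (auto simp: homeomorphism_def) metis
  qed
  then have dis: "u1 \<inter> u2 = {}" using W(4) u by (auto simp: pairwise_def disjnt_def)
  have "openin (top_of_set T) ((T \<inter> g1 -` u1) \<inter> (T \<inter> g2 -` u2))"
    using g1 g2 W u by (intro openin_Int continuous_openin_preimage[where T = C]) auto
  then show "\<exists>U. openin (top_of_set T) U \<and> z \<in> U \<and> U \<subseteq> {x \<in> T. g1 x \<noteq> g2 x}"
    using z u dis by (intro exI[of _ "(T \<inter> g1 -` u1) \<inter> (T \<inter> g2 -` u2)"]) auto
qed

lemma covering_lift_unique:
  assumes cov: "covering_space C p S" and T: "connected T"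
    and g1: "continuous_on T g1" "g1 ` T \<subseteq> C" and g2: "continuous_on T g2" "g2 ` T \<subseteq> C"
    and eq: "\<And>x. x \<in> T \<Longrightarrow> p (g1 x) = p (g2 x)"
    and a: "a \<in> T" "g1 a = g2 a" and x: "x \<in> T"
  shows "g1 x = g2 x"
proof -
  let ?E = "{x \<in> T. g1 x = g2 x}"
  have "openin (top_of_set T) ?E" by (rule covering_lifts_agree_openin[OF cov g1 g2 eq])
  moreover have "T - ?E = {x \<in> T. g1 x \<noteq> g2 x}" by auto
  then have "closedin (top_of_set T) ?E"
    using covering_lifts_differ_openin[OF cov g1 g2 eq] by (auto simp: closedin_def)
  ultimately have "?E = {} \<or> ?E = T" using T connected_clopen by blast
  then show ?thesis using a x by blast
qed

text \<open>Even covering recast in terms of inverse maps: each sheet is recorded by its section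
  over \<open>W\<close>, and the unique existence clause expresses that the sheets are disjoint and
  exhaust the preimage. Later constructions select a section through a point and compose with
  it.\<close>

lemma covering_sections:
  assumes cov: "covering_space C p S" and b: "b \<in> S"
  obtains W \<Sigma> where "b \<in> W" "openin (top_of_set S) W"
    "\<forall>s\<in>\<Sigma>. continuous_on W s \<and> s ` W \<subseteq> C \<and> (\<forall>x\<in>W. p (s x) = x)"
    "\<forall>y\<in>C. p y \<in> W \<longrightarrow> (\<exists>!s. s \<in> \<Sigma> \<and> s (p y) = y)"
proof -
  obtain W v where W: "b \<in> W" "openin (top_of_set S) W" "\<Union>v = C \<inter> p -` W"
      "\<forall>u\<in>v. openin (top_of_set C) u"
      "pairwise disjnt v" "\<forall>u\<in>v. \<exists>q. homeomorphism u W p q"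
    using cov b unfolding covering_space_def by metis
  then obtain q where q: "\<And>u. u \<in> v \<Longrightarrow> homeomorphism u W p (q u)" by metis
  show thesis
  proof (rule that[of W "q ` v"])
    show "b \<in> W" "openin (top_of_set S) W" by fact+
    show "\<forall>s\<in>q ` v. continuous_on W s \<and> s ` W \<subseteq> C \<and> (\<forall>x\<in>W. p (s x) = x)"
    proof
      fix s assume "s \<in> q ` v"
      then obtain u where u: "u \<in> v" "s = q u" by auto
      then show "continuous_on W s \<and> s ` W \<subseteq> C \<and> (\<forall>x\<in>W. p (s x) = x)"
        using q[OF u(1)] W(3) by (auto simp: homeomorphism_def)
    qed
    show "\<forall>y\<in>C. p y \<in> W \<longrightarrow> (\<exists>!s. s \<in> q ` v \<and> s (p y) = y)"
    proof (intro ballI impI)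
      fix y assume y: "y \<in> C" "p y \<in> W"
      then obtain u where u: "u \<in> v" "y \<in> u" using W(3) by auto
      have *: "u' = u" if "u' \<in> v" "q u' (p y) = y" for u'
      proof -
        have "y \<in> u'" using q[OF that(1)] y that(2) unfolding homeomorphism_def by (metis imageI)
        then show ?thesis using W(5) u that(1) by (auto simp: pairwise_def disjnt_def)
      qed
      show "\<exists>!s. s \<in> q ` v \<and> s (p y) = y"
      proof (rule ex1I[of _ "q u"])
        show "q u \<in> q ` v \<and> q u (p y) = y" using u q[OF u(1)] by (auto simp: homeomorphism_def)
      qed (use * in auto)
    qed
  qed
qed

section \<open>Homotopy lifting over arbitrary parameter spaces\<close>

text \<open>The lift is required over every subset of \<open>V\<close>, so that two strips can be composed by
  intersecting their neighbourhoods in a bisection argument.\<close>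

lemma covering_homotopy_lift_strip:
  fixes h :: "real \<times> 'c::topological_space \<Rightarrow> 'a::topological_space"
  assumes cov: "covering_space C p S"
    and h: "continuous_on ({0..1} \<times> U) h" "h ` ({0..1} \<times> U) \<subseteq> S" and y: "y \<in> U"
  shows "\<exists>V. openin (top_of_set U) V \<and> y \<in> V \<and>
    (\<forall>V' c. V' \<subseteq> V \<and> continuous_on V' c \<and> c ` V' \<subseteq> C \<and> (\<forall>v\<in>V'. p (c v) = h (0, v)) \<longrightarrow>
      (\<exists>k. continuous_on ({0..1} \<times> V') k \<and> k ` ({0..1} \<times> V') \<subseteq> C \<and>
        (\<forall>v\<in>V'. k (0, v) = c v) \<and> (\<forall>z\<in>{0..1} \<times> V'. p (k z) = h z)))"
proof -
  \<comment> \<open>The inequalities are premises inside \<open>P\<close> because bisection tests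
    all short intervals around a point, including those that leave the unit interval.\<close>
  define P where "P a b \<longleftrightarrow> (0 \<le> a \<longrightarrow> a \<le> b \<longrightarrow> b \<le> 1 \<longrightarrow>
    (\<exists>V. openin (top_of_set U) V \<and> y \<in> V \<and>
    (\<forall>V' c. V' \<subseteq> V \<and> continuous_on V' c \<and> c ` V' \<subseteq> C \<and> (\<forall>v\<in>V'. p (c v) = h (a, v)) \<longrightarrow>
      (\<exists>k. continuous_on ({a..b} \<times> V') k \<and> k ` ({a..b} \<times> V') \<subseteq> C \<and>
        (\<forall>v\<in>V'. k (a, v) = c v) \<and> (\<forall>z\<in>{a..b} \<times> V'. p (k z) = h z)))))" for a b :: real
  have "P 0 1" using zero_le_one
  proof (rule Bolzano)
    fix a b c :: real
    assume P: "P a b" "P b c" and ab: "a \<le> b" "b \<le> c"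
    show "P a c" unfolding P_def
    proof (intro impI)
      assume ac: "0 \<le> a" "a \<le> c" "c \<le> 1"
      obtain V1 where V1: "openin (top_of_set U) V1" "y \<in> V1"
        and k1: "\<And>V' c. V' \<subseteq> V1 \<and> continuous_on V' c \<and> c ` V' \<subseteq> C \<and> (\<forall>v\<in>V'. p (c v) = h (a, v)) \<Longrightarrow>
      (\<exists>k. continuous_on ({a..b} \<times> V') k \<and> k ` ({a..b} \<times> V') \<subseteq> C \<and>
        (\<forall>v\<in>V'. k (a, v) = c v) \<and> (\<forall>z\<in>{a..b} \<times> V'. p (k z) = h z))"
        using P(1) ab ac unfolding P_def by (smt (verit))
      obtain V2 where V2: "openin (top_of_set U) V2" "y \<in> V2"
        and k2: "\<And>V' g. V' \<subseteq> V2 \<and> continuous_on V' g \<and> g ` V' \<subseteq> C \<and> (\<forall>v\<in>V'. p (g v) = h (b, v)) \<Longrightarrow>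
      (\<exists>k. continuous_on ({b..c} \<times> V') k \<and> k ` ({b..c} \<times> V') \<subseteq> C \<and>
        (\<forall>v\<in>V'. k (b, v) = g v) \<and> (\<forall>z\<in>{b..c} \<times> V'. p (k z) = h z))"
        using P(2) ab ac unfolding P_def by (smt (verit))
      show "\<exists>V. openin (top_of_set U) V \<and> y \<in> V \<and>
         (\<forall>V' g. V' \<subseteq> V \<and> continuous_on V' g \<and> g ` V' \<subseteq> C \<and> (\<forall>v\<in>V'. p (g v) = h (a, v)) \<longrightarrow>
           (\<exists>k. continuous_on ({a..c} \<times> V') k \<and> k ` ({a..c} \<times> V') \<subseteq> C \<and>
            (\<forall>v\<in>V'. k (a, v) = g v) \<and> (\<forall>z\<in>{a..c} \<times> V'. p (k z) = h z)))"
      proof (intro exI[of _ "V1 \<inter> V2"] conjI allI impI)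
        show "openin (top_of_set U) (V1 \<inter> V2)" "y \<in> V1 \<inter> V2" using V1 V2 by auto
        fix V' g
        assume g: "V' \<subseteq> V1 \<inter> V2 \<and> continuous_on V' g \<and> g ` V' \<subseteq> C \<and> (\<forall>v\<in>V'. p (g v) = h (a, v))"
        then obtain k where k: "continuous_on ({a..b} \<times> V') k" "k ` ({a..b} \<times> V') \<subseteq> C"
            "\<forall>v\<in>V'. k (a, v) = g v" "\<forall>z\<in>{a..b} \<times> V'. p (k z) = h z"
          using k1[of V' g] by blast
        \<comment> \<open>The final slice of the first lift is the initial slice for the second, so
          the two agree at time \<open>b\<close> and paste along closed pieces.\<close>
        have "continuous_on V' (\<lambda>v. k (b, v))"
          by (rule continuous_on_compose2[OF k(1)]) (use ab in \<open>auto intro!: continuous_intros\<close>)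
        then have kb: "V' \<subseteq> V2 \<and> continuous_on V' (\<lambda>v. k (b, v)) \<and> (\<lambda>v. k (b, v)) ` V' \<subseteq> C \<and> (\<forall>v\<in>V'. p (k (b, v)) = h (b, v))"
        proof (intro conjI ballI)
          have "(b, v) \<in> {a..b} \<times> V'" if "v \<in> V'" for v using that ab by simp
          then show "(\<lambda>v. k (b, v)) ` V' \<subseteq> C" "\<And>v. v \<in> V' \<Longrightarrow> p (k (b, v)) = h (b, v)"
            using k(2,4) by blast+
        qed (use g in blast)+
        then obtain k' where k': "continuous_on ({b..c} \<times> V') k'" "k' ` ({b..c} \<times> V') \<subseteq> C"
            "\<forall>v\<in>V'. k' (b, v) = k (b, v)" "\<forall>z\<in>{b..c} \<times> V'. p (k' z) = h z"
          using k2[OF kb] by (elim exE conjE)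
        let ?k = "\<lambda>z. if z \<in> {a..b} \<times> V' then k z else k' z"
        have un: "{a..c} \<times> V' = ({a..b} \<times> V') \<union> ({b..c} \<times> V')" using ab by auto
        have eq: "k z = k' z" if "z \<in> ({a..b} \<times> V') \<inter> ({b..c} \<times> V')" for z
        proof -
          have "z = (b, snd z)" "snd z \<in> V'" using that by (auto simp: prod_eq_iff)
          then obtain v where "z = (b, v)" "v \<in> V'" by metis
          then show ?thesis using k'(3) by auto
        qed
        have "continuous_on ({a..c} \<times> V') ?k" unfolding un
        proof (rule continuous_on_cases_local)
          have "closed ({a..b} \<times> UNIV :: (real \<times> 'c) set)" "closed ({b..c} \<times> UNIV :: (real \<times> 'c) set)"
            by (auto intro: closed_Times)
          moreover have "{a..b} \<times> V' = ({a..b} \<times> V' \<union> {b..c} \<times> V') \<inter> ({a..b} \<times> UNIV)"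
            "{b..c} \<times> V' = ({a..b} \<times> V' \<union> {b..c} \<times> V') \<inter> ({b..c} \<times> UNIV)"
            using ab by auto
          ultimately show "closedin (top_of_set ({a..b} \<times> V' \<union> {b..c} \<times> V')) ({a..b} \<times> V')"
            "closedin (top_of_set ({a..b} \<times> V' \<union> {b..c} \<times> V')) ({b..c} \<times> V')"
            unfolding closedin_closed by blast+
        next show "continuous_on ({a..b} \<times> V') k" "continuous_on ({b..c} \<times> V') k'" by fact+ qed (use eq in blast)
        moreover have "?k ` ({a..c} \<times> V') \<subseteq> C" using k(2) k'(2) unfolding un by (auto simp: image_subset_iff)
        moreover have "\<forall>v\<in>V'. ?k (a, v) = g v" using k(3) ab by auto
        moreover have "\<forall>z\<in>{a..c} \<times> V'. p (?k z) = h z" using k(4) k'(4) unfolding un by auto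
        ultimately show "\<exists>k. continuous_on ({a..c} \<times> V') k \<and> k ` ({a..c} \<times> V') \<subseteq> C \<and>
            (\<forall>v\<in>V'. k (a, v) = g v) \<and> (\<forall>z\<in>{a..c} \<times> V'. p (k z) = h z)" by blast
      qed
    qed
  next
    fix x :: real assume x: "0 \<le> x" "x \<le> 1"
    have "h (x, y) \<in> S" using h x y by auto
    then obtain W \<Sigma> where W: "h (x, y) \<in> W" "openin (top_of_set S) W"
      and \<Sigma>': "\<forall>s\<in>\<Sigma>. continuous_on W s \<and> s ` W \<subseteq> C \<and> (\<forall>x\<in>W. p (s x) = x)"
        "\<forall>y\<in>C. p y \<in> W \<longrightarrow> (\<exists>!s. s \<in> \<Sigma> \<and> s (p y) = y)"
      by (rule covering_sections[OF cov])
    have \<Sigma>: "\<And>s. s \<in> \<Sigma> \<Longrightarrow> continuous_on W s \<and> s ` W \<subseteq> C \<and> (\<forall>x\<in>W. p (s x) = x)"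
        "\<And>y. y \<in> C \<Longrightarrow> p y \<in> W \<Longrightarrow> \<exists>!s. s \<in> \<Sigma> \<and> s (p y) = y"
      using \<Sigma>' by blast+
    have "openin (top_of_set ({0..1} \<times> U)) (({0..1} \<times> U) \<inter> h -` W)"
      by (rule continuous_openin_preimage[OF h(1) _ W(2)]) (use h in auto)
    then obtain O' where O': "open O'" "({0..1} \<times> U) \<inter> h -` W = ({0..1} \<times> U) \<inter> O'"
      by (auto simp: openin_open)
    have "(x, y) \<in> O'" using O' x y W by auto
    then obtain A B where AB: "open A" "open B" "x \<in> A" "y \<in> B" "A \<times> B \<subseteq> O'"
      using O'(1) by (metis mem_Times_iff open_prod_elim fst_conv snd_conv)
    obtain d where d: "d > 0" "\<And>t. \<bar>t - x\<bar> < d \<Longrightarrow> t \<in> A"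
      using AB(1,3) unfolding open_dist dist_real_def by metis
    show "\<exists>d>0. \<forall>a b. a \<le> x \<and> x \<le> b \<and> b - a < d \<longrightarrow> P a b"
    proof (intro exI[of _ d] conjI allI impI)
      show "d > 0" by fact
      fix a b assume ab: "a \<le> x \<and> x \<le> b \<and> b - a < d"
      show "P a b" unfolding P_def
      proof (intro impI exI[of _ "U \<inter> B"] conjI allI)
        assume ab': "0 \<le> a" "a \<le> b" "b \<le> 1"
        show "openin (top_of_set U) (U \<inter> B)" "y \<in> U \<inter> B" using AB y by auto
        fix V' c
        assume c: "V' \<subseteq> U \<inter> B \<and> continuous_on V' c \<and> c ` V' \<subseteq> C \<and> (\<forall>v\<in>V'. p (c v) = h (a, v))"
        have hW: "h (t, v) \<in> W" if "t \<in> {a..b}" "v \<in> V'" for t v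
        proof -
          have "t \<in> A" using d(2)[of t] that ab by auto
          then have "(t, v) \<in> ({0..1} \<times> U) \<inter> O'" using AB that c ab' by auto
          then show ?thesis using O'(2) by blast
        qed
        define s where "s v = (THE s. s \<in> \<Sigma> \<and> s (p (c v)) = c v)" for v
        have s: "s v \<in> \<Sigma> \<and> s v (h (a, v)) = c v" if "v \<in> V'" for v
        proof -
          have *: "c v \<in> C" "p (c v) = h (a, v)" using c that by auto
          have "p (c v) \<in> W" using * hW[of a v] that ab' by auto
          from theI'[OF \<Sigma>(2)[OF *(1) this]] show ?thesis unfolding s_def *(2) by simp
        qed
        have s_eq: "s v = t" if "v \<in> V'" "t \<in> \<Sigma>" "t (h (a, v)) = c v" for v t
        proof -
          have *: "c v \<in> C" "p (c v) = h (a, v)" using c that by auto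
          have "p (c v) \<in> W" using * hW[of a v] that ab' by auto
          from \<Sigma>(2)[OF *(1) this] s[OF that(1)] that(2,3) show ?thesis unfolding *(2) by blast
        qed
        let ?k = "\<lambda>(t, v). s v (h (t, v))"
        have hcont: "continuous_on ({a..b} \<times> V') h"
          by (rule continuous_on_subset[OF h(1)]) (use c ab' in auto)
        have "continuous_on ({a..b} \<times> V') ?k"
        proof (rule continuous_on_locallyI)
          fix z assume z: "z \<in> {a..b} \<times> V'"
          obtain t0 v0 where [simp]: "z = (t0, v0)" by force
          have v0: "v0 \<in> V'" using z by auto
          \<comment> \<open>Both \<open>c\<close> and \<open>s v0\<close> after
            \<open>h (a, _)\<close> lift the same map, so this set is open: the chosen section is
            locally constant in \<open>v\<close>. Near \<open>v0\<close> the candidate lift is thus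
            \<open>s v0\<close> after \<open>h\<close>, which is continuous.\<close>
          let ?E = "{v \<in> V'. s v0 (h (a, v)) = c v}"
          have "continuous_on V' (\<lambda>v. h (a, v))"
            by (rule continuous_on_compose2[OF hcont]) (use ab' in \<open>auto intro!: continuous_intros\<close>)
          then have cs: "continuous_on V' (\<lambda>v. s v0 (h (a, v)))"
            by (rule continuous_on_compose2[rotated, of _ _ W])
              (use \<Sigma>(1) s[OF v0] hW ab' in auto)
          have "openin (top_of_set V') ?E"
            by (rule covering_lifts_agree_openin[OF cov cs])
              (use \<Sigma>(1) s[OF v0] hW ab' c in \<open>auto simp: image_subset_iff\<close>)
          then obtain V0 where V0: "open V0" "?E = V' \<inter> V0" by (auto simp: openin_open)
          have "openin (top_of_set ({a..b} \<times> V')) ({a..b} \<times> ?E)"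
            unfolding openin_open V0(2)
            by (rule exI[of _ "UNIV \<times> V0"]) (use V0(1) in \<open>auto intro: open_Times\<close>)
          moreover have "z \<in> {a..b} \<times> ?E" using z s[OF v0] by auto
          moreover have "continuous_on ({a..b} \<times> ?E) ?k"
          proof (subst continuous_on_cong[OF refl])
            show "?k w = s v0 (h w)" if "w \<in> {a..b} \<times> ?E" for w
              using s_eq[of "snd w" "s v0"] that s[OF v0] by auto
            show "continuous_on ({a..b} \<times> ?E) (\<lambda>w. s v0 (h w))"
              by (rule continuous_on_compose2[of W "s v0"])
                (use \<Sigma>(1) s[OF v0] hW in \<open>auto intro: continuous_on_subset[OF hcont]\<close>)
          qed
          ultimately show "\<exists>B. openin (top_of_set ({a..b} \<times> V')) B \<and> z \<in> B \<and> continuous_on B ?k"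
            by blast
        qed
        moreover have "?k ` ({a..b} \<times> V') \<subseteq> C"
          using \<Sigma>(1) s hW by (auto simp: image_subset_iff)
        moreover have "\<forall>v\<in>V'. ?k (a, v) = c v" using s by auto
        moreover have "\<forall>z\<in>{a..b} \<times> V'. p (?k z) = h z"
          using \<Sigma>(1) s hW by auto
        ultimately show "\<exists>k. continuous_on ({a..b} \<times> V') k \<and> k ` ({a..b} \<times> V') \<subseteq> C \<and>
            (\<forall>v\<in>V'. k (a, v) = c v) \<and> (\<forall>z\<in>{a..b} \<times> V'. p (k z) = h z)" by blast
      qed
    qed
  qed
  then show ?thesis unfolding P_def by simp
qed

text \<open>Over a fixed \<open>v\<close>, any two strip lifts are lifts of the same path starting
  at \<open>c v\<close>, hence equal. The local lifts therefore agree on overlaps and glue.\<close>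

lemma covering_homotopy_lift:
  fixes h :: "real \<times> 'c::topological_space \<Rightarrow> 'a::topological_space"
  assumes cov: "covering_space C p S"
    and h: "continuous_on ({0..1} \<times> U) h" "h ` ({0..1} \<times> U) \<subseteq> S"
    and c: "continuous_on U c" "c ` U \<subseteq> C" "\<And>v. v \<in> U \<Longrightarrow> p (c v) = h (0, v)"
  obtains k where "continuous_on ({0..1} \<times> U) k" "k ` ({0..1} \<times> U) \<subseteq> C"
    "\<And>v. v \<in> U \<Longrightarrow> k (0, v) = c v" "\<And>z. z \<in> {0..1} \<times> U \<Longrightarrow> p (k z) = h z"
proof -
  define L where "L V k \<longleftrightarrow> continuous_on ({0..1} \<times> V) k \<and> k ` ({0..1} \<times> V) \<subseteq> C \<and>
      (\<forall>v\<in>V. k (0, v) = c v) \<and> (\<forall>z\<in>{0..1} \<times> V. p (k z) = h z)" for V k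
  have ex: "\<exists>V k. openin (top_of_set U) V \<and> y \<in> V \<and> L V k" if y: "y \<in> U" for y
  proof -
    obtain V where V: "openin (top_of_set U) V" "y \<in> V" and
       k: "\<And>V' c. V' \<subseteq> V \<and> continuous_on V' c \<and> c ` V' \<subseteq> C \<and> (\<forall>v\<in>V'. p (c v) = h (0, v)) \<Longrightarrow>
        \<exists>k. continuous_on ({0..1} \<times> V') k \<and> k ` ({0..1} \<times> V') \<subseteq> C \<and>
        (\<forall>v\<in>V'. k (0, v) = c v) \<and> (\<forall>z\<in>{0..1} \<times> V'. p (k z) = h z)"
      using covering_homotopy_lift_strip[OF cov h y] by auto
    have VU: "V \<subseteq> U" using V openin_imp_subset by blast
    have "\<exists>k. L V k" unfolding L_def
      by (rule k) (use c VU continuous_on_subset in \<open>auto simp: image_subset_iff\<close>)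
    then show ?thesis using V by blast
  qed
  have uniq: "k (t, v) = k' (t, v)" if L: "L V k" "L V' k'" and v: "v \<in> V" "v \<in> V'" and t: "t \<in> {0..1}"
    for V k V' k' v t
  proof (rule covering_lift_unique[OF cov, of "{0..1::real}" "\<lambda>t. k (t, v)" "\<lambda>t. k' (t, v)" 0 t])
    show "continuous_on {0..1} (\<lambda>t. k (t, v))" "continuous_on {0..1} (\<lambda>t. k' (t, v))"
      using L v unfolding L_def
      by (auto intro!: continuous_on_compose2[of "{0..1} \<times> V" k]
          continuous_on_compose2[of "{0..1} \<times> V'" k'] continuous_intros)
  qed (use L v t in \<open>auto simp: L_def image_subset_iff\<close>)
  define k where "k z = (SOME w. \<exists>V k. openin (top_of_set U) V \<and> snd z \<in> V \<and> L V k \<and> w = k z)" for z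
  have keq: "k (t, v) = k' (t, v)" if "openin (top_of_set U) V" "L V k'" "v \<in> V" "t \<in> {0..1}" for V k' v t
  proof -
    have "\<exists>w. \<exists>V k. openin (top_of_set U) V \<and> snd (t, v) \<in> V \<and> L V k \<and> w = k (t, v)"
      using that by auto
    from someI_ex[OF this] show ?thesis unfolding k_def[symmetric]
      using uniq that by fastforce
  qed
  show thesis
  proof (rule that)
    show "continuous_on ({0..1} \<times> U) k"
    proof (rule continuous_on_locallyI)
      fix z assume z: "z \<in> {0..1::real} \<times> U"
      then obtain V k' where V: "openin (top_of_set U) V" "snd z \<in> V" "L V k'" using ex[of "snd z"] by auto
      then obtain V0 where V0: "open V0" "V = U \<inter> V0" by (auto simp: openin_open)
      have "openin (top_of_set ({0..1} \<times> U)) ({0..1::real} \<times> V)"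
        unfolding openin_open V0(2)
        by (rule exI[of _ "UNIV \<times> V0"]) (use V0(1) in \<open>auto intro: open_Times\<close>)
      moreover have "continuous_on ({0..1} \<times> V) k"
      proof (subst continuous_on_cong[OF refl])
        show "k w = k' w" if "w \<in> {0..1} \<times> V" for w
          using keq[OF V(1,3), of "snd w" "fst w"] that by auto
        show "continuous_on ({0..1} \<times> V) k'" using V(3) by (simp add: L_def)
      qed
      ultimately show "\<exists>B. openin (top_of_set ({0..1} \<times> U)) B \<and> z \<in> B \<and> continuous_on B k"
        using z V by (intro exI[of _ "{0..1} \<times> V"]) (auto simp: mem_Times_iff)
    qed
    have all: "\<exists>V k'. v \<in> V \<and> L V k' \<and> (\<forall>t\<in>{0..1}. k (t, v) = k' (t, v))" if "v \<in> U" for v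
      using ex[OF that] keq by metis
    show "k ` ({0..1} \<times> U) \<subseteq> C" using all by (fastforce simp: L_def image_subset_iff)
    show "k (0, v) = c v" if "v \<in> U" for v using all[OF that] by (auto simp: L_def)
    show "p (k z) = h z" if "z \<in> {0..1} \<times> U" for z
      using all[of "snd z"] that by (cases z) (fastforce simp: L_def)
  qed
qed

text \<open>Contract \<open>U\<close> to \<open>z\<close> along segments. This is a homotopy from a
  constant map, which has the constant lift \<open>a\<close>, to \<open>f\<close>; the time
  \<open>1\<close> slice of the lifted homotopy lifts \<open>f\<close>.\<close>

lemma covering_lift_convex:
  fixes f :: "'c::real_normed_vector \<Rightarrow> 'a::topological_space"
  assumes cov: "covering_space C p S" and U: "convex U"
    and f: "continuous_on U f" "f ` U \<subseteq> S" and a: "z \<in> U" "a \<in> C" "p a = f z"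
  obtains g where "continuous_on U g" "g ` U \<subseteq> C" "g z = a" "\<And>y. y \<in> U \<Longrightarrow> p (g y) = f y"
proof -
  let ?m = "\<lambda>(t, y). (1 - t) *\<^sub>R z + t *\<^sub>R y"
  have m: "?m w \<in> U" if "w \<in> {0..1} \<times> U" for w
    using that U a(1) by (auto simp: convex_alt)
  have cm: "continuous_on ({0..1} \<times> U) ?m"
    unfolding case_prod_unfold by (intro continuous_intros)
  obtain k where k: "continuous_on ({0..1} \<times> U) k" "k ` ({0..1} \<times> U) \<subseteq> C"
    "\<And>v. v \<in> U \<Longrightarrow> k (0, v) = a" "\<And>w. w \<in> {0..1} \<times> U \<Longrightarrow> p (k w) = (f \<circ> ?m) w"
  proof (rule covering_homotopy_lift[OF cov, of U "f \<circ> ?m" "\<lambda>_. a"])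
    show "continuous_on ({0..1} \<times> U) (f \<circ> ?m)"
      by (rule continuous_on_compose[OF cm continuous_on_subset[OF f(1)]]) (use m in blast)
    show "(f \<circ> ?m) ` ({0..1} \<times> U) \<subseteq> S" using m f(2) by fastforce
  qed (use a in auto)
  \<comment> \<open>The contraction fixes \<open>z\<close>, so the lifted track of \<open>z\<close>
    lies over a constant path and never leaves \<open>a\<close>.\<close>
  have kz: "k (t, z) = a" if "t \<in> {0..1}" for t
  proof (rule covering_lift_unique[OF cov, of "{0..1::real}" "\<lambda>t. k (t, z)" "\<lambda>_. a" 0 t])
    show "continuous_on {0..1} (\<lambda>t. k (t, z))"
      by (rule continuous_on_compose2[OF k(1)]) (use a in \<open>auto intro!: continuous_intros\<close>)
    show "p (k (t, z)) = p a" if "t \<in> {0..1}" for t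
      using k(4)[of "(t, z)"] that a by (simp add: scaleR_left_distrib[symmetric])
  qed (use that k a in \<open>auto simp: image_subset_iff\<close>)
  show thesis
  proof (rule that[of "\<lambda>y. k (1, y)"])
    show "continuous_on U (\<lambda>y. k (1, y))"
      by (rule continuous_on_compose2[OF k(1)]) (auto intro!: continuous_intros)
    show "(\<lambda>y. k (1, y)) ` U \<subseteq> C" using k(2) by (auto simp: image_subset_iff)
    show "k (1, z) = a" using kz by auto
    show "p (k (1, y)) = f y" if "y \<in> U" for y using k(4)[of "(1, y)"] that by auto
  qed
qed

section \<open>Monodromy and the lifting criterion\<close>

text \<open>Simple connectedness is phrased by free homotopy of any two loops. Applied to the
  constant loops at two points, the track of the base point during the homotopy is a path between
  them.\<close>

lemma simply_connected_imp_path_connected_gen: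
  assumes "simply_connected X"
  shows "path_connected X"
  unfolding path_connected_def
proof (intro ballI)
  fix a b assume ab: "a \<in> X" "b \<in> X"
  have "homotopic_loops X (\<lambda>_. a) (\<lambda>_. b)"
    by (rule assms[unfolded simply_connected_def, rule_format])
      (use ab in \<open>auto simp: path_def path_image_def pathstart_def pathfinish_def\<close>)
  then obtain h where h: "continuous_on ({0..1::real} \<times> {0..1::real}) h" "h \<in> ({0..1} \<times> {0..1}) \<rightarrow> X"
      "\<forall>x\<in>{0..1}. h (0, x) = a" "\<forall>x\<in>{0..1}. h (1, x) = b"
    unfolding homotopic_loops by blast
  have "continuous_on {0..1} (\<lambda>t. h (t, 0))"
    by (rule continuous_on_compose2[OF h(1)]) (auto intro!: continuous_intros)
  then show "\<exists>g. path g \<and> path_image g \<subseteq> X \<and> pathstart g = a \<and> pathfinish g = b"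
    using h by (intro exI[of _ "\<lambda>t. h (t, 0)"])
      (auto simp: path_def path_image_def pathstart_def pathfinish_def Pi_iff)
qed

lemma simply_connected_imp_connected_gen: "simply_connected X \<Longrightarrow> connected X"
  by (simp add: simply_connected_imp_path_connected_gen path_connected_imp_connected)

lemma covering_path_lift:
  assumes cov: "covering_space C p S" and r: "path r" "path_image r \<subseteq> S"
    and a: "a \<in> C" "p a = pathstart r"
  obtains q where "path q" "path_image q \<subseteq> C" "pathstart q = a" "\<And>t. t \<in> {0..1} \<Longrightarrow> p (q t) = r t"
  by (rule covering_lift_convex[OF cov, of "{0..1}" r 0 a])
    (use assms in \<open>auto simp: path_def path_image_def pathstart_def\<close>)

lemma covering_path_lift_unique:
  assumes cov: "covering_space C p S" and q: "path q" "path_image q \<subseteq> C" and q': "path q'" "path_image q' \<subseteq> C"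
    and eq: "\<And>t. t \<in> {0..1} \<Longrightarrow> p (q t) = p (q' t)" and s: "s \<in> {0..1}" "q s = q' s" and t: "t \<in> {0..1}"
  shows "q t = q' t"
  by (rule covering_lift_unique[OF cov, of "{0..1}" q q' s t])
    (use assms in \<open>auto simp: path_def path_image_def\<close>)

lemma covering_square_lift:
  fixes h :: "real \<times> real \<Rightarrow> 'a::topological_space"
  assumes cov: "covering_space C p S"
    and h: "continuous_on ({0..1} \<times> {0..1}) h" "h ` ({0..1} \<times> {0..1}) \<subseteq> S"
    and q: "path q" "path_image q \<subseteq> C" "\<And>t. t \<in> {0..1} \<Longrightarrow> p (q t) = h (0, t)"
  obtains k where "continuous_on ({0..1} \<times> {0..1}) k" "k ` ({0..1} \<times> {0..1}) \<subseteq> C"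
    "\<And>t. t \<in> {0..1} \<Longrightarrow> k (0, t) = q t" "\<And>z. z \<in> {0..1} \<times> {0..1} \<Longrightarrow> p (k z) = h z"
  by (rule covering_homotopy_lift[OF cov h, of q])
    (use q in \<open>auto simp: path_def path_image_def\<close>)

lemma square_sections:
  fixes k :: "real \<times> real \<Rightarrow> 'a::topological_space"
  assumes k: "continuous_on ({0..1} \<times> {0..1}) k" "k ` ({0..1} \<times> {0..1}) \<subseteq> C" and s: "s \<in> {0..1}"
  shows "path (\<lambda>t. k (s, t))" "path_image (\<lambda>t. k (s, t)) \<subseteq> C"
    "path (\<lambda>t. k (t, s))" "path_image (\<lambda>t. k (t, s)) \<subseteq> C"
proof -
  have "continuous_on {0..1} (\<lambda>t. k (s, t))" "continuous_on {0..1} (\<lambda>t. k (t, s))"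
    by (rule continuous_on_compose2[OF k(1)], use s in \<open>auto intro!: continuous_intros\<close>)+
  then show "path (\<lambda>t. k (s, t))" "path (\<lambda>t. k (t, s))" by (auto simp: path_def)
qed (use k s in \<open>auto simp: path_image_def image_subset_iff\<close>)

text \<open>Lift the homotopy starting from \<open>q1\<close>. The sides of the square lie over the
  fixed endpoints, so they are constant, and the far edge is a lift of \<open>p \<circ> q2\<close>
  with the same start as \<open>q2\<close>.\<close>

lemma covering_monodromy:
  assumes cov: "covering_space C p S"
    and q1: "path q1" "path_image q1 \<subseteq> C" and q2: "path q2" "path_image q2 \<subseteq> C"
    and start: "pathstart q1 = pathstart q2"
    and hom: "homotopic_paths S (p \<circ> q1) (p \<circ> q2)"
  shows "pathfinish q1 = pathfinish q2"
proof -
  obtain h where h: "continuous_on ({0..1} \<times> {0..1}) h" "h ` ({0..1} \<times> {0..1}) \<subseteq> S"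
      "\<forall>x\<in>{0..1}. h (0, x) = (p \<circ> q1) x" "\<forall>x\<in>{0..1}. h (1, x) = (p \<circ> q2) x"
      "\<forall>t\<in>{0..1::real}. pathstart (h \<circ> Pair t) = pathstart (p \<circ> q1) \<and> pathfinish (h \<circ> Pair t) = pathfinish (p \<circ> q1)"
    using hom unfolding homotopic_paths by (auto simp: image_subset_iff_funcset)
  obtain k where k: "continuous_on ({0..1} \<times> {0..1}) k" "k ` ({0..1} \<times> {0..1}) \<subseteq> C"
    "\<And>t. t \<in> {0..1} \<Longrightarrow> k (0, t) = q1 t" "\<And>z. z \<in> {0..1} \<times> {0..1} \<Longrightarrow> p (k z) = h z"
    by (rule covering_square_lift[OF cov h(1,2) q1]) (use h(3) in auto)
  note sec = square_sections[OF k(1,2)]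
  have h0: "h (t, 0) = p (q1 0)" "h (t, 1) = p (q1 1)" if "t \<in> {0..1}" for t
    using h(5) that by (auto simp: pathstart_def pathfinish_def)
  have const: "k (1, s) = q1 s" if s: "s \<in> {0, 1}" for s
  proof -
    have s': "s \<in> {0..1}" using s by auto
    show ?thesis
      by (rule covering_path_lift_unique[OF cov, of "\<lambda>t. k (t, s)" "\<lambda>_. q1 s" 0 1])
        (use sec[OF s'] s s' k(3,4) h0 q1 in \<open>auto simp: path_def path_image_def\<close>)
  qed
  have "k (1, 1) = q2 1"
    by (rule covering_path_lift_unique[OF cov, of "\<lambda>t. k (1, t)" q2 0 1])
      (use sec[of 1] q2 h(4) k(4) const[of 0] start in \<open>auto simp: pathstart_def\<close>)
  then show ?thesis using const[of 1] by (simp add: pathfinish_def)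
qed

text \<open>Lift a free contraction of the loop. The last edge lies over a constant and is therefore
  constant. The two sides lie over one and the same path, since every stage is a loop; agreeing at
  the last edge, they agree at the first, which says that \<open>q\<close> closes.\<close>

lemma covering_lift_loop_closed:
  fixes f :: "'c::topological_space \<Rightarrow> 'a::topological_space"
  assumes cov: "covering_space C p S" and X: "simply_connected X"
    and f: "continuous_on X f" "f ` X \<subseteq> S"
    and r: "path r" "path_image r \<subseteq> X" "pathfinish r = pathstart r"
    and q: "path q" "path_image q \<subseteq> C" "\<And>t. t \<in> {0..1} \<Longrightarrow> p (q t) = f (r t)"
  shows "pathfinish q = pathstart q"
proof -
  have z: "pathstart r \<in> X" using r(2) pathstart_in_path_image by blast
  have "homotopic_loops X r (\<lambda>_. pathstart r)"
    by (rule X[unfolded simply_connected_def, rule_format])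
      (use r z in \<open>auto simp: path_def path_image_def pathstart_def pathfinish_def\<close>)
  then obtain h where h: "continuous_on ({0..1::real} \<times> {0..1::real}) h" "h ` ({0..1} \<times> {0..1}) \<subseteq> X"
      "\<forall>x\<in>{0..1}. h (0, x) = r x" "\<forall>x\<in>{0..1}. h (1, x) = pathstart r"
      "\<forall>t\<in>{0..1}. pathfinish (h \<circ> Pair t) = pathstart (h \<circ> Pair t)"
    unfolding homotopic_loops by (auto simp: image_subset_iff_funcset)
  have fh: "continuous_on ({0..1} \<times> {0..1}) (f \<circ> h)" "(f \<circ> h) ` ({0..1} \<times> {0..1}) \<subseteq> S"
    using f(2) h(2) continuous_on_compose[OF h(1) continuous_on_subset[OF f(1) h(2)]]
    by (auto simp: image_subset_iff)
  obtain k where k: "continuous_on ({0..1} \<times> {0..1}) k" "k ` ({0..1} \<times> {0..1}) \<subseteq> C"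
    "\<And>t. t \<in> {0..1} \<Longrightarrow> k (0, t) = q t" "\<And>z. z \<in> {0..1} \<times> {0..1} \<Longrightarrow> p (k z) = (f \<circ> h) z"
    by (rule covering_square_lift[OF cov fh q(1,2)]) (use h(3) q(3) in auto)
  note sec = square_sections[OF k(1,2)]
  have "k (1, 1) = k (1, 0)"
    by (rule covering_path_lift_unique[OF cov, of "\<lambda>t. k (1, t)" "\<lambda>_. k (1, 0)" 0 1])
      (use sec[of 1] k(2,4) h(4) in \<open>auto simp: path_def path_image_def image_subset_iff\<close>)
  then have "k (0, 1) = k (0, 0)"
    by (intro covering_path_lift_unique[OF cov, of "\<lambda>t. k (t, 1)" "\<lambda>t. k (t, 0)" 1 0])
      (use sec[of 0] sec[of 1] k(4) h(5) in \<open>auto simp: pathstart_def pathfinish_def\<close>)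
  then show ?thesis using k(3) by (simp add: pathstart_def pathfinish_def)
qed

text \<open>The loop made of \<open>r1\<close> and the reverse of \<open>r2\<close> lifts to a
  closed path; its first half is \<open>q1\<close> and its second half, run backwards, is
  \<open>q2\<close>. Both therefore end at the point halfway.\<close>

lemma covering_lift_end_unique:
  fixes f :: "'c::topological_space \<Rightarrow> 'a::topological_space"
  assumes cov: "covering_space C p S" and X: "simply_connected X"
    and f: "continuous_on X f" "f ` X \<subseteq> S"
    and r1: "path r1" "path_image r1 \<subseteq> X" and r2: "path r2" "path_image r2 \<subseteq> X"
    and r12: "pathstart r1 = pathstart r2" "pathfinish r1 = pathfinish r2"
    and q1: "path q1" "path_image q1 \<subseteq> C" "\<And>t. t \<in> {0..1} \<Longrightarrow> p (q1 t) = f (r1 t)"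
    and q2: "path q2" "path_image q2 \<subseteq> C" "\<And>t. t \<in> {0..1} \<Longrightarrow> p (q2 t) = f (r2 t)"
    and q12: "pathstart q1 = pathstart q2"
  shows "pathfinish q1 = pathfinish q2"
proof -
  let ?r = "r1 +++ reversepath r2"
  have r: "path ?r" "path_image ?r \<subseteq> X" "pathfinish ?r = pathstart ?r"
    using r1 r2 r12 by (simp_all add: subset_path_image_join)
  have fr: "path (f \<circ> ?r)" "path_image (f \<circ> ?r) \<subseteq> S"
    using r f by (auto simp: path_image_compose intro!: path_continuous_image intro: continuous_on_subset)
  have a: "pathstart q1 \<in> C" "p (pathstart q1) = pathstart (f \<circ> ?r)"
    using q1 by (auto simp: path_image_def pathstart_def joinpaths_def)
  obtain q where q: "path q" "path_image q \<subseteq> C" "pathstart q = pathstart q1"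
      "\<And>t. t \<in> {0..1} \<Longrightarrow> p (q t) = (f \<circ> ?r) t"
    by (rule covering_path_lift[OF cov fr a]) blast
  have closed: "q 1 = q 0"
    using covering_lift_loop_closed[OF cov X f r q(1,2)] q(4) by (simp add: pathstart_def pathfinish_def)
  have "q (1/2) = q1 1"
  proof (rule covering_path_lift_unique[OF cov, of "\<lambda>t. q (t / 2)" q1 0 1, simplified])
    show "path (\<lambda>t. q (t / 2))" unfolding path_def
      by (rule continuous_on_compose2[OF q(1)[unfolded path_def]]) (auto intro!: continuous_intros)
    show "path_image (\<lambda>t. q (t / 2)) \<subseteq> C" using q(2) by (auto simp: path_image_def image_subset_iff)
    show "p (q (t / 2)) = p (q1 t)" if "0 \<le> t \<and> t \<le> 1" for t
      using q(4)[of "t / 2"] q1(3)[of t] that by (auto simp: joinpaths_def)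
  qed (use q1 q(3) in \<open>auto simp: pathstart_def\<close>)
  moreover have "q (1/2) = q2 1"
  \<comment> \<open>The reversed second half starts at \<open>q 1\<close>, which is the common start
    because the lift is closed. At \<open>t = 1\<close> the join is evaluated by its first path,
    hence the separate case below, which uses that \<open>r1\<close> and \<open>r2\<close> end
    together.\<close>
  proof (rule covering_path_lift_unique[OF cov, of "\<lambda>t. q (1 - t / 2)" q2 0 1, simplified])
    show "path (\<lambda>t. q (1 - t / 2))" unfolding path_def
      by (rule continuous_on_compose2[OF q(1)[unfolded path_def]]) (auto intro!: continuous_intros)
    show "path_image (\<lambda>t. q (1 - t / 2)) \<subseteq> C" using q(2) by (auto simp: path_image_def image_subset_iff)
    show "p (q (1 - t / 2)) = p (q2 t)" if "0 \<le> t \<and> t \<le> 1" for t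
      using q(4)[of "1 - t / 2"] q2(3)[of t] that r12(2)
      by (cases "t = 1") (auto simp: joinpaths_def reversepath_def pathfinish_def field_simps)
  qed (use q2 q(3) closed q12 in \<open>auto simp: pathstart_def\<close>)
  ultimately show ?thesis by (simp add: pathfinish_def)
qed

text \<open>The value at \<open>y\<close> is the end of the lift of any path from \<open>z\<close>
  to \<open>y\<close>. Simple connectedness makes it independent of the path, local path
  connectedness makes it continuous.\<close>

lemma covering_lift_simply_connected:
  fixes f :: "'c::topological_space \<Rightarrow> 'a::topological_space"
  assumes cov: "covering_space C p S" and X: "simply_connected X" "locally path_connected X"
    and f: "continuous_on X f" "f ` X \<subseteq> S" and a: "z \<in> X" "a \<in> C" "p a = f z"
  obtains g where "continuous_on X g" "g ` X \<subseteq> C" "g z = a" "\<And>y. y \<in> X \<Longrightarrow> p (g y) = f y"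
proof -
  define E where "E y r q \<longleftrightarrow> path r \<and> path_image r \<subseteq> X \<and> pathstart r = z \<and> pathfinish r = y \<and>
      path q \<and> path_image q \<subseteq> C \<and> pathstart q = a \<and> (\<forall>t\<in>{0..1}. p (q t) = f (r t))" for y r q
  have ex: "\<exists>r q. E y r q" if y: "y \<in> X" for y
  proof -
    have "path_connected X" using X simply_connected_imp_path_connected_gen by blast
    then have "\<exists>r. path r \<and> path_image r \<subseteq> X \<and> pathstart r = z \<and> pathfinish r = y"
      unfolding path_connected_def using a(1) y by (elim ballE) auto
    then obtain r where r: "path r" "path_image r \<subseteq> X" "pathstart r = z" "pathfinish r = y"
      by (elim exE conjE)
    have "path (f \<circ> r)" "path_image (f \<circ> r) \<subseteq> S"
      using r f by (auto simp: path_image_compose intro!: path_continuous_image intro: continuous_on_subset)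
    moreover have "p a = pathstart (f \<circ> r)" using a r by (simp add: pathstart_compose)
    ultimately obtain q where "path q" "path_image q \<subseteq> C" "pathstart q = a" "\<And>t. t \<in> {0..1} \<Longrightarrow> p (q t) = (f \<circ> r) t"
      by (rule covering_path_lift[OF cov _ _ a(2)]) blast
    then show ?thesis using r unfolding E_def by (intro exI[of _ r] exI[of _ q]) auto
  qed
  have uniq: "pathfinish q1 = pathfinish q2" if "E y r1 q1" "E y r2 q2" for y r1 q1 r2 q2
    by (rule covering_lift_end_unique[OF cov X(1) f, of r1 r2]) (use that in \<open>auto simp: E_def\<close>)
  define g where "g y = pathfinish (SOME q. \<exists>r. E y r q)" for y
  have g: "g y = pathfinish q" if "E y r q" for y r q
  proof -
    have "\<exists>q. \<exists>r. E y r q" using that by blast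
    from someI_ex[OF this] show ?thesis unfolding g_def using uniq that by blast
  qed
  have gC: "g y \<in> C" "p (g y) = f y" if y: "y \<in> X" for y
  proof -
    obtain r q where E: "E y r q" using ex[OF y] by blast
    then show "g y \<in> C" "p (g y) = f y"
      using g[OF E] E pathfinish_in_path_image[of q] unfolding E_def by (auto simp: pathfinish_def)
  qed
  show thesis
  proof (rule that)
    show "g ` X \<subseteq> C" "\<And>y. y \<in> X \<Longrightarrow> p (g y) = f y" using gC by auto
    have "E z (\<lambda>_. z) (\<lambda>_. a)" unfolding E_def
      using a by (auto simp: path_def path_image_def pathstart_def pathfinish_def)
    then show "g z = a" using g by (fastforce simp: pathfinish_def)
    show "continuous_on X g"
    proof (rule continuous_on_locallyI)
      fix y assume y: "y \<in> X"
      have "f y \<in> S" using f y by auto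
      then obtain W \<Sigma> where W: "f y \<in> W" "openin (top_of_set S) W"
        and \<Sigma>: "\<forall>s\<in>\<Sigma>. continuous_on W s \<and> s ` W \<subseteq> C \<and> (\<forall>x\<in>W. p (s x) = x)"
          "\<forall>y\<in>C. p y \<in> W \<longrightarrow> (\<exists>!s. s \<in> \<Sigma> \<and> s (p y) = y)"
        by (rule covering_sections[OF cov])
      obtain s where s: "s \<in> \<Sigma>" "s (f y) = g y" using \<Sigma>(2) gC[OF y] W(1) by metis
      have "openin (top_of_set X) (X \<inter> f -` W)"
        by (rule continuous_openin_preimage[OF f(1) _ W(2)]) (use f in auto)
      then obtain V where V: "openin (top_of_set X) V" "path_connected V" "y \<in> V" "V \<subseteq> X \<inter> f -` W"
        using X(2) y W(1) unfolding locally_path_connected by (metis IntI vimage_eq)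
      \<comment> \<open>A path to \<open>y\<close> extended inside \<open>V\<close> lifts by
        following the section \<open>s\<close>, so near \<open>y\<close> the map \<open>g\<close> is
        a section composed with \<open>f\<close>.\<close>
      have "g v = s (f v)" if v: "v \<in> V" for v
      proof -
        obtain r q where E: "E y r q" using ex[OF y] by blast
        obtain r' where r': "path r'" "path_image r' \<subseteq> V" "pathstart r' = y" "pathfinish r' = v"
          using V(2,3) v unfolding path_connected_def by metis
        have im: "path_image r' \<subseteq> X" "f ` path_image r' \<subseteq> W" using r'(2) V(4) by auto
        let ?q' = "s \<circ> (f \<circ> r')"
        have "continuous_on (f ` path_image r') s"
          using \<Sigma>(1) s(1) im(2) continuous_on_subset by blast
        then have q': "path ?q'" "path_image ?q' \<subseteq> C"
          using \<Sigma>(1) s(1) im f(1) r'(1)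
          by (auto simp: path_image_compose image_subset_iff intro!: path_continuous_image
              intro: continuous_on_subset)
        have jn: "pathfinish q = pathstart ?q'"
          using g[OF E] s(2) r'(3) by (simp add: pathstart_def)
        have pq': "p (?q' t) = f (r' t)" if "t \<in> {0..1}" for t
          using \<Sigma>(1) s(1) im that by (auto simp: path_image_def image_subset_iff)
        have "E v (r +++ r') (q +++ ?q')" unfolding E_def
        proof (intro conjI ballI)
          fix t :: real assume t: "t \<in> {0..1}"
          show "p ((q +++ ?q') t) = f ((r +++ r') t)"
            using E pq'[of "2 * t - 1"] t unfolding E_def by (auto simp: joinpaths_def)
        qed (use E r' q' jn im in \<open>simp_all add: E_def subset_path_image_join\<close>)
        then show ?thesis using g[of v] r'(4) by (auto simp: pathfinish_def joinpaths_def)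
      qed
      moreover have "continuous_on V (\<lambda>v. s (f v))"
        by (rule continuous_on_compose2[of W s])
          (use \<Sigma>(1) s(1) V(4) in \<open>auto intro: continuous_on_subset[OF f(1)]\<close>)
      ultimately have "continuous_on V g" by (simp cong: continuous_on_cong)
      then show "\<exists>B. openin (top_of_set X) B \<and> y \<in> B \<and> continuous_on B g" using V by blast
    qed
  qed
qed

section \<open>Deck transformations\<close>

text \<open>Lift \<open>p\<close> through itself, once sending \<open>x\<close> to \<open>x'\<close>
  and once back. The two composites are lifts of \<open>p\<close> that fix a point, as the identity
  does.\<close>

lemma deck_transformation_exists:
  assumes cov: "covering_space C p S" and C: "simply_connected C" "locally path_connected C"
    and x: "x \<in> C" "x' \<in> C" "p x' = p x"
  obtains g g' where "homeomorphism C C g g'" "\<And>y. y \<in> C \<Longrightarrow> p (g y) = p y" "g x = x'"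
proof -
  have p: "continuous_on C p" "p ` C \<subseteq> S" using cov by (auto simp: covering_space_def)
  have conn: "connected C" using C simply_connected_imp_connected_gen by blast
  obtain g where g: "continuous_on C g" "g ` C \<subseteq> C" "g x = x'" "\<And>y. y \<in> C \<Longrightarrow> p (g y) = p y"
    by (rule covering_lift_simply_connected[OF cov C p x(1,2,3)]) blast
  obtain g' where g': "continuous_on C g'" "g' ` C \<subseteq> C" "g' x' = x" "\<And>y. y \<in> C \<Longrightarrow> p (g' y) = p y"
    by (rule covering_lift_simply_connected[OF cov C p x(2,1) x(3)[symmetric]]) blast
  have "g' (g y) = y" if "y \<in> C" for y
    by (rule covering_lift_unique[OF cov conn, of "\<lambda>y. g' (g y)" "\<lambda>y. y" x y])
      (use g g' x that in \<open>auto intro!: continuous_on_compose2[OF g'(1) g(1)] simp: image_subset_iff\<close>)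
  moreover have "g (g' y) = y" if "y \<in> C" for y
    by (rule covering_lift_unique[OF cov conn, of "\<lambda>y. g (g' y)" "\<lambda>y. y" x' y])
      (use g g' x that in \<open>auto intro!: continuous_on_compose2[OF g(1) g'(1)] simp: image_subset_iff\<close>)
  ultimately have "homeomorphism C C g g'"
    using g g' by (intro homeomorphismI) (auto simp: image_subset_iff)
  then show thesis using that g by blast
qed

text \<open>Since \<open>deck_of\<close> is a choice, the given \<open>g\<close> has to be recovered
  from it. With \<open>\<gamma>\<close> the class of the projection of a path from \<open>x\<close>
  to \<open>g x\<close>, monodromy forces every admissible choice to send \<open>x\<close> to
  \<open>g x\<close>, and uniqueness of lifts forces it to equal \<open>g\<close> on
  \<open>C\<close>.\<close>

lemma deck_of_realizes:
  assumes cov: "covering_space C p M" and C: "simply_connected C" and x: "x \<in> C"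
    and g: "homeomorphism C C g g'" "\<And>y. y \<in> C \<Longrightarrow> p (g y) = p y"
  obtains \<gamma> where "\<gamma> \<in> carrier (fundamental_group M (p x))" "\<And>y. y \<in> C \<Longrightarrow> deck_of C p x \<gamma> y = g y"
proof -
  have p: "continuous_on C p" "p ` C \<subseteq> M" using cov by (auto simp: covering_space_def)
  have gx: "g x \<in> C" using g(1) x by (auto simp: homeomorphism_def)
  obtain f where f: "path f" "path_image f \<subseteq> C" "pathstart f = x" "pathfinish f = g x"
    using simply_connected_imp_path_connected_gen[OF C] x gx unfolding path_connected_def by metis
  have pf: "path (p \<circ> f)" "path_image (p \<circ> f) \<subseteq> M"
    using p f by (auto simp: path_image_compose intro!: path_continuous_image intro: continuous_on_subset)
  define \<gamma> where "\<gamma> = Collect (homotopic_paths M (p \<circ> f))"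
  have \<gamma>: "\<gamma> \<in> carrier (fundamental_group M (p x))"
    unfolding \<gamma>_def fundamental_group_def using pf f g(2)[OF x]
    by (auto simp: pathstart_compose pathfinish_compose intro!: exI[of _ "p \<circ> f"])
  let ?P = "\<lambda>g. (\<exists>g'. homeomorphism C C g g') \<and> (\<forall>y\<in>C. p (g y) = p y) \<and>
     (\<exists>f. path f \<and> path_image f \<subseteq> C \<and> pathstart f = x \<and> p \<circ> f \<in> \<gamma> \<and> g x = pathfinish f)"
  have "?P g"
    using g f pf by (auto simp: \<gamma>_def intro!: exI[of _ f])
  then have "?P (deck_of C p x \<gamma>)" unfolding deck_of_def by (rule someI[where P = ?P])
  then obtain d' f2 where d: "homeomorphism C C (deck_of C p x \<gamma>) d'" "\<forall>y\<in>C. p (deck_of C p x \<gamma> y) = p y"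
      and f2: "path f2" "path_image f2 \<subseteq> C" "pathstart f2 = x" "p \<circ> f2 \<in> \<gamma>" "deck_of C p x \<gamma> x = pathfinish f2"
    by blast
  have "pathfinish f = pathfinish f2"
    by (rule covering_monodromy[OF cov f(1,2) f2(1,2)]) (use f f2 in \<open>auto simp: \<gamma>_def\<close>)
  then have dx: "deck_of C p x \<gamma> x = g x" using f f2 by simp
  have "deck_of C p x \<gamma> y = g y" if "y \<in> C" for y
    by (rule covering_lift_unique[OF cov simply_connected_imp_connected_gen[OF C], of _ _ x])
      (use d g dx x that in \<open>auto simp: homeomorphism_def\<close>)
  then show thesis using that \<gamma> by blast
qed

section \<open>Manifold boundaries and their lifts\<close>

lemma half_space_chart_subset:
  assumes "half_space_chart M U f" "openin (top_of_set M) U'" "U' \<subseteq> U"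
  shows "half_space_chart M U' f"
proof -
  obtain V g where V: "openin (top_of_set half_space) V" "homeomorphism U V f g" and U: "openin (top_of_set M) U"
    using assms(1) unfolding half_space_chart_def by blast
  have "openin (top_of_set U) U'"
    by (rule openin_subset_trans[OF assms(2,3) openin_imp_subset[OF U]])
  then have "openin (top_of_set V) (f ` U')" by (rule homeomorphism_imp_open_map[OF V(2)])
  then have "openin (top_of_set half_space) (f ` U')" using V(1) openin_trans by blast
  moreover have "homeomorphism U' (f ` U') f g"
    by (rule homeomorphism_of_subsets[OF V(2) assms(3) order_refl])
      (use assms(3) V(2) in \<open>auto simp: homeomorphism_def\<close>)
  ultimately show ?thesis using assms(2) unfolding half_space_chart_def by blast
qed

lemma half_space_chart_homeomorphism:
  assumes "half_space_chart M v f" "homeomorphism u v p q" "openin (top_of_set C) u"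
  shows "half_space_chart C u (f \<circ> p)"
  using assms unfolding half_space_chart_def by (meson homeomorphism_compose)

lemma local_chart_transfer:
  assumes pq: "homeomorphism u v p q" and u: "openin (top_of_set C) u" and v: "openin (top_of_set M) v"
    and y: "y \<in> u" and U: "p y \<in> U" "half_space_chart M U f"
  shows "\<exists>U'. y \<in> U' \<and> half_space_chart C U' (f \<circ> p)"
proof -
  have oU: "openin (top_of_set M) U" using U unfolding half_space_chart_def by blast
  have "openin (top_of_set v) (v \<inter> U)"
    using oU v by (metis openin_Int openin_imp_subset openin_subset_trans inf_le1)
  then have "openin (top_of_set u) (q ` (v \<inter> U))"
    by (rule homeomorphism_imp_open_map[OF homeomorphism_symD[OF pq]])
  then have o: "openin (top_of_set C) (q ` (v \<inter> U))" using u openin_trans by blast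
  have hq: "homeomorphism (v \<inter> U) (q ` (v \<inter> U)) q p"
    by (rule homeomorphism_of_subsets[OF homeomorphism_symD[OF pq] _ order_refl])
      (use pq in \<open>auto simp: homeomorphism_def\<close>)
  have "half_space_chart M (v \<inter> U) f"
    by (rule half_space_chart_subset[OF U(2) openin_Int[OF v oU]]) auto
  then have "half_space_chart C (q ` (v \<inter> U)) (f \<circ> p)"
    by (rule half_space_chart_homeomorphism[OF _ homeomorphism_symD[OF hq] o])
  moreover have "y \<in> q ` (v \<inter> U)"
    using pq y U(1) by (auto simp: homeomorphism_def intro!: image_eqI[of _ _ "p y"])
  ultimately show ?thesis by (intro exI conjI)
qed

lemma manifold_boundary_transfer:
  assumes pq: "homeomorphism u v p q" and uv: "openin (top_of_set C) u" "openin (top_of_set M) v" "y \<in> u"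
    and b: "p y \<in> manifold_boundary M"
  shows "y \<in> manifold_boundary C"
proof -
  obtain U f where U: "p y \<in> U" "half_space_chart M U f" "f (p y) $ 1 = 0"
    using b unfolding manifold_boundary_def by blast
  have "y \<in> C" using uv openin_imp_subset by blast
  moreover obtain U' where "y \<in> U'" "half_space_chart C U' (f \<circ> p)"
    using local_chart_transfer[OF pq uv U(1,2)] by (elim exE conjE)
  ultimately show ?thesis
    using U(3) unfolding manifold_boundary_def by (auto intro!: exI[of _ U'] exI[of _ "f \<circ> p"])
qed

lemma manifold_boundary_local_homeomorphism:
  assumes pq: "homeomorphism u v p q" and uv: "openin (top_of_set C) u" "openin (top_of_set M) v" "y \<in> u"
  shows "y \<in> manifold_boundary C \<longleftrightarrow> p y \<in> manifold_boundary M"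
proof -
  have "p y \<in> v" "q (p y) = y" using assms by (auto simp: homeomorphism_def)
  then show ?thesis
    using manifold_boundary_transfer[OF pq uv]
      manifold_boundary_transfer[OF homeomorphism_symD[OF pq] uv(2,1), of "p y"] by auto
qed

lemma manifold_boundary_covering:
  assumes "covering_space C p M" "y \<in> C"
  shows "y \<in> manifold_boundary C \<longleftrightarrow> p y \<in> manifold_boundary M"
proof -
  obtain u v q where "y \<in> u" "openin (top_of_set C) u" "openin (top_of_set M) v" "homeomorphism u v p q"
    using covering_space_local_homeomorphism[OF assms] by metis
  then show ?thesis using manifold_boundary_local_homeomorphism by blast
qed

lemma manifold_boundary_covering_eq:
  assumes "covering_space C p M"
  shows "manifold_boundary C = C \<inter> p -` manifold_boundary M"
proof -
  have "manifold_boundary C \<subseteq> C" by (auto simp: manifold_boundary_def)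
  then show ?thesis using manifold_boundary_covering[OF assms] by blast
qed

text \<open>The chart clause of \<open>three_manifold\<close> by itself, in a form that can be
  transported from \<open>M\<close> to the cover.\<close>

definition locally_half_space :: "'a::topological_space set \<Rightarrow> bool" where
  "locally_half_space M \<longleftrightarrow> (\<forall>x\<in>M. \<exists>U f. x \<in> U \<and> half_space_chart M U f)"

lemma locally_half_space_covering:
  assumes cov: "covering_space C p M" and M: "locally_half_space M"
  shows "locally_half_space C"
  unfolding locally_half_space_def
proof
  fix y assume y: "y \<in> C"
  obtain u v q where u: "homeomorphism u v p q" "openin (top_of_set C) u" "openin (top_of_set M) v" "y \<in> u"
    using covering_space_local_homeomorphism[OF cov y] by metis
  have "p y \<in> M" using cov y by (auto simp: covering_space_def)
  then obtain U f where "p y \<in> U" "half_space_chart M U f" using M unfolding locally_half_space_def by blast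
  then show "\<exists>U f. y \<in> U \<and> half_space_chart C U f" using local_chart_transfer[OF u] by blast
qed

section \<open>Invariance of the boundary and half-ball neighbourhoods\<close>

text \<open>\<open>manifold_boundary\<close> asks for only one chart with vanishing first
  coordinate. If another chart put the point into the open half-space, the transition map would, by
  invariance of domain, have an open image around a point of the bounding plane, and this image
  would leave the half-space.\<close>

lemma chart_boundary_coordinate:
  assumes U: "half_space_chart M U f" and y: "y \<in> U" "y \<in> manifold_boundary M"
  shows "f y $ 1 = 0"
proof (rule ccontr)
  assume n0: "f y $ 1 \<noteq> 0"
  obtain V g where V: "openin (top_of_set half_space) V" "homeomorphism U V f g" and oU: "openin (top_of_set M) U"
    using U unfolding half_space_chart_def by blast
  obtain U' f' where U': "y \<in> U'" "half_space_chart M U' f'" "f' y $ 1 = 0"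
    using y unfolding manifold_boundary_def by blast
  obtain V' g' where V': "openin (top_of_set half_space) V'" "homeomorphism U' V' f' g'" and oU': "openin (top_of_set M) U'"
    using U' unfolding half_space_chart_def by blast
  have "half_space_chart M (U \<inter> U') f" using U oU' oU by (intro half_space_chart_subset[OF U]) auto
  then obtain V1 g1 where V1: "openin (top_of_set half_space) V1" "homeomorphism (U \<inter> U') V1 f g1"
    unfolding half_space_chart_def by blast
  define S where "S = V1 \<inter> {z. 0 < z $ 1}"
  obtain W where W: "open W" "V1 = half_space \<inter> W" using V1(1) by (auto simp: openin_open)
  have "S = W \<inter> {z. 0 < z $ 1}" unfolding S_def W half_space_def by auto
  moreover have "open {z::real^3. 0 < z $ 1}"
    by (intro open_Collect_less continuous_intros)
  ultimately have oS: "open S" using W(1) by auto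
  have S1: "g1 z \<in> U'" "f (g1 z) = z" if "z \<in> S" for z
    using V1(2) that unfolding S_def homeomorphism_def by auto
  have "open ((f' \<circ> g1) ` S)"
  proof (rule invariance_of_domain[OF _ oS])
    have "continuous_on S g1"
      using V1(2) unfolding S_def homeomorphism_def by (auto intro: continuous_on_subset)
    moreover have "continuous_on (g1 ` S) f'"
      using V'(2) S1 unfolding homeomorphism_def by (auto intro: continuous_on_subset)
    ultimately show "continuous_on S (f' \<circ> g1)" by (rule continuous_on_compose)
    show "inj_on (f' \<circ> g1) S"
    proof (rule inj_onI)
      fix a b assume ab: "a \<in> S" "b \<in> S" "(f' \<circ> g1) a = (f' \<circ> g1) b"
      then have "g1 a = g1 b" using V'(2) S1(1) unfolding homeomorphism_def by (metis comp_apply)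
      then show "a = b" using S1(2) ab by metis
    qed
  qed
  have fy: "f y \<in> V1" "g1 (f y) = y" using V1(2) y(1) U'(1) by (auto simp: homeomorphism_def)
  then have "0 \<le> f y $ 1" using W(2) by (auto simp: half_space_def)
  then have "f y \<in> S" using n0 fy by (auto simp: S_def)
  then have "f' y \<in> (f' \<circ> g1) ` S" using fy(2) by (auto intro!: image_eqI[of _ _ "f y"])
  then obtain e where e: "e > 0" "ball (f' y) e \<subseteq> (f' \<circ> g1) ` S"
    using \<open>open ((f' \<circ> g1) ` S)\<close> by (meson openE)
  \<comment> \<open>A point of the ball pushed strictly below the bounding plane; the factor
    \<open>1/2\<close> keeps it inside the open ball.\<close>
  let ?w = "f' y - axis 1 (e / 2)"
  have "norm (axis 1 (e/2) :: real^3) = e / 2" using e(1) by (simp add: norm_eq_sqrt_inner inner_axis_axis real_sqrt_divide)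
  then have "?w \<in> ball (f' y) e" using e(1) by (simp add: dist_norm)
  then have "?w \<in> (f' \<circ> g1) ` S" using e by blast
  then have "?w \<in> half_space"
    using S1(1) V' openin_imp_subset[OF V'(1)] unfolding homeomorphism_def by auto
  then show False using U'(3) e(1) by (simp add: half_space_def axis_def)
qed

text \<open>Pull back a half-ball: it is convex, and so is its possibly empty intersection with the
  bounding plane. Connectedness of the boundary part ensures later that one sheet over such a set
  meets at most one boundary component of the cover.\<close>

lemma half_ball_neighbourhood:
  assumes M: "locally_half_space M" and W: "openin (top_of_set M) W" "x \<in> W"
  obtains U where "openin (top_of_set M) U" "x \<in> U" "U \<subseteq> W" "path_connected U" "connected (U \<inter> manifold_boundary M)"
proof -
  have "x \<in> M" using W openin_imp_subset by blast
  then obtain U0 f where U0: "x \<in> U0" "half_space_chart M U0 f" using M unfolding locally_half_space_def by blast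
  then have "openin (top_of_set M) (U0 \<inter> W)" using W unfolding half_space_chart_def by blast
  then have ch: "half_space_chart M (U0 \<inter> W) f" by (rule half_space_chart_subset[OF U0(2)]) auto
  then obtain V g where V: "openin (top_of_set half_space) V" "homeomorphism (U0 \<inter> W) V f g"
    unfolding half_space_chart_def by blast
  obtain O' where O': "open O'" "V = half_space \<inter> O'" using V(1) by (auto simp: openin_open)
  have "f x \<in> V" using V(2) U0 W(2) by (auto simp: homeomorphism_def)
  then obtain e where e: "e > 0" "ball (f x) e \<subseteq> O'" using O' by (metis IntD2 openE)
  define B where "B = half_space \<inter> ball (f x) e"
  have conv: "convex (half_space)"
  proof -
    have "half_space = {y. axis 1 1 \<bullet> y \<ge> 0}" by (auto simp: half_space_def inner_axis' )
    then show ?thesis by (metis convex_halfspace_ge)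
  qed
  have BV: "B \<subseteq> V" using e O'(2) by (auto simp: B_def)
  have B: "convex B" "convex (B \<inter> {y. y $ 1 = 0})"
  proof -
    show "convex B" unfolding B_def by (intro convex_Int conv convex_ball)
    have "{y::real^3. y $ 1 = 0} = {y. axis 1 1 \<bullet> y = 0}" by (auto simp: inner_axis')
    then have "convex {y::real^3. y $ 1 = 0}" by (metis convex_hyperplane)
    then show "convex (B \<inter> {y. y $ 1 = 0})" using \<open>convex B\<close> by (intro convex_Int)
  qed
  have cg: "continuous_on V g" and gV: "g ` V = U0 \<inter> W" "\<And>z. z \<in> V \<Longrightarrow> f (g z) = z"
    and gf: "\<And>y. y \<in> U0 \<inter> W \<Longrightarrow> g (f y) = y"
    using V(2) unfolding homeomorphism_def by auto
  show thesis
  proof (rule that[of "g ` B"])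
    have "openin (top_of_set half_space) B" unfolding B_def by (auto simp: openin_open)
    then have "openin (top_of_set V) B" using BV openin_imp_subset[OF V(1)] by (rule openin_subset_trans)
    then have "openin (top_of_set (U0 \<inter> W)) (g ` B)"
      by (rule homeomorphism_imp_open_map[OF homeomorphism_symD[OF V(2)]])
    then show "openin (top_of_set M) (g ` B)"
      using \<open>openin (top_of_set M) (U0 \<inter> W)\<close> openin_trans by blast
    have "f x \<in> B" using \<open>f x \<in> V\<close> O' e by (auto simp: B_def)
    then show "x \<in> g ` B" using gf[of x] U0 W by (metis IntI imageI)
    show "g ` B \<subseteq> W" using gV BV by auto
    show "path_connected (g ` B)"
      using B(1) BV cg by (intro path_connected_continuous_image convex_imp_path_connected) (auto intro: continuous_on_subset)
    have "g ` B \<inter> manifold_boundary M = g ` (B \<inter> {y. y $ 1 = 0})"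
    proof (intro equalityI subsetI)
      fix y assume y: "y \<in> g ` B \<inter> manifold_boundary M"
      then obtain z where z: "z \<in> B" "y = g z" by blast
      have "y \<in> U0 \<inter> W" using gV z BV by auto
      then have "f y $ 1 = 0" using chart_boundary_coordinate[OF ch] y by auto
      then show "y \<in> g ` (B \<inter> {y. y $ 1 = 0})" using z gV BV by auto
    next
      fix y assume "y \<in> g ` (B \<inter> {y. y $ 1 = 0})"
      then obtain z where z: "z \<in> B" "y = g z" "z $ 1 = 0" by blast
      have y: "y \<in> U0 \<inter> W" "f y = z" using gV z BV by auto
      then have "y \<in> manifold_boundary M"
        using ch z(3) openin_imp_subset[OF \<open>openin (top_of_set M) (U0 \<inter> W)\<close>] unfolding manifold_boundary_def by blast
      then show "y \<in> g ` B \<inter> manifold_boundary M" using z by blast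
    qed
    moreover have "connected (g ` (B \<inter> {y. y $ 1 = 0}))"
      using B(2) BV cg by (intro connected_continuous_image convex_connected) (auto intro: continuous_on_subset)
    ultimately show "connected (g ` B \<inter> manifold_boundary M)" by simp
  qed
qed

lemma locally_half_space_imp_locally_path_connected:
  "locally_half_space M \<Longrightarrow> locally path_connected M"
  unfolding locally_path_connected by (metis half_ball_neighbourhood)

section \<open>Boundary components inside the preimage of a boundary neighbourhood\<close>

definition local_section :: "('b::topological_space \<Rightarrow> 'a::topological_space) \<Rightarrow> 'b set \<Rightarrow> 'a set \<Rightarrow> ('a \<Rightarrow> 'b) \<Rightarrow> bool" where
  "local_section p C U s \<longleftrightarrow> continuous_on U s \<and> s ` U \<subseteq> C \<and> (\<forall>x\<in>U. p (s x) = x)"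

lemma local_section_subset: "local_section p C U s \<Longrightarrow> V \<subseteq> U \<Longrightarrow> local_section p C V s"
  unfolding local_section_def by (auto intro: continuous_on_subset)

lemma half_ball_sections:
  assumes cov: "covering_space C p M" and M: "locally_half_space M" and W: "openin (top_of_set M) W" "x \<in> W"
  shows "\<exists>U. openin (top_of_set M) U \<and> x \<in> U \<and> U \<subseteq> W \<and> connected U \<and> connected (U \<inter> manifold_boundary M) \<and>
    (\<forall>y\<in>C. p y \<in> U \<longrightarrow> (\<exists>s. local_section p C U s \<and> s (p y) = y))"
proof -
  have x: "x \<in> M" using W openin_imp_subset by blast
  obtain T \<Sigma> where T: "x \<in> T" "openin (top_of_set M) T"
    and \<Sigma>: "\<forall>s\<in>\<Sigma>. continuous_on T s \<and> s ` T \<subseteq> C \<and> (\<forall>x\<in>T. p (s x) = x)"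
      "\<forall>y\<in>C. p y \<in> T \<longrightarrow> (\<exists>!s. s \<in> \<Sigma> \<and> s (p y) = y)"
    by (rule covering_sections[OF cov x])
  have "openin (top_of_set M) (W \<inter> T)" "x \<in> W \<inter> T" using W T by auto
  then obtain U where U: "openin (top_of_set M) U" "x \<in> U" "U \<subseteq> W \<inter> T" "path_connected U"
      "connected (U \<inter> manifold_boundary M)"
    by (rule half_ball_neighbourhood[OF M])
  have "\<exists>s. local_section p C U s \<and> s (p y) = y" if y: "y \<in> C" "p y \<in> U" for y
  proof -
    obtain s where "s \<in> \<Sigma>" "s (p y) = y" using \<Sigma>(2) y U(3) by blast
    then show ?thesis using \<Sigma>(1) U(3) local_section_subset[of p C T s U] by (auto simp: local_section_def)
  qed
  then show ?thesis using U path_connected_imp_connected by blast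
qed

lemma local_sections_agree:
  assumes cov: "covering_space C p M" and s: "local_section p C U s" "local_section p C U' s'"
    and G: "connected G" "G \<subseteq> U" "G \<subseteq> U'" "z \<in> G" "s z = s' z" "b \<in> G"
  shows "s b = s' b"
  by (rule covering_lift_unique[OF cov G(1), of s s' z b])
    (use local_section_subset[OF s(1) G(2)] local_section_subset[OF s(2) G(3)] G(4-6) in
      \<open>auto simp: local_section_def\<close>)

text \<open>Take the union of small evenly covered half-balls around boundary points. A component of
  the preimage contains, with any point, a whole lifted half-ball, so also a lift of its centre, and
  then the boundary component through that lift. This yields existence of ends.\<close>

lemma boundary_neighbourhood_refine:
  assumes cov: "covering_space C p M" and M: "locally_half_space M"
    and N: "openin (top_of_set M) N" "manifold_boundary M \<subseteq> N"
  obtains N' where "openin (top_of_set M) N'" "manifold_boundary M \<subseteq> N'" "N' \<subseteq> N"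
    "\<And>K. K \<in> components (C \<inter> p -` N') \<Longrightarrow> \<exists>c\<in>Delta C. c \<subseteq> K"
proof -
  let ?P = "\<lambda>b U. openin (top_of_set M) U \<and> b \<in> U \<and> U \<subseteq> N \<and> connected U \<and> connected (U \<inter> manifold_boundary M) \<and>
    (\<forall>y\<in>C. p y \<in> U \<longrightarrow> (\<exists>s. local_section p C U s \<and> s (p y) = y))"
  have "\<forall>b\<in>manifold_boundary M. \<exists>U. ?P b U"
    using half_ball_sections[OF cov M N(1)] N(2) by blast
  then obtain G where G: "\<And>b. b \<in> manifold_boundary M \<Longrightarrow> ?P b (G b)" by metis
  let ?N = "\<Union>b\<in>manifold_boundary M. G b"
  show thesis
  proof (rule that[of ?N])
    show "openin (top_of_set M) ?N" using G by (intro openin_Union) auto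
    show "manifold_boundary M \<subseteq> ?N" "?N \<subseteq> N" using G by blast+
    fix K assume K: "K \<in> components (C \<inter> p -` ?N)"
    then obtain y where y: "y \<in> K" using in_components_nonempty by blast
    then have "y \<in> C" "p y \<in> ?N" using in_components_subset[OF K] by auto
    then obtain b where b: "b \<in> manifold_boundary M" "p y \<in> G b" by auto
    then obtain s where s: "local_section p C (G b) s" "s (p y) = y" using G[OF b(1)] \<open>y \<in> C\<close> by blast
    have bG: "b \<in> G b" using G[OF b(1)] by blast
    have "connected (s ` G b)"
      using G[OF b(1)] s(1) by (auto simp: local_section_def intro: connected_continuous_image)
    moreover have "s ` G b \<subseteq> C \<inter> p -` ?N" using s(1) b(1) by (auto simp: local_section_def)
    moreover have "K \<inter> s ` G b \<noteq> {}" using y s(2) b(2) by (metis IntI empty_iff imageI)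
    ultimately have "s ` G b \<subseteq> K" using components_maximal[OF K] by blast
    then have sb: "s b \<in> K" "s b \<in> C" "p (s b) = b" using bG s(1) by (auto simp: local_section_def)
    then have "s b \<in> manifold_boundary C" using manifold_boundary_covering[OF cov] b(1) by simp
    then obtain c where c: "c \<in> components (manifold_boundary C)" "s b \<in> c"
      using Union_components[of "manifold_boundary C"] by blast
    have "c \<subseteq> C \<inter> p -` ?N"
      using in_components_subset[OF c(1)] manifold_boundary_covering_eq[OF cov] \<open>manifold_boundary M \<subseteq> ?N\<close> by blast
    then have "c \<subseteq> K" using components_maximal[OF K in_components_connected[OF c(1)]] sb(1) c(2) by blast
    then show "\<exists>c\<in>Delta C. c \<subseteq> K" using c(1) unfolding Delta_def by blast
  qed
qed

text \<open>Compact Hausdorff spaces are regular, so every \<open>U x\<close> contains a closed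
  neighbourhood of \<open>x\<close>; finitely many of the open sets inside these already cover
  \<open>M\<close>.\<close>

lemma finite_closed_shrinking:
  assumes "compact M" "Hausdorff_space (top_of_set M)"
    and U: "\<And>x. x \<in> M \<Longrightarrow> openin (top_of_set M) (U x) \<and> x \<in> U x"
  obtains I V F where "finite I" "I \<subseteq> M" "M \<subseteq> (\<Union>i\<in>I. V i)"
    "\<And>i. i \<in> I \<Longrightarrow> openin (top_of_set M) (V i) \<and> closedin (top_of_set M) (F i) \<and> V i \<subseteq> F i \<and> F i \<subseteq> U i"
proof -
  have "regular_space (top_of_set M)"
    using assms(1,2) compact_Hausdorff_imp_regular_space[of "top_of_set M"]
      compact_space_subtopology[of euclidean M] by simp
  then have nb: "neighbourhood_base_of (closedin (top_of_set M)) (top_of_set M)"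
    by (simp add: neighbourhood_base_of_closedin)
  have "\<exists>V F. openin (top_of_set M) V \<and> closedin (top_of_set M) F \<and> x \<in> V \<and> V \<subseteq> F \<and> F \<subseteq> U x" if "x \<in> M" for x
    using nb U[OF that] unfolding neighbourhood_base_of by blast
  then obtain V F where VF: "\<And>x. x \<in> M \<Longrightarrow> openin (top_of_set M) (V x) \<and> closedin (top_of_set M) (F x) \<and> x \<in> V x \<and> V x \<subseteq> F x \<and> F x \<subseteq> U x"
    by metis
  have "compactin (top_of_set M) M" using assms(1) by (simp add: compactin_subtopology)
  then obtain \<F> where "finite \<F>" "\<F> \<subseteq> V ` M" "M \<subseteq> \<Union>\<F>"
    unfolding compactin_def using VF by (elim conjE allE[of _ "V ` M"]) auto
  then obtain I where "finite I" "I \<subseteq> M" "\<F> = V ` I" by (meson finite_subset_image)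
  then show thesis using that[of I V F] VF \<open>M \<subseteq> \<Union>\<F>\<close> by auto
qed

text \<open>This replaces a collar of the boundary.  Shrink a finite cover by half-balls \<open>U i\<close> to closed sets
  \<open>F i\<close>, and around each boundary point \<open>b\<close> choose \<open>G b\<close> inside all \<open>U i\<close> with \<open>b \<in> F i\<close> and away from the
  other \<open>F i\<close>.  A point of the cover over some \<open>F i\<close> and some \<open>G b\<close> is then related to the boundary
  component met by its sheet over \<open>U i\<close>; the choice of \<open>i\<close> does not matter because all these sheets
  contain the lift of \<open>G b\<close>, and the relation is locally constant.\<close>

lemma boundary_components_separated:
  assumes cov: "covering_space C p M" and M: "locally_half_space M"
    and cpt: "compact M" "Hausdorff_space (top_of_set M)"
  obtains N where "openin (top_of_set M) N" "manifold_boundary M \<subseteq> N"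
    "\<And>K c c'. K \<in> components (C \<inter> p -` N) \<Longrightarrow> c \<in> Delta C \<Longrightarrow> c' \<in> Delta C \<Longrightarrow> c \<subseteq> K \<Longrightarrow> c' \<subseteq> K \<Longrightarrow> c = c'"
proof -
  let ?B = "manifold_boundary M" and ?BC = "manifold_boundary C"
  let ?P = "\<lambda>x U. openin (top_of_set M) U \<and> x \<in> U \<and> connected U \<and> connected (U \<inter> ?B) \<and>
    (\<forall>y\<in>C. p y \<in> U \<longrightarrow> (\<exists>s. local_section p C U s \<and> s (p y) = y))"
  have nb: "\<exists>U. ?P x U \<and> U \<subseteq> W" if "openin (top_of_set M) W" "x \<in> W" for x W
    using half_ball_sections[OF cov M that] by blast
  have "\<exists>U. ?P x U" if x: "x \<in> M" for x
    using nb[OF openin_subtopology_self x] by meson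
  then obtain U where U: "\<And>x. x \<in> M \<Longrightarrow> ?P x (U x)" by metis
  obtain I V F where I: "finite I" "I \<subseteq> M" "M \<subseteq> (\<Union>i\<in>I. V i)"
    and VF: "\<And>i. i \<in> I \<Longrightarrow> openin (top_of_set M) (V i) \<and> closedin (top_of_set M) (F i) \<and> V i \<subseteq> F i \<and> F i \<subseteq> U i"
    by (rule finite_closed_shrinking[OF cpt, of U]) (use U in auto)
  have bd_M: "?B \<subseteq> M" by (auto simp: manifold_boundary_def)
  have bd_C: "?BC = C \<inter> p -` ?B" by (rule manifold_boundary_covering_eq[OF cov])
  have "\<exists>G. openin (top_of_set M) G \<and> b \<in> G \<and> connected G \<and>
      (\<forall>i\<in>I. (b \<in> F i \<longrightarrow> G \<subseteq> U i) \<and> (b \<notin> F i \<longrightarrow> G \<inter> F i = {}))" if b: "b \<in> ?B" for b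
  proof -
    let ?f = "\<lambda>i. if b \<in> F i then U i else M - F i"
    \<comment> \<open>The intersection with \<open>M\<close> handles empty \<open>I\<close>, for
      which the intersection of the family is the whole type.\<close>
    have "openin (top_of_set M) (M \<inter> \<Inter>(?f ` I))"
    proof (cases "I = {}")
      case False
      have "openin (top_of_set M) (\<Inter>(?f ` I))"
        using I U VF False by (intro openin_INT2) (auto simp: openin_diff subset_eq)
      then show ?thesis by (rule openin_Int[OF openin_subtopology_self])
    qed auto
    moreover have "b \<in> M \<inter> \<Inter>(?f ` I)" using b bd_M VF by (auto split: if_splits)
    ultimately have "\<exists>G. ?P b G \<and> G \<subseteq> M \<inter> \<Inter>(?f ` I)" by (rule nb)
    then obtain G where "?P b G \<and> G \<subseteq> M \<inter> \<Inter>(?f ` I)" by (elim exE)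
    then have G: "?P b G" "G \<subseteq> M \<inter> \<Inter>(?f ` I)" by blast+
    have "(b \<in> F i \<longrightarrow> G \<subseteq> U i) \<and> (b \<notin> F i \<longrightarrow> G \<inter> F i = {})" if "i \<in> I" for i
    proof -
      have "\<Inter>(?f ` I) \<subseteq> ?f i" by (rule INT_lower[OF that])
      then have "G \<subseteq> ?f i" using G(2) by blast
      then show ?thesis by (auto split: if_splits)
    qed
    then show ?thesis using G(1) by (intro exI[of _ G]) simp
  qed
  then obtain G where G: "\<And>b. b \<in> ?B \<Longrightarrow> openin (top_of_set M) (G b) \<and> b \<in> G b \<and> connected (G b) \<and>
      (\<forall>i\<in>I. (b \<in> F i \<longrightarrow> G b \<subseteq> U i) \<and> (b \<notin> F i \<longrightarrow> G b \<inter> F i = {}))" by metis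
  define N where "N = (\<Union>b\<in>?B. G b)"
  have N: "openin (top_of_set M) N" "?B \<subseteq> N" unfolding N_def using G by (auto intro!: openin_Union)
  have NM: "N \<subseteq> M" using N(1) openin_imp_subset by blast
  define R where "R y c \<longleftrightarrow> c \<in> Delta C \<and> (\<exists>i\<in>I. p y \<in> F i \<and> (\<exists>s. local_section p C (U i) s \<and> s (p y) = y \<and> s ` U i \<inter> c \<noteq> {}))" for y c
  \<comment> \<open>The boundary part of \<open>U i\<close> is connected, so its lift by
    \<open>s\<close> lies in one boundary component, and \<open>c\<close> is that one as soon as the
    sheet meets it.\<close>
  have comp: "s b \<in> c" if c: "c \<in> Delta C" and i: "i \<in> I" and s: "local_section p C (U i) s" "s ` U i \<inter> c \<noteq> {}" and b: "b \<in> ?B" "b \<in> U i"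
    for c i s b
  proof -
    have c': "c \<in> components ?BC" using c by (simp add: Delta_def)
    obtain z where z: "z \<in> U i" "s z \<in> c" using s(2) by blast
    then have "s z \<in> ?BC" using in_components_subset[OF c'] by blast
    then have "z \<in> ?B" using bd_C s(1) z(1) by (auto simp: local_section_def)
    have "connected (s ` (U i \<inter> ?B))"
      using U[of i] i I(2) s(1) by (intro connected_continuous_image) (auto simp: local_section_def intro: continuous_on_subset)
    moreover have "s ` (U i \<inter> ?B) \<subseteq> ?BC" using s(1) unfolding bd_C by (auto simp: local_section_def)
    moreover have "c \<inter> s ` (U i \<inter> ?B) \<noteq> {}" using z \<open>z \<in> ?B\<close> by blast
    ultimately have "s ` (U i \<inter> ?B) \<subseteq> c" using components_maximal[OF c'] by blast
    then show ?thesis using b by blast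
  qed
  have ex_at: "\<exists>c. c \<in> Delta C \<and> s ` U i \<inter> c \<noteq> {}"
    if i: "i \<in> I" and y: "y \<in> C" "p y \<in> N" "p y \<in> F i" and s: "local_section p C (U i) s" for i y s
  proof -
    obtain b where b: "b \<in> ?B" "p y \<in> G b" using y(2) unfolding N_def by blast
    have "b \<in> U i" using G[OF b(1)] i y(3) b(2) VF[OF i] by blast
    then have "s b \<in> ?BC" using s b(1) unfolding bd_C by (auto simp: local_section_def)
    then obtain c where "c \<in> components ?BC" "s b \<in> c" using Union_components[of ?BC] by blast
    then show ?thesis using \<open>b \<in> U i\<close> unfolding Delta_def by blast
  qed
  have uniq: "c = c'" if y: "y \<in> C" "p y \<in> N" and R: "R y c" "R y c'" for y c c'
  proof -
    obtain b where b: "b \<in> ?B" "p y \<in> G b" using y(2) unfolding N_def by blast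
    obtain i s where i: "i \<in> I" "p y \<in> F i" and s: "local_section p C (U i) s" "s (p y) = y" "s ` U i \<inter> c \<noteq> {}" and c: "c \<in> Delta C"
      using R(1) unfolding R_def by blast
    obtain j s' where j: "j \<in> I" "p y \<in> F j" and s': "local_section p C (U j) s'" "s' (p y) = y" "s' ` U j \<inter> c' \<noteq> {}" and c': "c' \<in> Delta C"
      using R(2) unfolding R_def by blast
    have GU: "G b \<subseteq> U i" "G b \<subseteq> U j" "b \<in> G b" "connected (G b)" using G[OF b(1)] i j b(2) by blast+
    have "s b = s' b"
      by (rule local_sections_agree[OF cov s(1) s'(1) GU(4,1,2) b(2)]) (use s s' GU in auto)
    moreover have "s b \<in> c" "s' b \<in> c'"
      using comp[OF c i(1) s(1,3) b(1)] comp[OF c' j(1) s'(1,3) b(1)] GU by blast+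
    ultimately have "c \<inter> c' \<noteq> {}" by auto
    then show "c = c'" using components_eq[OF c[unfolded Delta_def] c'[unfolded Delta_def]] by blast
  qed
  have loc: "\<exists>Y. openin (top_of_set C) Y \<and> y \<in> Y \<and> (\<forall>y'\<in>Y. p y' \<in> N \<longrightarrow> R y' c)"
    if y: "y \<in> C" "p y \<in> N" and R: "R y c" for y c
  proof -
    obtain i where i: "i \<in> I" "p y \<in> V i" using y(2) NM I(3) by blast
    then have yF: "p y \<in> F i" "p y \<in> U i" using VF by blast+
    obtain s where s: "local_section p C (U i) s" "s (p y) = y" using U[of i] i I(2) y(1) yF by blast
    obtain c' where c': "c' \<in> Delta C" "s ` U i \<inter> c' \<noteq> {}" using ex_at[OF i(1) y yF(1) s(1)] by blast
    then have "R y c'" unfolding R_def using i yF s by blast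
    then have [simp]: "c' = c" using uniq[OF y] R by blast
    \<comment> \<open>Membership in \<open>F i\<close> is not an open condition, so local constancy
      is proved over the open \<open>V i\<close> inside it. There the points of the sheet of
      \<open>s\<close> form an open set.\<close>
    let ?X = "C \<inter> p -` V i"
    have cp: "continuous_on C p" "p ` C \<subseteq> M" using cov by (auto simp: covering_space_def)
    have oX: "openin (top_of_set C) ?X"
      by (rule continuous_openin_preimage[OF cp(1), of M]) (use cp VF[OF i(1)] in auto)
    have XU: "p ` ?X \<subseteq> U i" using VF[OF i(1)] by blast
    have "openin (top_of_set ?X) {y \<in> ?X. s (p y) = y}"
    proof (rule covering_lifts_agree_openin[OF cov])
      show "continuous_on ?X (\<lambda>y. s (p y))"
        by (rule continuous_on_compose2[of "U i" s])
          (use s(1) XU in \<open>auto simp: local_section_def intro: continuous_on_subset[OF cp(1)]\<close>)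
    qed (use s(1) XU in \<open>auto simp: local_section_def\<close>)
    then have "openin (top_of_set C) {y \<in> ?X. s (p y) = y}" using oX openin_trans by blast
    moreover have "R y' c" if "y' \<in> {y \<in> ?X. s (p y) = y}" "p y' \<in> N" for y'
    proof -
      have "p y' \<in> F i" "s (p y') = y'" using that(1) VF[OF i(1)] by blast+
      then show ?thesis unfolding R_def using c' i(1) s(1) unfolding \<open>c' = c\<close> by blast
    qed
    ultimately show ?thesis using y(1) i(2) s(2) by (intro exI[of _ "{y \<in> ?X. s (p y) = y}"]) auto
  qed
  have ex: "\<exists>c. R y c" if y: "y \<in> C" "p y \<in> N" for y
  proof -
    obtain i where i: "i \<in> I" "p y \<in> V i" using y(2) NM I(3) by blast
    then have yF: "p y \<in> F i" "p y \<in> U i" using VF by blast+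
    obtain s where s: "local_section p C (U i) s" "s (p y) = y" using U[of i] i I(2) y(1) yF by blast
    obtain c' where c': "c' \<in> Delta C" "s ` U i \<inter> c' \<noteq> {}" using ex_at[OF i(1) y yF(1) s(1)] by blast
    then show ?thesis unfolding R_def using i yF s by blast
  qed
  \<comment> \<open>A boundary point is related to its own component. Since the related component is
    constant on \<open>K\<close>, all boundary components inside \<open>K\<close> coincide.\<close>
  have self: "R y c" if c: "c \<in> Delta C" "y \<in> c" for y c
  proof -
    have y: "y \<in> ?BC" using c in_components_subset unfolding Delta_def by blast
    then have y: "y \<in> C" "p y \<in> ?B" unfolding bd_C by auto
    then obtain i where i: "i \<in> I" "p y \<in> V i" using bd_M I(3) by blast
    then have yF: "p y \<in> F i" "p y \<in> U i" using VF by blast+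
    obtain s where s: "local_section p C (U i) s" "s (p y) = y" using U[of i] i I(2) y(1) yF by blast
    then have "y \<in> s ` U i \<inter> c" using yF c(2) by (auto intro!: image_eqI[of _ _ "p y"])
    then show ?thesis unfolding R_def using i yF s c by blast
  qed
  show thesis
  proof (rule that[OF N])
    fix K c c'
    assume K: "K \<in> components (C \<inter> p -` N)" and c: "c \<in> Delta C" "c' \<in> Delta C" "c \<subseteq> K" "c' \<subseteq> K"
    have KC: "y \<in> C" "p y \<in> N" if "y \<in> K" for y using in_components_subset[OF K] that by auto
    define r where "r y = (THE c. R y c)" for y
    have r: "R y (r y)" if "y \<in> K" for y unfolding r_def
      by (rule theI') (use ex uniq KC[OF that] in blast)
    have r_eq: "r y = c" if "y \<in> K" "R y c" for y c
      using r[OF that(1)] uniq KC[OF that(1)] that(2) by blast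
    have "r constant_on K"
    proof (rule locally_constant_imp_constant[OF in_components_connected[OF K]])
      fix y assume y: "y \<in> K"
      obtain Y where Y: "openin (top_of_set C) Y" "y \<in> Y" "\<forall>y'\<in>Y. p y' \<in> N \<longrightarrow> R y' (r y)"
        using loc[OF KC[OF y] r[OF y]] by blast
      have "openin (top_of_set K) (K \<inter> Y)"
        using Y(1) KC by (auto simp: openin_open)
      then show "\<exists>T. openin (top_of_set K) T \<and> y \<in> T \<and> (\<forall>x\<in>T. r x = r y)"
        using Y y r_eq KC by (intro exI[of _ "K \<inter> Y"]) auto
    qed
    moreover obtain y y' where y: "y \<in> c" "y' \<in> c'"
      using c(1,2) unfolding Delta_def by (metis all_not_in_conv in_components_nonempty)
    then have "y \<in> K" "y' \<in> K" using c(3,4) by blast+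
    ultimately have "r y = r y'" unfolding constant_on_def by auto
    then show "c = c'"
      using r_eq[OF \<open>y \<in> K\<close> self[OF c(1) y(1)]] r_eq[OF \<open>y' \<in> K\<close> self[OF c(2) y(2)]] by simp
  qed
qed

section \<open>Tetrahedra of the universal cover and their ideal vertices\<close>

lemma norm_std_vertex: "norm (std_vertex a) = 1"
  by (simp add: std_vertex_def)

lemma std_vertex_in_std_simplex: "std_vertex a \<in> std_simplex"
  by (auto simp: std_vertex_def std_simplex_def axis_def)

lemma std_simplex_component_le_1: "x \<in> std_simplex \<Longrightarrow> x $ k \<le> 1"
  unfolding std_simplex_def using member_le_sum[of k UNIV "\<lambda>k. x $ k"] by auto

text \<open>The coordinates lie between \<open>0\<close> and \<open>1\<close>, so none is smaller
  than its square, and they sum to \<open>1\<close>. Norm at least \<open>1\<close> forces equality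
  in every coordinate: each is \<open>0\<close> or \<open>1\<close>, and exactly one of them is
  \<open>1\<close>.\<close>

lemma norm_less_1_ideal_simplex:
  assumes x: "x \<in> std_simplex"
  shows "norm x < 1 \<longleftrightarrow> x \<notin> range std_vertex"
proof
  assume "x \<notin> range std_vertex"
  show "norm x < 1"
  proof (rule ccontr)
    assume "\<not> norm x < 1"
    then have "1 \<le> (norm x)\<^sup>2" by (simp add: one_le_power)
    then have n: "1 \<le> (\<Sum>k\<in>UNIV. (x $ k)\<^sup>2)"
      unfolding power2_norm_eq_inner inner_vec_def by (simp add: power2_eq_square)
    have x0: "0 \<le> x $ k" and s1: "(\<Sum>k\<in>UNIV. x $ k) = 1" for k using x by (auto simp: std_simplex_def)
    have nn: "0 \<le> x $ k - (x $ k)\<^sup>2" for k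
      using x0[of k] std_simplex_component_le_1[OF x, of k] by (simp add: power2_eq_square mult_left_le)
    have "(\<Sum>k\<in>UNIV. x $ k - (x $ k)\<^sup>2) \<le> 0" using n s1 by (simp add: sum_subtractf)
    then have "(\<Sum>k\<in>UNIV. x $ k - (x $ k)\<^sup>2) = 0" using nn by (meson order_antisym sum_nonneg)
    then have "x $ k - (x $ k)\<^sup>2 = 0" for k using nn by (simp add: sum_nonneg_eq_0_iff)
    then have x01: "x $ k = 0 \<or> x $ k = 1" for k by (auto simp: power2_eq_square)
    obtain a where a: "x $ a = 1" using s1 x01 by (metis sum.neutral zero_neq_one)
    have "(\<Sum>k\<in>UNIV. x $ k) = x $ a + (\<Sum>k\<in>UNIV - {a}. x $ k)"
      by (simp add: sum.remove)
    then have "(\<Sum>k\<in>UNIV - {a}. x $ k) = 0" using s1 a by simp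
    then have "x $ k = 0" if "k \<noteq> a" for k using that x0 by (simp add: sum_nonneg_eq_0_iff)
    then have "x = std_vertex a" using a by (auto simp: vec_eq_iff std_vertex_def axis_def)
    then show False using \<open>x \<notin> range std_vertex\<close> by blast
  qed
qed (use norm_std_vertex in auto)

text \<open>Removing the vertices is the same as intersecting with the open unit ball, which makes
  convexity immediate.\<close>

lemma ideal_simplex_alt: "ideal_simplex = std_simplex \<inter> ball 0 1"
  unfolding ideal_simplex_def using norm_less_1_ideal_simplex by (auto simp: dist_norm)

lemma convex_std_simplex: "convex std_simplex"
  unfolding convex_def std_simplex_def
  by (auto simp: sum.distrib sum_distrib_left[symmetric])

lemma convex_ideal_simplex: "convex ideal_simplex"
  unfolding ideal_simplex_alt by (intro convex_Int convex_std_simplex convex_ball)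

text \<open>A probe that runs into the vertex \<open>a\<close> as \<open>t\<close> tends to
  \<open>0\<close>. It stays in every face containing both \<open>a\<close> and \<open>b\<close>, so
  it can compare two tetrahedra glued along such a face.\<close>

definition edge_point :: "4 \<Rightarrow> 4 \<Rightarrow> real \<Rightarrow> real^4" where
  "edge_point a b t = (1 - t) *\<^sub>R std_vertex a + t *\<^sub>R std_vertex b"

lemma exists_other_vertex: "\<exists>d::4. d \<noteq> a \<and> d \<noteq> b"
proof -
  have "card {a, b} \<le> 2" by (simp add: card_insert_if)
  moreover have "card (UNIV :: 4 set) = 4" by simp
  ultimately have "{a, b} \<noteq> (UNIV :: 4 set)" by (intro notI) simp
  then show ?thesis by blast
qed

lemma edge_point_component:
  "edge_point a b t $ k = (1 - t) * (if k = a then 1 else 0) + t * (if k = b then 1 else 0)"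
  by (simp add: edge_point_def std_vertex_def axis_def)

lemma edge_point_in_ideal_simplex:
  assumes "a \<noteq> b" "0 < t" "t < 1"
  shows "edge_point a b t \<in> ideal_simplex"
proof -
  have "edge_point a b t \<in> std_simplex"
    unfolding edge_point_def
    using convexD[OF convex_std_simplex std_vertex_in_std_simplex[of a] std_vertex_in_std_simplex[of b], of "1 - t" t] assms
    by auto
  moreover have "edge_point a b t \<noteq> std_vertex c" for c
  proof
    assume "edge_point a b t = std_vertex c"
    then have "edge_point a b t $ a = std_vertex c $ a" by simp
    then show False using assms by (auto simp: edge_point_component std_vertex_def axis_def split: if_splits)
  qed
  ultimately show ?thesis by (auto simp: ideal_simplex_def)
qed

text \<open>Statements near an ideal vertex become statements for small positive \<open>t\<close>,
  where the filter is nontrivial and hence provides actual witnesses.\<close>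

lemma eventually_edge_point:
  assumes "a \<noteq> b" and P: "\<forall>\<^sub>F x in at (std_vertex a) within ideal_simplex. P x"
  shows "\<forall>\<^sub>F t in at_right 0. P (edge_point a b t)"
proof -
  have "((\<lambda>t. edge_point a b t) \<longlongrightarrow> edge_point a b 0) (at_right 0)"
    unfolding edge_point_def by (intro tendsto_intros)
  then have "((\<lambda>t. edge_point a b t) \<longlongrightarrow> std_vertex a) (at_right 0)"
    by (simp add: edge_point_def)
  moreover have "\<forall>\<^sub>F t in at_right 0. edge_point a b t \<in> ideal_simplex \<and> edge_point a b t \<noteq> std_vertex a"
    using eventually_at_right_less[of "0::real"]
    by (rule eventually_mono[OF eventually_conj[OF _ eventually_at_right_real[of 0 "1::real"]]])
      (use edge_point_in_ideal_simplex[OF assms(1)] in \<open>auto simp: ideal_simplex_def\<close>)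
  ultimately have "filterlim (edge_point a b) (at (std_vertex a) within ideal_simplex) (at_right 0)"
    by (auto simp: filterlim_at elim: eventually_mono)
  then show ?thesis using P by (auto simp: filterlim_iff)
qed

section \<open>Gluing maps and classes of points\<close>

lemma simplex_map_component: "bij \<sigma> \<Longrightarrow> simplex_map \<sigma> x $ \<sigma> k = x $ k"
  by (simp add: simplex_map_def bij_is_inj)

lemma simplex_map_edge_point:
  assumes "bij \<sigma>"
  shows "simplex_map \<sigma> (edge_point a b t) = edge_point (\<sigma> a) (\<sigma> b) t"
  unfolding vec_eq_iff
proof
  fix k
  obtain l where "k = \<sigma> l" using assms by (metis bij_pointE)
  then show "simplex_map \<sigma> (edge_point a b t) $ k = edge_point (\<sigma> a) (\<sigma> b) t $ k"
    using assms by (simp add: simplex_map_component edge_point_component bij_def inj_eq)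
qed

lemma sum_simplex_map:
  assumes "bij \<sigma>"
  shows "(\<Sum>k\<in>UNIV. f (simplex_map \<sigma> x $ k)) = (\<Sum>k\<in>UNIV. f (x $ k))"
  using sum.reindex_bij_betw[of \<sigma> UNIV UNIV "\<lambda>k. f (simplex_map \<sigma> x $ k)"] assms
  by (simp add: simplex_map_component)

lemma norm_simplex_map: "bij \<sigma> \<Longrightarrow> norm (simplex_map \<sigma> x) = norm x"
  unfolding norm_vec_def L2_set_def by (simp add: sum_simplex_map[of \<sigma> "\<lambda>r. r\<^sup>2" x])

lemma simplex_map_in_std_simplex: "bij \<sigma> \<Longrightarrow> x \<in> std_simplex \<Longrightarrow> simplex_map \<sigma> x \<in> std_simplex"
  using sum_simplex_map[of \<sigma> "\<lambda>x. x" x] by (auto simp: std_simplex_def simplex_map_def)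

lemma simplex_map_in_ideal_simplex: "bij \<sigma> \<Longrightarrow> x \<in> ideal_simplex \<Longrightarrow> simplex_map \<sigma> x \<in> ideal_simplex"
  using simplex_map_in_std_simplex norm_simplex_map by (auto simp: ideal_simplex_alt dist_norm)

lemma continuous_on_simplex_map: "continuous_on A (simplex_map \<sigma>)"
  unfolding simplex_map_def by (intro continuous_on_vec_lambda continuous_intros)

lemma simplex_map_inverse:
  assumes "bij \<sigma>"
  shows "simplex_map (inv_into UNIV \<sigma>) (simplex_map \<sigma> x) = x"
  using assms by (auto simp: vec_eq_iff simplex_map_def inv_inv_eq bij_is_inj)

lemma glue_step_invariant:
  assumes "face_pairing T" "((i, x), (j, y)) \<in> glue_step T"
  shows "i \<in> tets T" "x \<in> std_simplex" "j \<in> tets T" "y \<in> std_simplex" "norm y = norm x"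
proof -
  obtain a \<sigma> where g: "i \<in> tets T" "x \<in> std_simplex" "x $ a = 0" "glue T (i, a) = (j, \<sigma>)" "y = simplex_map \<sigma> x"
    using assms(2) unfolding glue_step_def by auto
  have "j \<in> tets T" "bij \<sigma>" using assms(1) g unfolding face_pairing_def by blast+
  then show "i \<in> tets T" "x \<in> std_simplex" "j \<in> tets T" "y \<in> std_simplex" "norm y = norm x"
    using g simplex_map_in_std_simplex norm_simplex_map by auto
qed

lemma glue_step_sym:
  assumes "face_pairing T" "(u, w) \<in> glue_step T"
  shows "(w, u) \<in> glue_step T"
proof -
  obtain i x j a \<sigma> where g: "i \<in> tets T" "x \<in> std_simplex" "x $ a = 0" "glue T (i, a) = (j, \<sigma>)"
    and uw: "u = (i, x)" "w = (j, simplex_map \<sigma> x)"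
    using assms(2) unfolding glue_step_def by auto
  have s: "j \<in> tets T" "bij \<sigma>" "glue T (j, \<sigma> a) = (i, inv_into UNIV \<sigma>)"
    using assms(1) g unfolding face_pairing_def by blast+
  have "simplex_map \<sigma> x $ \<sigma> a = 0" using g s by (simp add: simplex_map_component)
  moreover have "u = (i, simplex_map (inv_into UNIV \<sigma>) (simplex_map \<sigma> x))"
    using uw simplex_map_inverse[OF s(2)] by simp
  ultimately show ?thesis
    using s simplex_map_in_std_simplex[OF s(2) g(2)] unfolding uw glue_step_def by blast
qed

lemma point_class_eq:
  assumes "face_pairing T" "(u, w) \<in> glue_step T"
  shows "point_class T u = point_class T w"
proof -
  have "(w, u) \<in> glue_step T" using glue_step_sym assms by blast
  then show ?thesis using assms(2) unfolding point_class_def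
    by (auto intro: converse_rtrancl_into_rtrancl)
qed

lemma point_class_norm:
  assumes "face_pairing T" "w \<in> point_class T (i, x)"
  shows "norm (snd w) = norm x"
proof -
  have "((i, x), w) \<in> (glue_step T)\<^sup>*" using assms(2) by (simp add: point_class_def)
  then show ?thesis
  proof (induction rule: rtrancl_induct)
    case (step y z)
    then show ?case using glue_step_invariant(5)[OF assms(1), of "fst y" "snd y" "fst z" "snd z"] by simp
  qed simp
qed

lemma point_class_self: "(i, x) \<in> point_class T (i, x)"
  by (simp add: point_class_def)

text \<open>The gluing maps permute barycentric coordinates, so the Euclidean norm descends to the quotient;
  on the simplex it is \<open>1\<close> exactly at the vertices.\<close>

definition class_norm :: "('t \<times> (real^4)) set \<Rightarrow> real" where
  "class_norm z = norm (snd (SOME w. w \<in> z))"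

lemma class_norm_point_class:
  assumes "face_pairing T"
  shows "class_norm (point_class T (i, x)) = norm x"
  unfolding class_norm_def
  by (rule point_class_norm[OF assms]) (rule someI[where P = "\<lambda>w. w \<in> point_class T (i, x)"], rule point_class_self)

lemma topspace_quotient_space: "topspace (quotient_space T) = point_class T ` (tets T \<times> std_simplex)"
  by (simp add: quotient_space_def topspace_quotient_topology)

lemma continuous_map_class_norm:
  assumes "face_pairing T"
  shows "continuous_map (quotient_space T) euclideanreal class_norm"
  unfolding quotient_space_def
proof (rule continuous_compose_quotient_map[OF quotient_map_quotient_topology])
  let ?X = "prod_topology (discrete_topology (tets T)) (top_of_set std_simplex)"
  have "continuous_map ?X euclideanreal (\<lambda>w. norm (snd w))"
    by (rule continuous_map_norm[OF continuous_map_into_fulltopology[OF continuous_map_snd]])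
  then show "continuous_map ?X euclideanreal (class_norm \<circ> point_class T)"
    by (rule continuous_map_eq) (auto simp: class_norm_point_class[OF assms])
qed

text \<open>Vertices of the quotient are classes, so one has to exclude that a nonvertex point is
  identified with a vertex. Invariance of the norm under gluing does this.\<close>

lemma point_class_nonvertex:
  assumes "face_pairing T" "i \<in> tets T" "x \<in> std_simplex"
  shows "point_class T (i, x) \<in> topspace (quotient_space T) - quotient_vertices T \<longleftrightarrow> x \<in> ideal_simplex"
proof -
  have "point_class T (i, x) \<in> topspace (quotient_space T)"
    using assms by (auto simp: topspace_quotient_space)
  moreover have "point_class T (i, x) \<in> quotient_vertices T \<longleftrightarrow> norm x \<ge> 1"
  proof
    assume "point_class T (i, x) \<in> quotient_vertices T"
    then obtain j a where "point_class T (i, x) = point_class T (j, std_vertex a)"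
      unfolding quotient_vertices_def by auto
    then have "class_norm (point_class T (i, x)) = class_norm (point_class T (j, std_vertex a))" by simp
    then show "norm x \<ge> 1" by (simp add: class_norm_point_class[OF assms(1)] norm_std_vertex)
  next
    assume "norm x \<ge> 1"
    then have "x \<in> range std_vertex" using norm_less_1_ideal_simplex[OF assms(3)] by auto
    then show "point_class T (i, x) \<in> quotient_vertices T" using assms(2) by (auto simp: quotient_vertices_def)
  qed
  ultimately show ?thesis using assms(3) by (auto simp: ideal_simplex_alt dist_norm)
qed

lemma components_homeomorphism_image:
  assumes g: "homeomorphism A B g g'" and c: "c \<in> components A"
  shows "g ` c \<in> components B"
proof -
  have cA: "c \<subseteq> A" "connected c" "c \<noteq> {}"
    using c by (auto dest: in_components_subset in_components_connected in_components_nonempty)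
  have gg: "g ` A = B" "g' ` B = A" "\<And>x. x \<in> A \<Longrightarrow> g' (g x) = x" "\<And>y. y \<in> B \<Longrightarrow> g (g' y) = y"
    "continuous_on A g" "continuous_on B g'"
    using g by (auto simp: homeomorphism_def)
  have "connected (g ` c)" using cA gg(5) by (meson connected_continuous_image continuous_on_subset)
  moreover have "g ` c \<subseteq> B" "g ` c \<noteq> {}" using cA gg by auto
  ultimately obtain d where d: "d \<in> components B" "g ` c \<subseteq> d"
    using exists_component_superset[of "g ` c" B] by auto
  have dB: "d \<subseteq> B" "connected d" using d by (auto dest: in_components_subset in_components_connected)
  have "connected (g' ` d)" using dB gg(6) by (meson connected_continuous_image continuous_on_subset)
  moreover have "g' ` d \<subseteq> A" using dB gg by auto
  moreover have "c \<inter> g' ` d \<noteq> {}"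
  proof -
    obtain y where "y \<in> c" using cA by blast
    then have "y \<in> g' ` d" using d(2) gg(3)[of y] cA by (metis image_eqI subsetD)
    then show ?thesis using \<open>y \<in> c\<close> by blast
  qed
  ultimately have "g' ` d \<subseteq> c" using components_maximal[OF c] by blast
  then have "d \<subseteq> g ` c" using gg(4) dB by (metis image_eqI subset_iff)
  then show ?thesis using d by simp
qed

section \<open>Lifted tetrahedra and their ends\<close>

locale triangulated_cover =
  fixes M :: "'a::topological_space set" and C :: "'b::topological_space set" and p :: "'b \<Rightarrow> 'a"
    and T :: "'t triangulation" and h :: "('t \<times> (real^4)) set \<Rightarrow> 'a"
  assumes half_space: "locally_half_space M" and compact_M: "compact M"
    and Hausdorff_M: "Hausdorff_space (top_of_set M)"
    and cover: "covering_space C p M" and simply_connected_C: "simply_connected C"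
    and triangulation: "ideal_triangulation M T h"
begin

abbreviation "bdM \<equiv> manifold_boundary M"

lemma face_pairing: "face_pairing T"
  using triangulation by (simp add: ideal_triangulation_def)

lemma glueD:
  assumes "i \<in> tets T" "glue T (i, a) = (j, \<sigma>)"
  shows "j \<in> tets T" "bij \<sigma>" "glue T (j, \<sigma> a) = (i, inv_into UNIV \<sigma>)"
  using face_pairing assms unfolding face_pairing_def by blast+

lemma locally_path_connected_C: "locally path_connected C"
  by (rule locally_half_space_imp_locally_path_connected[OF locally_half_space_covering[OF cover half_space]])

abbreviation "Q \<equiv> subtopology (quotient_space T) (topspace (quotient_space T) - quotient_vertices T)"

lemma homeomorphic_map_h: "homeomorphic_map Q (top_of_set (M - bdM)) h"
  using triangulation by (simp add: ideal_triangulation_def)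

lemma point_class_in_Q: "i \<in> tets T \<Longrightarrow> x \<in> ideal_simplex \<Longrightarrow> point_class T (i, x) \<in> topspace Q"
  using point_class_nonvertex[OF face_pairing, of i x] by (auto simp: ideal_simplex_def)

lemma characteristic_map:
  assumes i: "i \<in> tets T"
  shows "continuous_on ideal_simplex (\<lambda>x. h (point_class T (i, x)))"
    "(\<lambda>x. h (point_class T (i, x))) ` ideal_simplex \<subseteq> M - bdM"
proof -
  let ?X = "prod_topology (discrete_topology (tets T)) (top_of_set std_simplex)"
  have "continuous_map (top_of_set ideal_simplex) ?X (\<lambda>x. (i, x))"
    using i by (intro continuous_map_pairedI) (auto simp: ideal_simplex_def continuous_map_in_subtopology)
  moreover have "continuous_map ?X (quotient_space T) (point_class T)"
    unfolding quotient_space_def by (rule quotient_imp_continuous_map[OF quotient_map_quotient_topology])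
  ultimately have "continuous_map (top_of_set ideal_simplex) (quotient_space T) (point_class T \<circ> (\<lambda>x. (i, x)))"
    by (rule continuous_map_compose)
  then have "continuous_map (top_of_set ideal_simplex) Q (point_class T \<circ> (\<lambda>x. (i, x)))"
    using point_class_in_Q[OF i] by (auto simp: continuous_map_in_subtopology)
  then have "continuous_map (top_of_set ideal_simplex) (top_of_set (M - bdM)) (h \<circ> (point_class T \<circ> (\<lambda>x. (i, x))))"
    using homeomorphic_imp_continuous_map[OF homeomorphic_map_h] continuous_map_compose by blast
  then show "continuous_on ideal_simplex (\<lambda>x. h (point_class T (i, x)))"
    "(\<lambda>x. h (point_class T (i, x))) ` ideal_simplex \<subseteq> M - bdM"
    by (auto simp: comp_def continuous_map_in_subtopology)
qed

text \<open>The complement of \<open>N\<close> is a compact part of the interior. Its image under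
  the inverse of \<open>h\<close> is compact and avoids the vertices, so \<open>class_norm\<close>
  attains a maximum below \<open>1\<close> on it; points of larger norm must lie over
  \<open>N\<close>.\<close>

lemma near_vertices:
  assumes N: "openin (top_of_set M) N" "bdM \<subseteq> N"
  obtains m where "m < 1" "\<And>i x. i \<in> tets T \<Longrightarrow> x \<in> ideal_simplex \<Longrightarrow> m < norm x \<Longrightarrow> h (point_class T (i, x)) \<in> N"
proof -
  obtain k where k: "homeomorphic_maps Q (top_of_set (M - bdM)) h k"
    using homeomorphic_map_h homeomorphic_map_maps by blast
  then have cont: "continuous_map (top_of_set (M - bdM)) Q k"
    and kh: "\<And>z. z \<in> topspace Q \<Longrightarrow> k (h z) = z"
    unfolding homeomorphic_maps_def by blast+
  obtain O' where "open O'" "N = M \<inter> O'" using N(1) by (auto simp: openin_open)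
  then have "M - N = M - O'" by auto
  then have "compact (M - N)" using compact_M \<open>open O'\<close> compact_diff by metis
  then have "compactin (top_of_set (M - bdM)) (M - N)" using N(2) by (auto simp: compactin_subtopology)
  then have "compactin Q (k ` (M - N))" using cont image_compactin by blast
  then have kQ: "compactin (quotient_space T) (k ` (M - N))" "k ` (M - N) \<subseteq> topspace Q"
    by (auto simp: compactin_subtopology)
  have cpt: "compact (class_norm ` k ` (M - N))"
    using image_compactin[OF kQ(1) continuous_map_class_norm[OF face_pairing]] by simp
  have less: "class_norm z < 1" if z: "z \<in> topspace Q" for z
  proof -
    obtain i x where ix: "z = point_class T (i, x)" "i \<in> tets T" "x \<in> std_simplex"
      using z by (auto simp: topspace_quotient_space)
    then have "x \<in> ideal_simplex" using point_class_nonvertex[OF face_pairing ix(2,3)] z by simp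
    then show ?thesis using ix(1) by (simp add: class_norm_point_class[OF face_pairing] ideal_simplex_alt)
  qed
  have "\<exists>m<1. \<forall>r\<in>class_norm ` k ` (M - N). r \<le> m"
  proof (cases "M - N = {}")
    case True
    then show ?thesis by (intro exI[of _ 0]) auto
  next
    case False
    then obtain r where "r \<in> class_norm ` k ` (M - N)" "\<forall>r'\<in>class_norm ` k ` (M - N). r' \<le> r"
      using compact_attains_sup[OF cpt] by auto
    then show ?thesis using less kQ(2) by (intro exI[of _ r]) auto
  qed
  then obtain m where m: "m < 1" "\<And>r. r \<in> class_norm ` k ` (M - N) \<Longrightarrow> r \<le> m" by blast
  show thesis
  proof (rule that[OF m(1)])
    fix i x assume ix: "i \<in> tets T" "x \<in> ideal_simplex" "m < norm x"
    show "h (point_class T (i, x)) \<in> N"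
    proof (rule ccontr)
      assume "h (point_class T (i, x)) \<notin> N"
      moreover have "h (point_class T (i, x)) \<in> M" using characteristic_map(2)[OF ix(1)] ix(2) by auto
      ultimately have "class_norm (k (h (point_class T (i, x)))) \<le> m" using m(2) by auto
      then show False using ix kh[OF point_class_in_Q[OF ix(1,2)]] by (simp add: class_norm_point_class[OF face_pairing])
    qed
  qed
qed

abbreviation lifted :: "'t \<Rightarrow> (real^4 \<Rightarrow> 'b) \<Rightarrow> bool" where
  "lifted \<equiv> lifted_tet C p T h"

abbreviation end_of :: "(real^4 \<Rightarrow> 'b) \<Rightarrow> 4 \<Rightarrow> 'b set" where
  "end_of \<equiv> ideal_end M C p"

lemma lifted_exists:
  assumes i: "i \<in> tets T" and x: "x \<in> ideal_simplex" and y: "y \<in> C" "p y = h (point_class T (i, x))"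
  obtains \<tau> where "lifted i \<tau>" "\<tau> x = y"
proof -
  have im: "(\<lambda>x. h (point_class T (i, x))) ` ideal_simplex \<subseteq> M" using characteristic_map(2)[OF i] by auto
  obtain \<tau> where "continuous_on ideal_simplex \<tau>" "\<tau> ` ideal_simplex \<subseteq> C" "\<tau> x = y"
      "\<And>z. z \<in> ideal_simplex \<Longrightarrow> p (\<tau> z) = h (point_class T (i, z))"
    by (rule covering_lift_convex[OF cover convex_ideal_simplex characteristic_map(1)[OF i] im x y]) blast
  then show thesis using that i unfolding lifted_tet_def by blast
qed

lemma lifted_exists_some:
  assumes i: "i \<in> tets T"
  obtains \<tau> where "lifted i \<tau>"
proof -
  have x: "edge_point 0 1 (1/2) \<in> ideal_simplex" by (rule edge_point_in_ideal_simplex) auto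
  then have "h (point_class T (i, edge_point 0 1 (1/2))) \<in> M" using characteristic_map(2)[OF i] by auto
  then obtain y where "y \<in> C" "p y = h (point_class T (i, edge_point 0 1 (1/2)))"
    using cover unfolding covering_space_def by (metis imageE)
  then show thesis using lifted_exists[OF i x] that by blast
qed

lemma lifted_unique:
  assumes "lifted i \<tau>" "lifted i \<tau>'" "x \<in> ideal_simplex" "\<tau> x = \<tau>' x" "y \<in> ideal_simplex"
  shows "\<tau> y = \<tau>' y"
  by (rule covering_lift_unique[OF cover convex_connected[OF convex_ideal_simplex], of _ _ x])
    (use assms in \<open>auto simp: lifted_tet_def\<close>)

text \<open>The property described by \<open>ideal_end\<close>, named so that unique existence can
  be proved before the description is used.\<close>

definition is_end :: "(real^4 \<Rightarrow> 'b) \<Rightarrow> 4 \<Rightarrow> 'b set \<Rightarrow> bool" where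
  "is_end \<tau> a c \<longleftrightarrow> c \<in> Delta C \<and>
     (\<forall>N. openin (top_of_set M) N \<and> bdM \<subseteq> N \<longrightarrow>
        (\<exists>K\<in>components (C \<inter> p -` N). c \<subseteq> K \<and>
           (\<forall>\<^sub>F x in at (std_vertex a) within ideal_simplex. \<tau> x \<in> K)))"

text \<open>The cap of the simplex where the coordinate at \<open>a\<close> exceeds \<open>m\<close>
  is convex, and it lies over \<open>N\<close> because the norm is at least that coordinate. Its
  connected image falls into a single component.\<close>

lemma lifted_in_component:
  assumes \<tau>: "lifted i \<tau>" and N: "openin (top_of_set M) N" "bdM \<subseteq> N"
  obtains K where "K \<in> components (C \<inter> p -` N)" "\<forall>\<^sub>F x in at (std_vertex a) within ideal_simplex. \<tau> x \<in> K"
proof -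
  obtain m where m: "m < 1" "\<And>i x. i \<in> tets T \<Longrightarrow> x \<in> ideal_simplex \<Longrightarrow> m < norm x \<Longrightarrow> h (point_class T (i, x)) \<in> N"
    using near_vertices[OF N] by blast
  define P where "P = ideal_simplex \<inter> {x. m < x $ a}"
  have "convex {x::real^4. m < x $ a}"
  proof -
    have "{x::real^4. m < x $ a} = {x. axis a 1 \<bullet> x > m}" by (auto simp: inner_axis')
    then show ?thesis by (metis convex_halfspace_gt)
  qed
  then have "convex P" unfolding P_def by (intro convex_Int convex_ideal_simplex)
  then have conn: "connected (\<tau> ` P)"
    using \<tau> by (intro connected_continuous_image convex_connected)
      (auto simp: lifted_tet_def P_def intro: continuous_on_subset)
  have sub: "\<tau> ` P \<subseteq> C \<inter> p -` N"
  proof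
    fix y assume "y \<in> \<tau> ` P"
    then obtain x where x: "y = \<tau> x" "x \<in> ideal_simplex" "m < x $ a" unfolding P_def by auto
    have "m < norm x" using x(3) component_le_norm_cart[of x a] by linarith
    then show "y \<in> C \<inter> p -` N" using \<tau> x m(2) unfolding lifted_tet_def by auto
  qed
  have ev: "\<forall>\<^sub>F x in at (std_vertex a) within ideal_simplex. x \<in> P"
  proof -
    have "((\<lambda>x. x $ a) \<longlongrightarrow> std_vertex a $ a) (at (std_vertex a) within ideal_simplex)"
      by (intro tendsto_intros)
    then have "\<forall>\<^sub>F x in at (std_vertex a) within ideal_simplex. m < x $ a"
      by (rule order_tendstoD) (use m(1) in \<open>simp add: std_vertex_def\<close>)
    moreover have "\<forall>\<^sub>F x in at (std_vertex a) within ideal_simplex. x \<in> ideal_simplex"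
      by (simp add: eventually_at_filter)
    ultimately show ?thesis by eventually_elim (auto simp: P_def)
  qed
  have "\<tau> ` P \<noteq> {}"
  proof -
    obtain b where "b \<noteq> a" by (metis zero_neq_one)
    then have "\<forall>\<^sub>F t in at_right 0. edge_point a b t \<in> P" using eventually_edge_point[OF _ ev] by metis
    then have "\<exists>t. edge_point a b t \<in> P" by (rule eventually_happens'[OF trivial_limit_at_right_real])
    then show ?thesis by blast
  qed
  then have "C \<inter> p -` N \<noteq> {}" using sub by blast
  then obtain K where "K \<in> components (C \<inter> p -` N)" "\<tau> ` P \<subseteq> K"
    using exists_component_superset[OF sub _ conn] by blast
  moreover have "\<forall>\<^sub>F x in at (std_vertex a) within ideal_simplex. \<tau> x \<in> K"
    using ev by eventually_elim (use \<open>\<tau> ` P \<subseteq> K\<close> in blast)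
  ultimately show thesis using that by blast
qed

lemma eventually_vertex_meet:
  assumes "\<forall>\<^sub>F x in at (std_vertex a) within ideal_simplex. \<tau> x \<in> K"
    "\<forall>\<^sub>F x in at (std_vertex a) within ideal_simplex. \<tau> x \<in> K'"
  shows "K \<inter> K' \<noteq> {}"
proof -
  obtain b where "b \<noteq> a" by (metis zero_neq_one)
  then have "\<forall>\<^sub>F t in at_right 0. \<tau> (edge_point a b t) \<in> K \<and> \<tau> (edge_point a b t) \<in> K'"
    using eventually_edge_point[OF _ eventually_conj[OF assms]] by metis
  then have "\<exists>t. \<tau> (edge_point a b t) \<in> K \<and> \<tau> (edge_point a b t) \<in> K'"
    by (rule eventually_happens'[OF trivial_limit_at_right_real])
  then show ?thesis by blast
qed

text \<open>The separating neighbourhood \<open>N0\<close> gives uniqueness and singles out a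
  candidate \<open>c\<close>. For any other neighbourhood, the refinement gives a boundary component
  lying both in its component and in \<open>K0\<close>; by separation this one is again
  \<open>c\<close>.\<close>

lemma is_end_ex1:
  assumes \<tau>: "lifted i \<tau>"
  shows "\<exists>!c. is_end \<tau> a c"
proof -
  let ?ev = "\<lambda>K. \<forall>\<^sub>F x in at (std_vertex a) within ideal_simplex. \<tau> x \<in> K"
  obtain N0 where N0: "openin (top_of_set M) N0" "bdM \<subseteq> N0"
    and sep: "\<And>K c c'. K \<in> components (C \<inter> p -` N0) \<Longrightarrow> c \<in> Delta C \<Longrightarrow> c' \<in> Delta C \<Longrightarrow> c \<subseteq> K \<Longrightarrow> c' \<subseteq> K \<Longrightarrow> c = c'"
    using boundary_components_separated[OF cover half_space compact_M Hausdorff_M] by blast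
  \<comment> \<open>Near the vertex, the lift stays in one component over a refinement of
    \<open>N \<inter> N'\<close>. That component is contained in both \<open>K\<close> and
    \<open>K'\<close>, and it contains a boundary component.\<close>
  have sub: "\<exists>c\<in>Delta C. c \<subseteq> K \<and> c \<subseteq> K'"
    if K: "K \<in> components (C \<inter> p -` N)" "?ev K" and K': "K' \<in> components (C \<inter> p -` N')" "?ev K'"
      and N: "openin (top_of_set M) N" "bdM \<subseteq> N" and N': "openin (top_of_set M) N'" "bdM \<subseteq> N'" for K K' N N'
  proof -
    have "openin (top_of_set M) (N \<inter> N')" "bdM \<subseteq> N \<inter> N'" using N N' by auto
    then obtain N'' where N'': "openin (top_of_set M) N''" "bdM \<subseteq> N''" "N'' \<subseteq> N \<inter> N'"
      and ex: "\<And>K. K \<in> components (C \<inter> p -` N'') \<Longrightarrow> \<exists>c\<in>Delta C. c \<subseteq> K"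
      using boundary_neighbourhood_refine[OF cover half_space] by metis
    obtain K'' where K'': "K'' \<in> components (C \<inter> p -` N'')" "?ev K''"
      using lifted_in_component[OF \<tau> N''(1,2)] by blast
    have "K'' \<subseteq> C \<inter> p -` N''" "connected K''"
      using in_components_subset[OF K''(1)] in_components_connected[OF K''(1)] by blast+
    moreover from this N''(3) have "K'' \<subseteq> C \<inter> p -` N" "K'' \<subseteq> C \<inter> p -` N'" by auto
    ultimately have "K'' \<subseteq> K" "K'' \<subseteq> K'"
      using components_maximal[OF K(1) _ _ eventually_vertex_meet[OF K(2) K''(2)]]
        components_maximal[OF K'(1) _ _ eventually_vertex_meet[OF K'(2) K''(2)]] by simp_all
    then show ?thesis using ex[OF K''(1)] by blast
  qed
  obtain K0 where K0: "K0 \<in> components (C \<inter> p -` N0)" "?ev K0"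
    using lifted_in_component[OF \<tau> N0] by blast
  obtain c where c: "c \<in> Delta C" "c \<subseteq> K0" using sub[OF K0 K0 N0 N0] by blast
  show ?thesis
  proof (rule ex1I)
    show "is_end \<tau> a c" unfolding is_end_def
    proof (intro conjI allI impI c(1))
      fix N assume N: "openin (top_of_set M) N \<and> bdM \<subseteq> N"
      obtain K where K: "K \<in> components (C \<inter> p -` N)" "?ev K"
        using lifted_in_component[OF \<tau>] N by metis
      obtain c' where "c' \<in> Delta C" "c' \<subseteq> K0" "c' \<subseteq> K" using sub[OF K0 K N0] N by blast
      then have "c \<subseteq> K" using sep[OF K0(1) c(1)] c(2) by blast
      then show "\<exists>K\<in>components (C \<inter> p -` N). c \<subseteq> K \<and> ?ev K" using K by blast
    qed
    fix c' assume "is_end \<tau> a c'"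
    then obtain K where K: "K \<in> components (C \<inter> p -` N0)" "c' \<subseteq> K" "?ev K" and c': "c' \<in> Delta C"
      using N0 unfolding is_end_def by blast
    have "K = K0" using components_eq[OF K(1) K0(1)] eventually_vertex_meet[OF K(3) K0(2)] by blast
    then show "c' = c" using sep[OF K0(1) c' c(1)] K(2) c(2) by blast
  qed
qed

lemma end_of_eq: "end_of \<tau> a = (THE c. is_end \<tau> a c)"
  unfolding ideal_end_def is_end_def ..

lemma is_end_end_of: "lifted i \<tau> \<Longrightarrow> is_end \<tau> a (end_of \<tau> a)"
  unfolding end_of_eq by (rule theI'[OF is_end_ex1])

lemma end_of_unique: "lifted i \<tau> \<Longrightarrow> is_end \<tau> a c \<Longrightarrow> end_of \<tau> a = c"
  using is_end_ex1 is_end_end_of by blast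

lemma end_of_Delta: "lifted i \<tau> \<Longrightarrow> end_of \<tau> a \<in> Delta C"
  using is_end_end_of unfolding is_end_def by blast

text \<open>A deck transformation restricts to a homeomorphism of the preimage of every
  \<open>N\<close>, including the boundary itself, so it permutes components and carries the
  characterisation of one end to the other.\<close>

lemma end_of_deck:
  assumes \<tau>: "lifted i \<tau>" "lifted i \<tau>'" and g: "homeomorphism C C g g'" "\<And>y. y \<in> C \<Longrightarrow> p (g y) = p y"
    and eq: "\<And>x. x \<in> ideal_simplex \<Longrightarrow> \<tau>' x = g (\<tau> x)"
  shows "end_of \<tau>' a = g ` end_of \<tau> a"
proof (rule end_of_unique[OF \<tau>(2)])
  have homN: "homeomorphism (C \<inter> p -` N) (C \<inter> p -` N) g g'" for N
  proof (rule homeomorphism_of_subsets[OF g(1)])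
    have gg: "g ` C = C" "\<And>y. y \<in> C \<Longrightarrow> g (g' y) = y" "g' ` C = C" using g(1) by (auto simp: homeomorphism_def)
    show "g ` (C \<inter> p -` N) = C \<inter> p -` N"
    proof (intro equalityI subsetI)
      fix y assume y: "y \<in> C \<inter> p -` N"
      then have "g' y \<in> C" "g (g' y) = y" using gg by auto
      then show "y \<in> g ` (C \<inter> p -` N)" using g(2)[of "g' y"] y by (auto intro!: image_eqI[of _ _ "g' y"])
    qed (use g(2) gg in auto)
  qed auto
  have e: "is_end \<tau> a (end_of \<tau> a)" by (rule is_end_end_of[OF \<tau>(1)])
  show "is_end \<tau>' a (g ` end_of \<tau> a)" unfolding is_end_def
  proof (intro conjI allI impI)
    show "g ` end_of \<tau> a \<in> Delta C"
      using components_homeomorphism_image[OF homN[of bdM]] end_of_Delta[OF \<tau>(1), of a]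
      unfolding Delta_def manifold_boundary_covering_eq[OF cover] by blast
    fix N assume N: "openin (top_of_set M) N \<and> bdM \<subseteq> N"
    then obtain K where K: "K \<in> components (C \<inter> p -` N)" "end_of \<tau> a \<subseteq> K"
        "\<forall>\<^sub>F x in at (std_vertex a) within ideal_simplex. \<tau> x \<in> K"
      using e unfolding is_end_def by blast
    have "\<forall>\<^sub>F x in at (std_vertex a) within ideal_simplex. x \<in> ideal_simplex"
      by (simp add: eventually_at_filter)
    with K(3) have "\<forall>\<^sub>F x in at (std_vertex a) within ideal_simplex. \<tau>' x \<in> g ` K"
      by eventually_elim (use eq in auto)
    then show "\<exists>K\<in>components (C \<inter> p -` N). g ` end_of \<tau> a \<subseteq> K \<and>
        (\<forall>\<^sub>F x in at (std_vertex a) within ideal_simplex. \<tau>' x \<in> K)"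
      using components_homeomorphism_image[OF homN[of N] K(1)] K(2) by blast
  qed
qed

text \<open>Lifts are functions on all of \<open>real^4\<close>, so two copies of one lift may
  differ off the ideal simplex. The identity, as a deck transformation, shows that the ends do not
  notice.\<close>

lemma end_of_cong:
  assumes "lifted i \<tau>" "lifted i \<tau>'" "\<And>x. x \<in> ideal_simplex \<Longrightarrow> \<tau>' x = \<tau> x"
  shows "end_of \<tau>' a = end_of \<tau> a"
  using end_of_deck[OF assms(1,2), of "\<lambda>y. y" "\<lambda>y. y" a] assms(3) by (simp add: homeomorphism_def)

text \<open>A deck transformation matching the two lifts at one point matches them everywhere, since
  the ideal simplex is connected. This is how equivariance under the fundamental group reaches the
  shapes.\<close>

lemma lifted_deck_related:
  assumes \<tau>: "lifted i \<tau>" "lifted i \<tau>'" and x: "x \<in> C"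
  obtains \<gamma> where "\<gamma> \<in> carrier (fundamental_group M (p x))" "\<And>a. end_of \<tau>' a = deck_of C p x \<gamma> ` end_of \<tau> a"
proof -
  let ?e = "edge_point 0 1 (1/2)"
  have e: "?e \<in> ideal_simplex" by (rule edge_point_in_ideal_simplex) auto
  then have "\<tau> ?e \<in> C" "\<tau>' ?e \<in> C" "p (\<tau>' ?e) = p (\<tau> ?e)" using \<tau> by (auto simp: lifted_tet_def)
  then obtain g g' where g: "homeomorphism C C g g'" "\<And>y. y \<in> C \<Longrightarrow> p (g y) = p y" "g (\<tau> ?e) = \<tau>' ?e"
    using deck_transformation_exists[OF cover simply_connected_C locally_path_connected_C] by metis
  have gC: "continuous_on C g" "g ` C = C" using g(1) by (auto simp: homeomorphism_def)
  have \<tau>C: "continuous_on ideal_simplex \<tau>" "\<tau> ` ideal_simplex \<subseteq> C" using \<tau>(1) by (auto simp: lifted_tet_def)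
  have eq: "\<tau>' y = g (\<tau> y)" if y: "y \<in> ideal_simplex" for y
  proof (rule covering_lift_unique[OF cover convex_connected[OF convex_ideal_simplex], of _ "\<lambda>y. g (\<tau> y)" ?e])
    show "continuous_on ideal_simplex (\<lambda>y. g (\<tau> y))"
      by (rule continuous_on_compose2[OF gC(1) \<tau>C])
    show "(\<lambda>y. g (\<tau> y)) ` ideal_simplex \<subseteq> C" using gC(2) \<tau>C(2) by auto
    show "p (\<tau>' z) = p (g (\<tau> z))" if "z \<in> ideal_simplex" for z
    proof -
      have "p (g (\<tau> z)) = p (\<tau> z)" using g(2) \<tau>C(2) that by blast
      then show ?thesis using \<tau> that by (simp add: lifted_tet_def)
    qed
  qed (use \<tau> e g(3) y in \<open>auto simp: lifted_tet_def\<close>)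
  obtain \<gamma> where \<gamma>: "\<gamma> \<in> carrier (fundamental_group M (p x))" "\<And>y. y \<in> C \<Longrightarrow> deck_of C p x \<gamma> y = g y"
    using deck_of_realizes[OF cover simply_connected_C x g(1,2)] by metis
  have "end_of \<tau>' a = deck_of C p x \<gamma> ` end_of \<tau> a" for a
  proof -
    have "end_of \<tau> a \<subseteq> C"
      using end_of_Delta[OF \<tau>(1), of a] in_components_subset unfolding Delta_def manifold_boundary_def by blast
    then have "deck_of C p x \<gamma> ` end_of \<tau> a = g ` end_of \<tau> a" using \<gamma>(2) by (intro image_cong) auto
    then show ?thesis using end_of_deck[OF \<tau> g(1,2) eq] by simp
  qed
  then show thesis using that \<gamma>(1) by blast
qed

text \<open>Start the neighbour at one point of the shared face; the face without its vertices is
  convex, so the lifts agree on all of it. Ends agree at the three shared vertices only, because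
  each is approached along an edge of that face.\<close>

lemma lifted_neighbour:
  assumes \<tau>: "lifted i \<tau>" and gl: "glue T (i, a) = (j, \<sigma>)"
  obtains \<tau>' where "lifted j \<tau>'" "\<And>x. x \<in> ideal_simplex \<Longrightarrow> x $ a = 0 \<Longrightarrow> \<tau>' (simplex_map \<sigma> x) = \<tau> x"
    "\<And>b. b \<noteq> a \<Longrightarrow> end_of \<tau>' (\<sigma> b) = end_of \<tau> b"
proof -
  have i: "i \<in> tets T" using \<tau> by (simp add: lifted_tet_def)
  note s = glueD[OF i gl]
  let ?F = "ideal_simplex \<inter> {x. x $ a = 0}"
  have "{x::real^4. x $ a = 0} = {x. axis a 1 \<bullet> x = 0}" by (auto simp: inner_axis')
  then have "convex {x::real^4. x $ a = 0}" by (metis convex_hyperplane)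
  then have F: "convex ?F" by (intro convex_Int convex_ideal_simplex)
  have face: "edge_point b d t \<in> ?F" if "b \<noteq> a" "d \<noteq> a" "b \<noteq> d" "0 < t" "t < 1" for b d t
    using edge_point_in_ideal_simplex[of b d t] that by (auto simp: edge_point_component)
  have same: "h (point_class T (i, x)) = h (point_class T (j, simplex_map \<sigma> x))" if "x \<in> ?F" for x
  proof -
    have "((i, x), (j, simplex_map \<sigma> x)) \<in> glue_step T"
      using that i gl unfolding glue_step_def ideal_simplex_def by blast
    then show ?thesis using point_class_eq[OF face_pairing] by metis
  qed
  have im: "simplex_map \<sigma> ` ?F \<subseteq> ideal_simplex" using simplex_map_in_ideal_simplex[OF s(2)] by blast
  obtain b0 where b0: "b0 \<noteq> a" using exists_other_vertex[of a a] by auto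
  obtain d0 where d0: "d0 \<noteq> a" "d0 \<noteq> b0" using exists_other_vertex by blast
  define x0 where "x0 = edge_point b0 d0 (1/2)"
  have x0: "x0 \<in> ?F" unfolding x0_def using face[of b0 d0 "1/2"] b0 d0 by auto
  have "\<tau> x0 \<in> C" "p (\<tau> x0) = h (point_class T (j, simplex_map \<sigma> x0))"
    using \<tau> x0 same[OF x0] by (auto simp: lifted_tet_def)
  then obtain \<tau>' where \<tau>': "lifted j \<tau>'" "\<tau>' (simplex_map \<sigma> x0) = \<tau> x0"
    using lifted_exists[OF s(1), of "simplex_map \<sigma> x0"] im x0 by blast
  have c\<tau>: "continuous_on ?F \<tau>" "\<tau> ` ?F \<subseteq> C"
    using \<tau> by (auto simp: lifted_tet_def intro: continuous_on_subset)
  have c\<tau>': "continuous_on ideal_simplex \<tau>'" "\<tau>' ` ideal_simplex \<subseteq> C" using \<tau>'(1) by (auto simp: lifted_tet_def)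
  have agree: "\<tau>' (simplex_map \<sigma> x) = \<tau> x" if x: "x \<in> ?F" for x
  proof (rule covering_lift_unique[OF cover convex_connected[OF F], of "\<lambda>x. \<tau>' (simplex_map \<sigma> x)" \<tau> x0])
    show "continuous_on ?F (\<lambda>x. \<tau>' (simplex_map \<sigma> x))"
      by (rule continuous_on_compose2[OF c\<tau>'(1) continuous_on_simplex_map im])
    show "(\<lambda>x. \<tau>' (simplex_map \<sigma> x)) ` ?F \<subseteq> C" using c\<tau>'(2) im by auto
    show "p (\<tau>' (simplex_map \<sigma> z)) = p (\<tau> z)" if "z \<in> ?F" for z
      using same[OF that] \<tau> \<tau>'(1) im that by (auto simp: lifted_tet_def)
  qed (use c\<tau> x0 \<tau>'(2) x in auto)
  have ends: "end_of \<tau>' (\<sigma> b) = end_of \<tau> b" if b: "b \<noteq> a" for b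
  proof (rule end_of_unique[OF \<tau>'(1)])
    obtain d where d: "d \<noteq> a" "d \<noteq> b" using exists_other_vertex by blast
    have \<sigma>bd: "\<sigma> b \<noteq> \<sigma> d" using s(2) d by (simp add: bij_def inj_eq)
    have e: "is_end \<tau> b (end_of \<tau> b)" by (rule is_end_end_of[OF \<tau>])
    show "is_end \<tau>' (\<sigma> b) (end_of \<tau> b)" unfolding is_end_def
    proof (intro conjI allI impI)
      show "end_of \<tau> b \<in> Delta C" by (rule end_of_Delta[OF \<tau>])
      fix N assume N: "openin (top_of_set M) N \<and> bdM \<subseteq> N"
      obtain K where K: "K \<in> components (C \<inter> p -` N)" "end_of \<tau> b \<subseteq> K"
          "\<forall>\<^sub>F x in at (std_vertex b) within ideal_simplex. \<tau> x \<in> K"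
        using e N unfolding is_end_def by blast
      obtain K' where K': "K' \<in> components (C \<inter> p -` N)"
          "\<forall>\<^sub>F x in at (std_vertex (\<sigma> b)) within ideal_simplex. \<tau>' x \<in> K'"
        using lifted_in_component[OF \<tau>'(1)] N by metis
      \<comment> \<open>Along the edge from \<open>b\<close> to \<open>d\<close> in the shared face
        the two lifts coincide. Their components therefore meet, hence are equal.\<close>
      have "\<forall>\<^sub>F t in at_right 0. 0 < t \<and> t < (1::real)"
        using eventually_at_right_real[of 0 "1::real"] by simp
      with eventually_edge_point[OF d(2)[symmetric] K(3)] eventually_edge_point[OF \<sigma>bd K'(2)]
      have "\<forall>\<^sub>F t in at_right 0. \<tau> (edge_point b d t) \<in> K \<inter> K'"
      proof eventually_elim
        case (elim t)
        have "edge_point b d t \<in> ?F" using face[OF b d(1) d(2)[symmetric]] elim by blast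
        then have "\<tau>' (edge_point (\<sigma> b) (\<sigma> d) t) = \<tau> (edge_point b d t)"
          using agree by (metis simplex_map_edge_point[OF s(2)])
        then show ?case using elim by simp
      qed
      then have "\<exists>t. \<tau> (edge_point b d t) \<in> K \<inter> K'"
        by (rule eventually_happens'[OF trivial_limit_at_right_real])
      then have "K' = K" using components_eq[OF K(1) K'(1)] by blast
      then show "\<exists>K\<in>components (C \<inter> p -` N). end_of \<tau> b \<subseteq> K \<and>
          (\<forall>\<^sub>F x in at (std_vertex (\<sigma> b)) within ideal_simplex. \<tau>' x \<in> K)"
        using K K' by blast
    qed
  qed
  show thesis using that[OF \<tau>'(1)] agree ends by blast
qed

end

section \<open>The action of the projective group on the projective line\<close>

definition psl :: "complex^2^2 \<Rightarrow> (complex^2^2) set" where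
  "psl A = {A, - A}"

lemma group_SL2C: "group SL2C"
proof (rule groupI)
  fix A assume "A \<in> carrier SL2C"
  then have A: "det A = 1" by (simp add: SL2C_def)
  then have "invertible A" by (simp add: invertible_det_nz)
  then obtain B where B: "A ** B = mat 1" "B ** A = mat 1" unfolding invertible_def by blast
  have "det A * det B = det (mat 1 :: complex^2^2)" using B(1) by (metis det_mul)
  then have "det B = 1" using A by simp
  then show "\<exists>B\<in>carrier SL2C. B \<otimes>\<^bsub>SL2C\<^esub> A = \<one>\<^bsub>SL2C\<^esub>" using B(2) by (auto simp: SL2C_def)
qed (auto simp: SL2C_def det_mul matrix_mul_assoc)

lemma matrix_mul_minus_left: "(- A) ** B = - (A ** B)" for A B :: "complex^2^2"
  by (simp add: matrix_matrix_mult_def vec_eq_iff sum_negf)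

lemma matrix_mul_minus_right: "A ** (- B) = - (A ** B)" for A B :: "complex^2^2"
  by (simp add: matrix_matrix_mult_def vec_eq_iff sum_negf)

lemma det_minus_2: "det (- A) = det A" for A :: "complex^2^2"
  by (simp add: det_2)

lemma r_coset_SL2C: "{mat 1, - mat 1} #>\<^bsub>SL2C\<^esub> A = psl A"
  by (auto simp: r_coset_def SL2C_def psl_def matrix_mul_minus_left)

lemma normal_center_SL2C: "{mat 1, - mat 1} \<lhd> SL2C"
proof -
  interpret group SL2C by (rule group_SL2C)
  have "subgroup {mat 1, - mat 1} SL2C"
  proof (rule subgroupI)
    fix A assume A: "A \<in> {mat 1, - mat 1 :: complex^2^2}"
    have "inv\<^bsub>SL2C\<^esub> A = A"
      using A by (intro inv_equality) (auto simp: SL2C_def matrix_mul_minus_left matrix_mul_minus_right det_minus_2)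
    then show "inv\<^bsub>SL2C\<^esub> A \<in> {mat 1, - mat 1}" using A by simp
  qed (auto simp: SL2C_def det_minus_2 matrix_mul_minus_left matrix_mul_minus_right)
  moreover have "A <#\<^bsub>SL2C\<^esub> {mat 1, - mat 1} = psl A" for A
    by (auto simp: l_coset_def SL2C_def psl_def matrix_mul_minus_right)
  ultimately show ?thesis by (intro normalI) (auto simp: r_coset_SL2C)
qed

lemma group_PSL2C: "group PSL2C"
  unfolding PSL2C_def by (rule normal.factorgroup_is_group[OF normal_center_SL2C])

lemma carrier_PSL2C: "carrier PSL2C = {psl A | A. det A = 1}"
  by (auto simp: PSL2C_def FactGroup_def RCOSETS_def r_coset_SL2C) (auto simp: SL2C_def)

lemma mult_PSL2C:
  assumes "det A = 1" "det B = 1"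
  shows "psl A \<otimes>\<^bsub>PSL2C\<^esub> psl B = psl (A ** B)"
proof -
  have "psl A <#>\<^bsub>SL2C\<^esub> psl B = psl (A ** B)"
    using normal.rcos_sum[OF normal_center_SL2C, of A B] assms unfolding r_coset_SL2C by (simp add: SL2C_def)
  then show ?thesis by (simp add: PSL2C_def FactGroup_def)
qed

lemma one_PSL2C: "\<one>\<^bsub>PSL2C\<^esub> = psl (mat 1)"
  by (simp add: PSL2C_def FactGroup_def psl_def)

text \<open>The matrices \<open>A\<close> and \<open>- A\<close> send a line to the same line, so
  the union in \<open>psl_act\<close> is the span of one image vector. Computations reduce to
  vectors.\<close>

lemma psl_act_span: "psl_act (psl A) (vec.span {v}) = vec.span {A *v v}"
proof -
  have 1: "(*v) A ` vec.span {v} = vec.span {A *v v}"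
    by (auto simp: vec.span_singleton vector_scalar_commute image_image)
  have m: "(- A) *v (k *s v) = (- k) *s (A *v v)" for k
    by (simp add: vec_eq_iff matrix_vector_mult_def sum_negf sum_distrib_left mult_ac)
  have "(- A) *v (k *s v) \<in> vec.span {A *v v}" for k
    unfolding m by (intro vec.span_scale vec.span_base) simp
  then have 2: "(*v) (- A) ` vec.span {v} \<subseteq> vec.span {A *v v}"
    by (subst vec.span_singleton[of v]) blast
  show ?thesis using 1 2 by (auto simp: psl_act_def psl_def)
qed

lemma matrix_vector_nonzero: "det A = 1 \<Longrightarrow> v \<noteq> 0 \<Longrightarrow> A *v v \<noteq> 0" for A :: "complex^2^2"
  by (metis invertible_det_nz matrix_left_invertible_ker invertible_def zero_neq_one)

lemma psl_act_CP1:
  assumes "g \<in> carrier PSL2C" "l \<in> CP1"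
  shows "psl_act g l \<in> CP1"
proof -
  obtain A v where "g = psl A" "det A = 1" "l = vec.span {v}" "v \<noteq> 0"
    using assms by (auto simp: carrier_PSL2C CP1_def)
  then show ?thesis using matrix_vector_nonzero by (auto simp: psl_act_span CP1_def)
qed

lemma psl_act_mult:
  assumes "g \<in> carrier PSL2C" "g' \<in> carrier PSL2C" "l \<in> CP1"
  shows "psl_act (g \<otimes>\<^bsub>PSL2C\<^esub> g') l = psl_act g (psl_act g' l)"
  using assms by (auto simp: carrier_PSL2C CP1_def mult_PSL2C psl_act_span matrix_vector_mul_assoc)

lemma psl_act_one: "l \<in> CP1 \<Longrightarrow> psl_act \<one>\<^bsub>PSL2C\<^esub> l = l"
  by (auto simp: one_PSL2C CP1_def psl_act_span)

lemma psl_act_inv: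
  assumes "g \<in> carrier PSL2C" "l \<in> CP1"
  shows "psl_act (inv\<^bsub>PSL2C\<^esub> g) (psl_act g l) = l"
proof -
  interpret group PSL2C by (rule group_PSL2C)
  show ?thesis using assms by (simp add: psl_act_mult[symmetric] psl_act_one)
qed

lemma psl_act_inj:
  assumes "g \<in> carrier PSL2C" "l \<in> CP1" "l' \<in> CP1" "psl_act g l = psl_act g l'"
  shows "l = l'"
  using psl_act_inv[OF assms(1)] assms by metis

section \<open>Affine coordinates and normal forms\<close>

lemma span_scale:
  assumes "k \<noteq> 0"
  shows "vec.span {k *s v} = vec.span {v :: complex^2}"
proof -
  have "range (\<lambda>c. c *s (k *s v)) = range (\<lambda>c. c *s v)"
  proof (intro equalityI subsetI)
    fix w assume "w \<in> range (\<lambda>c. c *s v)"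
    then obtain c where "w = c *s v" by blast
    then have "w = (c / k) *s (k *s v)" using assms by (simp add: vec_eq_iff)
    then show "w \<in> range (\<lambda>c. c *s (k *s v))" by (rule image_eqI) simp
  next
    fix w assume "w \<in> range (\<lambda>c. c *s (k *s v))"
    then obtain c where "w = (c * k) *s v" by (auto simp: vector_smult_assoc)
    then show "w \<in> range (\<lambda>c. c *s v)" by (rule image_eqI) simp
  qed
  then show ?thesis by (simp add: vec.span_singleton)
qed

lemma cp1_of_inject: "cp1_of z = cp1_of w \<longleftrightarrow> z = w"
proof
  assume "cp1_of z = cp1_of w"
  then have "vector [z, 1] \<in> vec.span {vector [w, 1] :: complex^2}"
    unfolding cp1_of_def by (metis vec.span_base singletonI)
  then show "z = w" by (auto simp: vec.span_singleton vec_eq_iff forall_2)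
qed simp

lemma cp1_of_neq_inf: "cp1_of z \<noteq> cp1_inf"
proof
  assume "cp1_of z = cp1_inf"
  then have "vector [z, 1] \<in> vec.span {vector [1, 0] :: complex^2}"
    unfolding cp1_of_def cp1_inf_def by (metis vec.span_base singletonI)
  then show False by (auto simp: vec.span_singleton vec_eq_iff forall_2)
qed

lemma span_pair:
  fixes v :: "complex^2"
  assumes "v \<noteq> 0"
  shows "vec.span {v} = (if v $ 2 = 0 then cp1_inf else cp1_of (v $ 1 / v $ 2))"
proof (cases "v $ 2 = 0")
  case True
  then have "v = v $ 1 *s vector [1, 0]" "v $ 1 \<noteq> 0" using assms by (auto simp: vec_eq_iff forall_2)
  then show ?thesis using True span_scale unfolding cp1_inf_def by metis
next
  case False
  then have "v = v $ 2 *s vector [v $ 1 / v $ 2, 1]" by (auto simp: vec_eq_iff forall_2)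
  then show ?thesis using False span_scale unfolding cp1_of_def by metis
qed

lemma CP1_cases: "l \<in> CP1 \<Longrightarrow> l = cp1_inf \<or> (\<exists>z. l = cp1_of z)"
  unfolding CP1_def using span_pair by (auto split: if_splits)

lemma matrix_vector_2:
  fixes A :: "complex^2^2"
  shows "(A *v v) $ 1 = A $ 1 $ 1 * v $ 1 + A $ 1 $ 2 * v $ 2" "(A *v v) $ 2 = A $ 2 $ 1 * v $ 1 + A $ 2 $ 2 * v $ 2"
  by (simp_all add: matrix_vector_mult_def sum_2)

lemma PSL2C_normalize:
  assumes "u \<in> CP1" "v \<in> CP1" "u \<noteq> v"
  obtains g where "g \<in> carrier PSL2C" "psl_act g u = cp1_of 0" "psl_act g v = cp1_inf"
proof -
  obtain a b where a: "u = vec.span {a}" "a \<noteq> 0" and b: "v = vec.span {b}" "b \<noteq> 0"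
    using assms by (auto simp: CP1_def)
  \<comment> \<open>Up to sign the determinant of the two spanning vectors, nonzero exactly because
    the lines differ.\<close>
  define D where "D = b $ 1 * a $ 2 - a $ 1 * b $ 2"
  have D: "D \<noteq> 0"
  proof
    assume "D = 0"
    then have *: "b $ 1 * a $ 2 = a $ 1 * b $ 2" by (simp add: D_def)
    have "a $ 1 \<noteq> 0 \<or> a $ 2 \<noteq> 0" "b $ 1 \<noteq> 0 \<or> b $ 2 \<noteq> 0" using a b by (auto simp: vec_eq_iff forall_2)
    then have z: "a $ 2 = 0 \<longleftrightarrow> b $ 2 = 0" using * by auto
    have "a $ 1 / a $ 2 = b $ 1 / b $ 2" if "a $ 2 \<noteq> 0" using that z * by (simp add: frac_eq_eq)
    then have "vec.span {a} = vec.span {b}"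
      unfolding span_pair[OF a(2)] span_pair[OF b(2)] using z by simp
    then show False using assms a b by simp
  qed
  \<comment> \<open>The first row annihilates \<open>a\<close>, sending its line to
    \<open>0\<close>; the second annihilates \<open>b\<close>, sending its line to infinity.
    Dividing the second row by \<open>D\<close> makes the determinant \<open>1\<close>.\<close>
  define A :: "complex^2^2" where "A = vector [vector [a $ 2, - a $ 1], vector [- b $ 2 / D, b $ 1 / D]]"
  have "det A = (b $ 1 * a $ 2 - a $ 1 * b $ 2) / D" by (simp add: A_def det_2 diff_divide_distrib mult_ac)
  then have det: "det A = 1" using D by (simp add: D_def)
  have Ab: "(A *v b) $ 1 = D" "(A *v b) $ 2 = 0" by (simp_all add: matrix_vector_2 A_def D_def mult_ac)
  have "(A *v a) $ 2 = (b $ 1 * a $ 2 - a $ 1 * b $ 2) / D"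
    by (simp add: matrix_vector_2 A_def diff_divide_distrib mult_ac)
  then have Aa: "(A *v a) $ 1 = 0" "(A *v a) $ 2 = 1"
    using D by (simp_all add: D_def matrix_vector_2 A_def mult_ac)
  show thesis
  proof (rule that[of "psl A"])
    show "psl A \<in> carrier PSL2C" using det by (auto simp: carrier_PSL2C)
    have "A *v a \<noteq> 0" "A *v b \<noteq> 0" using matrix_vector_nonzero[OF det] a b by auto
    then show "psl_act (psl A) u = cp1_of 0" "psl_act (psl A) v = cp1_inf"
      unfolding a b psl_act_span by (simp_all add: span_pair Aa Ab)
  qed
qed

lemma PSL2C_scale:
  assumes "s \<noteq> 0"
  obtains g where "g \<in> carrier PSL2C" "psl_act g cp1_inf = cp1_inf" "\<And>z. psl_act g (cp1_of z) = cp1_of (z / s)"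
proof -
  \<comment> \<open>The diagonal matrix with entries \<open>r\<close> and \<open>1 / r\<close>
    scales the affine coordinate by the square of \<open>r\<close>, so a square root of
    \<open>1 / s\<close> is required.\<close>
  define r where "r = csqrt (1 / s)"
  have r: "r * r = 1 / s" using power2_csqrt[of "1 / s"] by (simp add: r_def power2_eq_square)
  then have r0: "r \<noteq> 0" using assms by auto
  define A :: "complex^2^2" where "A = vector [vector [r, 0], vector [0, 1 / r]]"
  have det: "det A = 1" using r0 by (simp add: A_def det_2)
  have nz: "vector [z, 1] \<noteq> (0 :: complex^2)" "vector [1, 0] \<noteq> (0 :: complex^2)" for z
    by (auto simp: vec_eq_iff forall_2)
  show thesis
  proof (rule that[of "psl A"])
    show "psl A \<in> carrier PSL2C" using det by (auto simp: carrier_PSL2C)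
    show "psl_act (psl A) cp1_inf = cp1_inf"
      using matrix_vector_nonzero[OF det nz(2)]
      unfolding cp1_inf_def psl_act_span by (simp add: span_pair matrix_vector_2 A_def cp1_inf_def)
    fix z
    have "(A *v vector [z, 1]) $ 1 / (A *v vector [z, 1]) $ 2 = r * r * z"
      using r0 by (simp add: matrix_vector_2 A_def)
    then have "(A *v vector [z, 1]) $ 1 / (A *v vector [z, 1]) $ 2 = z / s" using r by simp
    moreover have "(A *v vector [z, 1]) $ 2 \<noteq> 0" using r0 by (simp add: matrix_vector_2 A_def)
    ultimately show "psl_act (psl A) (cp1_of z) = cp1_of (z / s)"
      using matrix_vector_nonzero[OF det nz(1)[of z]]
      unfolding cp1_of_def[of z] psl_act_span by (simp add: span_pair)
  qed
qed

text \<open>Fixing the two coordinate lines makes the matrix diagonal, and it then multiplies the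
  affine coordinate by the ratio of its diagonal entries.\<close>

lemma PSL2C_fix_0_inf:
  assumes g: "g \<in> carrier PSL2C" and fix0: "psl_act g (cp1_of 0) = cp1_of 0" and fixinf: "psl_act g cp1_inf = cp1_inf"
  obtains k where "k \<noteq> 0" "\<And>z. psl_act g (cp1_of z) = cp1_of (k * z)"
proof -
  obtain A where A: "g = psl A" "det A = 1" using g by (auto simp: carrier_PSL2C)
  have nz: "vector [z, 1] \<noteq> (0 :: complex^2)" "vector [1, 0] \<noteq> (0 :: complex^2)" for z
    by (auto simp: vec_eq_iff forall_2)
  have act: "psl_act g (vec.span {v}) = (if (A *v v) $ 2 = 0 then cp1_inf else cp1_of ((A *v v) $ 1 / (A *v v) $ 2))"
    if "v \<noteq> 0" for v
    unfolding A(1) psl_act_span by (rule span_pair[OF matrix_vector_nonzero[OF A(2) that]])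
  have A21: "A $ 2 $ 1 = 0"
    using fixinf act[OF nz(2)] cp1_of_neq_inf unfolding cp1_inf_def[symmetric]
    by (auto simp: matrix_vector_2 split: if_splits)
  have A22: "A $ 1 $ 1 * A $ 2 $ 2 = 1" using A(2) A21 by (simp add: det_2)
  then have n: "A $ 1 $ 1 \<noteq> 0" "A $ 2 $ 2 \<noteq> 0" by auto
  have "cp1_of (A $ 1 $ 2 / A $ 2 $ 2) = cp1_of 0"
    using fix0 act[OF nz(1)[of 0]] n unfolding cp1_of_def[of 0, symmetric] by (simp add: matrix_vector_2)
  then have A12: "A $ 1 $ 2 = 0" using n by (simp add: cp1_of_inject)
  show thesis
  proof (rule that[of "A $ 1 $ 1 / A $ 2 $ 2"])
    show "psl_act g (cp1_of z) = cp1_of (A $ 1 $ 1 / A $ 2 $ 2 * z)" for z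
      using act[OF nz(1)[of z]] n A21 A12 unfolding cp1_of_def[of z, symmetric] by (simp add: matrix_vector_2)
  qed (use n in auto)
qed

section \<open>Shapes and their parameters\<close>

lemma shape_of_related:
  assumes "range f \<subseteq> CP1" "f1 \<in> shape_of f" "f2 \<in> shape_of f"
  obtains g where "g \<in> carrier PSL2C" "f2 = (\<lambda>k. psl_act g (f1 k))"
proof -
  interpret group PSL2C by (rule group_PSL2C)
  obtain g1 g2 where g: "g1 \<in> carrier PSL2C" "f1 = (\<lambda>k. psl_act g1 (f k))"
      "g2 \<in> carrier PSL2C" "f2 = (\<lambda>k. psl_act g2 (f k))"
    using assms(2,3) by (auto simp: shape_of_def)
  have fk: "f k \<in> CP1" for k using assms(1) by auto
  have "f2 k = psl_act (g2 \<otimes>\<^bsub>PSL2C\<^esub> inv\<^bsub>PSL2C\<^esub> g1) (f1 k)" for k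
    using g fk[of k] by (simp add: psl_act_mult psl_act_CP1 psl_act_inv)
  then show thesis using that[of "g2 \<otimes>\<^bsub>PSL2C\<^esub> inv\<^bsub>PSL2C\<^esub> g1"] g by auto
qed

lemma shape_members:
  assumes "S \<in> shapes" "f \<in> S"
  shows "inj f" "range f \<subseteq> CP1"
proof -
  obtain f0 g where f0: "inj f0" "range f0 \<subseteq> CP1" and g: "g \<in> carrier PSL2C" "f = (\<lambda>k. psl_act g (f0 k))"
    using assms by (auto simp: shapes_def shape_of_def)
  have fk: "f0 k \<in> CP1" for k using f0 by auto
  show "inj f" unfolding g(2)
    by (rule injI, rule injD[OF f0(1)], rule psl_act_inj[OF g(1) fk fk])
  show "range f \<subseteq> CP1" unfolding g(2) using psl_act_CP1[OF g(1) fk] by auto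
qed

text \<open>Two maps that send the same pair to \<open>0\<close> and infinity differ by a scaling,
  so the ratio of the other two coordinates is invariant. The parameter can thus be read off without
  moving the third vertex to \<open>1\<close>, which lets one normalisation serve all tetrahedra
  around an edge.\<close>

lemma shape_parameter_eq:
  assumes f0: "range f0 \<subseteq> CP1" and f: "f \<in> shape_of f0" and g: "g \<in> carrier PSL2C"
    and eq: "psl_act g (f a) = cp1_of 0" "psl_act g (f b) = cp1_inf" "psl_act g (f c) = cp1_of s" "psl_act g (f d) = cp1_of t"
    and s: "s \<noteq> 0"
  shows "shape_parameter (shape_of f0) a b c d = t / s"
  unfolding shape_parameter_def
proof (rule the_equality)
  interpret group PSL2C by (rule group_PSL2C)
  have fk: "f k \<in> CP1" for k using f f0 psl_act_CP1 by (auto simp: shape_of_def)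
  obtain e where e: "e \<in> carrier PSL2C" "psl_act e cp1_inf = cp1_inf" "\<And>z. psl_act e (cp1_of z) = cp1_of (z / s)"
    using PSL2C_scale[OF s] by blast
  show "\<exists>f\<in>shape_of f0. \<exists>g\<in>carrier PSL2C. psl_act g (f a) = cp1_of 0 \<and> psl_act g (f b) = cp1_inf \<and>
     psl_act g (f c) = cp1_of 1 \<and> psl_act g (f d) = cp1_of (t / s)"
    by (rule bexI[OF _ f], rule bexI[of _ "e \<otimes>\<^bsub>PSL2C\<^esub> g"])
      (use e g s in \<open>simp_all add: psl_act_mult fk eq\<close>)
  fix z assume "\<exists>f\<in>shape_of f0. \<exists>g\<in>carrier PSL2C. psl_act g (f a) = cp1_of 0 \<and> psl_act g (f b) = cp1_inf \<and>
     psl_act g (f c) = cp1_of 1 \<and> psl_act g (f d) = cp1_of z"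
  then obtain f' g' where f': "f' \<in> shape_of f0" and g': "g' \<in> carrier PSL2C"
    and eq': "psl_act g' (f' a) = cp1_of 0" "psl_act g' (f' b) = cp1_inf" "psl_act g' (f' c) = cp1_of 1" "psl_act g' (f' d) = cp1_of z"
    by blast
  obtain k where k: "k \<in> carrier PSL2C" "f' = (\<lambda>j. psl_act k (f j))" using shape_of_related[OF f0 f f'] by blast
  \<comment> \<open>The change from the first normalisation to the second; it fixes \<open>0\<close>
    and infinity, so it is a scaling.\<close>
  define q where "q = g' \<otimes>\<^bsub>PSL2C\<^esub> k \<otimes>\<^bsub>PSL2C\<^esub> inv\<^bsub>PSL2C\<^esub> g"
  have q: "q \<in> carrier PSL2C" using g g' k by (simp add: q_def)
  have qf: "psl_act q (psl_act g (f j)) = psl_act g' (f' j)" for j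
    unfolding q_def using g g' k fk[of j] by (simp add: psl_act_mult psl_act_CP1 psl_act_inv)
  obtain r where r: "\<And>z. psl_act q (cp1_of z) = cp1_of (r * z)"
    using PSL2C_fix_0_inf[OF q] qf[of a] qf[of b] eq eq' by metis
  have "r * s = 1" "r * t = z"
    using qf[of c] qf[of d] eq eq' r by (simp_all add: cp1_of_inject)
  then show "z = t / s" using s by (auto simp: field_simps)
qed

section \<open>Gluing equations and anchorings\<close>

text \<open>With \<open>k\<close> the first return time, the iterates below \<open>k\<close> list
  the orbit without repetition. The gluing equations multiply over the orbit as a set, so this turns
  them into products over an interval.\<close>

lemma finite_injective_orbit:
  assumes A: "finite A" "f ` A \<subseteq> A" "inj_on f A" and x: "x \<in> A"
  obtains k where "k > 0" "(f ^^ k) x = x" "inj_on (\<lambda>n. (f ^^ n) x) {..<k}"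
    "{(f ^^ n) x | n. True} = (\<lambda>n. (f ^^ n) x) ` {..<k}"
proof -
  have inA: "(f ^^ n) x \<in> A" for n using A x by (induction n) auto
  have cancel: "(f ^^ (n - m)) x = x" if "(f ^^ m) x = (f ^^ n) x" "m \<le> n" for m n
    using that
  proof (induction m arbitrary: n)
    case (Suc m)
    then obtain n' where n: "n = Suc n'" by (cases n) auto
    then have "f ((f ^^ m) x) = f ((f ^^ n') x)" using Suc by simp
    then have "(f ^^ m) x = (f ^^ n') x" using A(3) inA by (meson inj_onD)
    then show ?case using Suc n by simp
  qed simp
  have "\<not> inj (\<lambda>n. (f ^^ n) x)"
    using finite_imageD[of "\<lambda>n. (f ^^ n) x" UNIV] finite_subset[OF _ A(1), of "range (\<lambda>n. (f ^^ n) x)"] inA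
    by auto
  then obtain m n where "m < n" "(f ^^ m) x = (f ^^ n) x" unfolding inj_def by (metis linorder_neqE_nat)
  then have "n - m > 0 \<and> (f ^^ (n - m)) x = x" using cancel by auto
  then have ex: "\<exists>k. k > 0 \<and> (f ^^ k) x = x" by blast
  define k where "k = (LEAST k. k > 0 \<and> (f ^^ k) x = x)"
  have k: "k > 0" "(f ^^ k) x = x" unfolding k_def using LeastI_ex[OF ex] by auto
  have least: "k \<le> j" if "j > 0" "(f ^^ j) x = x" for j unfolding k_def using that by (intro Least_le) auto
  show thesis
  proof (rule that[OF k])
    show "inj_on (\<lambda>n. (f ^^ n) x) {..<k}"
    proof (rule linorder_inj_onI)
      fix m n assume mn: "m < n" "m \<in> {..<k}" "n \<in> {..<k}"
      show "(f ^^ m) x \<noteq> (f ^^ n) x"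
      proof
        assume "(f ^^ m) x = (f ^^ n) x"
        then have "k \<le> n - m" using cancel mn by (intro least) auto
        then show False using mn by auto
      qed
    qed auto
    have "(f ^^ n) x = (f ^^ (n mod k)) x" for n using k(2) by (simp add: funpow_mod_eq)
    then show "{(f ^^ n) x | n. True} = (\<lambda>n. (f ^^ n) x) ` {..<k}"
      using k(1) by (auto intro!: image_eqI[of _ _ "_ mod k"])
  qed
qed

lemma rotate_flag_in_flags:
  assumes "face_pairing T" "F \<in> flags T"
  shows "rotate_flag T F \<in> flags T"
proof -
  obtain i a b c d where F: "F = (i, a, b, c, d)" "i \<in> tets T" "distinct [a, b, c, d]"
    using assms(2) by (auto simp: flags_def)
  obtain j \<sigma> where gl: "glue T (i, c) = (j, \<sigma>)" by fastforce
  then have "j \<in> tets T" "bij \<sigma>" using assms(1) F(2) unfolding face_pairing_def by blast+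
  then show ?thesis using F gl by (auto simp: flags_def rotate_flag_def bij_def inj_eq)
qed

text \<open>Rotation can be undone: the face just entered is opposite the last vertex of the new
  flag, so crossing it back recovers the old flag.\<close>

lemma inj_on_rotate_flag:
  assumes fp: "face_pairing T"
  shows "inj_on (rotate_flag T) (flags T)"
proof -
  define unrotate where "unrotate = (\<lambda>(j, a, b, c, d). case glue T (j, d) of (i, \<sigma>) \<Rightarrow> (i, \<sigma> a, \<sigma> b, \<sigma> d, \<sigma> c))"
  have "unrotate (rotate_flag T F) = F" if FT: "F \<in> flags T" for F
  proof -
    obtain i a b c d where F: "F = (i, a, b, c, d)" "i \<in> tets T" "distinct [a, b, c, d]"
      using FT by (auto simp: flags_def)
    obtain j \<sigma> where gl: "glue T (i, c) = (j, \<sigma>)" by fastforce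
    then have "bij \<sigma>" "glue T (j, \<sigma> c) = (i, inv_into UNIV \<sigma>)" using fp F(2) unfolding face_pairing_def by blast+
    then show ?thesis using F gl by (simp add: unrotate_def rotate_flag_def bij_is_inj)
  qed
  then show ?thesis by (rule inj_on_inverseI)
qed

lemma finite_flags: "face_pairing T \<Longrightarrow> finite (flags T)"
  by (rule finite_subset[of _ "tets T \<times> UNIV"]) (auto simp: flags_def face_pairing_def)

context triangulated_cover
begin

text \<open>Consecutive lifts agree at the midpoint of the edge, so when the flag recurs the lift recurs.
  Here \<open>w\<close> enumerates the vertices of the link of the edge.\<close>

lemma lifted_around_edge:
  assumes F: "F \<in> flags T"
  obtains u v w where
    "\<And>n i a b c d. (rotate_flag T ^^ n) F = (i, a, b, c, d) \<Longrightarrow>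
       \<exists>\<tau>. lifted i \<tau> \<and> end_of \<tau> a = u \<and> end_of \<tau> b = v \<and> end_of \<tau> c = w n \<and> end_of \<tau> d = w (Suc n)"
    "\<And>k. (rotate_flag T ^^ k) F = F \<Longrightarrow> w k = w 0"
proof -
  let ?G = "\<lambda>n. (rotate_flag T ^^ n) F"
  define ti where "ti n = fst (?G n)" for n
  define fa where "fa n = fst (snd (?G n))" for n
  define fb where "fb n = fst (snd (snd (?G n)))" for n
  define fc where "fc n = fst (snd (snd (snd (?G n))))" for n
  define fd where "fd n = snd (snd (snd (snd (?G n))))" for n
  have G: "?G n = (ti n, fa n, fb n, fc n, fd n)" for n by (simp add: ti_def fa_def fb_def fc_def fd_def)
  have fl: "?G n \<in> flags T" for n using F rotate_flag_in_flags[OF face_pairing] by (induction n) auto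
  have t: "ti n \<in> tets T" "distinct [fa n, fb n, fc n, fd n]" for n using fl[of n] unfolding G by (auto simp: flags_def)
  define mid where "mid n \<tau> = \<tau> (edge_point (fa n) (fb n) (1/2))" for n and \<tau> :: "real^4 \<Rightarrow> 'b"
  \<comment> \<open>Crossing the face opposite \<open>fc n\<close> keeps the vertex
    \<open>fd n\<close>, which becomes the third vertex of the next flag. Consecutive tetrahedra
    thus share a link vertex, and \<open>w\<close> is well matched.\<close>
  have "\<exists>f. \<forall>n. lifted (ti n) (f n) \<and> (mid (Suc n) (f (Suc n)) = mid n (f n) \<and>
      end_of (f (Suc n)) (fa (Suc n)) = end_of (f n) (fa n) \<and>
      end_of (f (Suc n)) (fb (Suc n)) = end_of (f n) (fb n) \<and>
      end_of (f (Suc n)) (fc (Suc n)) = end_of (f n) (fd n))"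
  proof (rule dependent_nat_choice)
    show "\<exists>\<tau>. lifted (ti 0) \<tau>" using lifted_exists_some[OF t(1)] by blast
    fix \<tau> n assume \<tau>: "lifted (ti n) \<tau>"
    obtain j \<sigma> where gl: "glue T (ti n, fc n) = (j, \<sigma>)" by fastforce
    have \<sigma>: "bij \<sigma>" using glueD(2)[OF t(1) gl] .
    have "?G (Suc n) = rotate_flag T (?G n)" by simp
    then have "(ti (Suc n), fa (Suc n), fb (Suc n), fc (Suc n), fd (Suc n)) = (j, \<sigma> (fa n), \<sigma> (fb n), \<sigma> (fd n), \<sigma> (fc n))"
      unfolding G using gl by (simp add: rotate_flag_def)
    then have S: "ti (Suc n) = j" "fa (Suc n) = \<sigma> (fa n)" "fb (Suc n) = \<sigma> (fb n)" "fc (Suc n) = \<sigma> (fd n)" by auto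
    obtain \<tau>' where \<tau>': "lifted j \<tau>'" "\<And>x. x \<in> ideal_simplex \<Longrightarrow> x $ fc n = 0 \<Longrightarrow> \<tau>' (simplex_map \<sigma> x) = \<tau> x"
        "\<And>b. b \<noteq> fc n \<Longrightarrow> end_of \<tau>' (\<sigma> b) = end_of \<tau> b"
      using lifted_neighbour[OF \<tau> gl] by blast
    have "\<tau>' (simplex_map \<sigma> (edge_point (fa n) (fb n) (1/2))) = \<tau> (edge_point (fa n) (fb n) (1/2))"
      using t(2)[of n] by (intro \<tau>'(2) edge_point_in_ideal_simplex) (auto simp: edge_point_component)
    then show "\<exists>\<tau>'. lifted (ti (Suc n)) \<tau>' \<and> (mid (Suc n) \<tau>' = mid n \<tau> \<and>
        end_of \<tau>' (fa (Suc n)) = end_of \<tau> (fa n) \<and> end_of \<tau>' (fb (Suc n)) = end_of \<tau> (fb n) \<and>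
        end_of \<tau>' (fc (Suc n)) = end_of \<tau> (fd n))"
      using \<tau>' t(2)[of n] unfolding S mid_def simplex_map_edge_point[OF \<sigma>] by (intro exI[of _ \<tau>']) auto
  qed
  then obtain f where f: "\<And>n. lifted (ti n) (f n)"
    and step: "\<And>n. mid (Suc n) (f (Suc n)) = mid n (f n)" "\<And>n. end_of (f (Suc n)) (fa (Suc n)) = end_of (f n) (fa n)"
      "\<And>n. end_of (f (Suc n)) (fb (Suc n)) = end_of (f n) (fb n)" "\<And>n. end_of (f (Suc n)) (fc (Suc n)) = end_of (f n) (fd n)"
    by metis
  have const: "mid n (f n) = mid 0 (f 0)" "end_of (f n) (fa n) = end_of (f 0) (fa 0)" "end_of (f n) (fb n) = end_of (f 0) (fb 0)" for n
    using step by (induction n) simp_all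
  define w where "w n = end_of (f n) (fc n)" for n
  show thesis
  proof (rule that[of "end_of (f 0) (fa 0)" "end_of (f 0) (fb 0)" w])
    fix n i a b c d assume "?G n = (i, a, b, c, d)"
    then have "i = ti n" "a = fa n" "b = fb n" "c = fc n" "d = fd n" unfolding G by auto
    then show "\<exists>\<tau>. lifted i \<tau> \<and> end_of \<tau> a = end_of (f 0) (fa 0) \<and> end_of \<tau> b = end_of (f 0) (fb 0) \<and>
        end_of \<tau> c = w n \<and> end_of \<tau> d = w (Suc n)"
      using f const step by (intro exI[of _ "f n"]) (auto simp: w_def)
  next
    fix k assume "?G k = F"
    then have "?G k = ?G 0" by simp
    then have k: "ti k = ti 0" "fa k = fa 0" "fb k = fb 0" "fc k = fc 0" unfolding G by auto
    have e: "edge_point (fa 0) (fb 0) (1/2) \<in> ideal_simplex"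
      using t(2)[of 0] by (intro edge_point_in_ideal_simplex) auto
    have "f k (edge_point (fa 0) (fb 0) (1/2)) = f 0 (edge_point (fa 0) (fb 0) (1/2))"
      using const(1)[of k] k by (simp add: mid_def)
    then have "f k y = f 0 y" if "y \<in> ideal_simplex" for y
      using lifted_unique[OF _ f[of 0] e] f[of k] k that by metis
    then show "w k = w 0" unfolding w_def using end_of_cong[OF f[of 0], of "f k"] f[of k] k by metis
  qed
qed

end

section \<open>The two implications\<close>

lemma solves_gluing_equations_anchored:
  assumes tc: "triangulated_cover M C p T h" and x: "x \<in> C"
    and \<rho>: "\<rho> \<in> hom (fundamental_group M (p x)) PSL2C"
    and L: "anchoring M C p x \<rho> L" "L_essential M C p T h L"
  obtains Z where "solves_gluing_equations T Z" "pseudo_developing M C p T h Z L"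
proof -
  interpret triangulated_cover M C p T h by (rule tc)
  have LC: "L c \<in> CP1" if "c \<in> Delta C" for c using L(1) that by (auto simp: anchoring_def)
  define V where "V \<tau> a = L (end_of \<tau> a)" for \<tau> a
  have V: "range (V \<tau>) \<subseteq> CP1" "inj (V \<tau>)" if \<tau>: "lifted i \<tau>" for i \<tau>
  proof -
    show "range (V \<tau>) \<subseteq> CP1" using LC end_of_Delta[OF \<tau>] by (auto simp: V_def)
    \<comment> \<open>Any two vertices of a tetrahedron are the ends of an edge, so essentiality is
      exactly injectivity here.\<close>
    show "inj (V \<tau>)"
      using L(2) \<tau> unfolding L_essential_def lifted_edge_ends_def V_def inj_def by metis
  qed
  define lift where "lift i = (SOME \<tau>. lifted i \<tau>)" for i
  have lift: "lifted i (lift i)" if i: "i \<in> tets T" for i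
    unfolding lift_def by (rule lifted_exists_some[OF i]) (rule someI[where P = "lifted i"])
  define Z where "Z i = shape_of (V (lift i))" for i
  have tets: "i \<in> tets T" if "lifted i \<tau>" for i \<tau> using that by (simp add: lifted_tet_def)
  \<comment> \<open>\<open>Z\<close> was read off from one chosen lift. Any other lift differs by a
    deck transformation, and \<open>\<rho> \<gamma>\<close> moves the values of \<open>L\<close>
    accordingly, so its shape is the same.\<close>
  have VZ: "V \<tau> \<in> Z i" if \<tau>: "lifted i \<tau>" for i \<tau>
  proof -
    obtain \<gamma> where \<gamma>: "\<gamma> \<in> carrier (fundamental_group M (p x))"
      "\<And>a. end_of \<tau> a = deck_of C p x \<gamma> ` end_of (lift i) a"
      using lifted_deck_related[OF lift[OF tets[OF \<tau>]] \<tau> x] by blast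
    have "V \<tau> a = psl_act (\<rho> \<gamma>) (V (lift i) a)" for a
      using L(1) \<gamma> end_of_Delta[OF lift[OF tets[OF \<tau>]], of a] unfolding V_def anchoring_def by simp
    moreover have "\<rho> \<gamma> \<in> carrier PSL2C" using \<rho> \<gamma>(1) by (auto simp: hom_def)
    ultimately show ?thesis unfolding Z_def shape_of_def by blast
  qed
  have pd: "pseudo_developing M C p T h Z L"
    using LC VZ unfolding pseudo_developing_def V_def by auto
  have "(\<Prod>(i, a, b, c, d)\<in>{(rotate_flag T ^^ n) F | n. True}. shape_parameter (Z i) a b c d) = 1"
    if F: "F \<in> flags T" for F
  proof -
    let ?G = "\<lambda>n. (rotate_flag T ^^ n) F"
    obtain u v w where uvw: "\<And>n i a b c d. ?G n = (i, a, b, c, d) \<Longrightarrow>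
         \<exists>\<tau>. lifted i \<tau> \<and> end_of \<tau> a = u \<and> end_of \<tau> b = v \<and> end_of \<tau> c = w n \<and> end_of \<tau> d = w (Suc n)"
      and close: "\<And>k. ?G k = F \<Longrightarrow> w k = w 0"
      by (rule lifted_around_edge[OF F]) blast
    have fl: "?G n \<in> flags T" for n using F rotate_flag_in_flags[OF face_pairing] by (induction n) auto
    have at: "\<exists>i a b c d \<tau>. ?G n = (i, a, b, c, d) \<and> lifted i \<tau> \<and> distinct [a, b, c, d] \<and>
        V \<tau> a = L u \<and> V \<tau> b = L v \<and> V \<tau> c = L (w n) \<and> V \<tau> d = L (w (Suc n))" for n
    proof -
      obtain i a b c d where G: "?G n = (i, a, b, c, d)" "distinct [a, b, c, d]"
        using fl[of n] by (auto simp: flags_def)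
      obtain \<tau> where "lifted i \<tau>" "end_of \<tau> a = u" "end_of \<tau> b = v" "end_of \<tau> c = w n" "end_of \<tau> d = w (Suc n)"
        using uvw[OF G(1)] by (elim exE conjE)
      then show ?thesis using G unfolding V_def
        by (intro exI[of _ i] exI[of _ a] exI[of _ b] exI[of _ c] exI[of _ d] exI[of _ \<tau>]) simp
    qed
    have distinct: "L u \<noteq> L v" "L (w n) \<noteq> L u" "L (w n) \<noteq> L v" "L u \<in> CP1" "L v \<in> CP1" "L (w n) \<in> CP1" for n
    proof -
      obtain i a b c d \<tau> where G: "lifted i \<tau>" "distinct [a, b, c, d]"
        "V \<tau> a = L u" "V \<tau> b = L v" "V \<tau> c = L (w n)" using at[of n] by (elim exE conjE)
      note VV = V[OF G(1)]
      show "L u \<noteq> L v" "L (w n) \<noteq> L u" "L (w n) \<noteq> L v"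
        unfolding G(3,4,5)[symmetric] using VV(2) G(2) by (auto simp: inj_eq)
      show "L u \<in> CP1" "L v \<in> CP1" "L (w n) \<in> CP1"
        unfolding G(3,4,5)[symmetric] using VV(1) by auto
    qed
    obtain g where g: "g \<in> carrier PSL2C" "psl_act g (L u) = cp1_of 0" "psl_act g (L v) = cp1_inf"
      using PSL2C_normalize[OF distinct(4,5,1)] by blast
    \<comment> \<open>Injectivity on each tetrahedron keeps \<open>L (w n)\<close> away from both
      ends of the edge, so its coordinate is finite and nonzero.\<close>
    have "\<exists>z. psl_act g (L (w n)) = cp1_of z \<and> z \<noteq> 0" for n
    proof -
      have "psl_act g (L (w n)) \<noteq> cp1_inf" "psl_act g (L (w n)) \<noteq> cp1_of 0"
        using psl_act_inj[OF g(1)] g(2,3) distinct by metis+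
      then show ?thesis using CP1_cases[OF psl_act_CP1[OF g(1) distinct(6)[of n]]] by metis
    qed
    then obtain \<omega> where \<omega>: "\<And>n. psl_act g (L (w n)) = cp1_of (\<omega> n)" "\<And>n. \<omega> n \<noteq> 0" by metis
    have param: "(case ?G n of (i, a, b, c, d) \<Rightarrow> shape_parameter (Z i) a b c d) = \<omega> (Suc n) / \<omega> n" for n
    proof -
      obtain i a b c d \<tau> where G: "?G n = (i, a, b, c, d)" "lifted i \<tau>"
        "V \<tau> a = L u" "V \<tau> b = L v" "V \<tau> c = L (w n)" "V \<tau> d = L (w (Suc n))" using at[of n] by (elim exE conjE)
      have "shape_parameter (Z i) a b c d = \<omega> (Suc n) / \<omega> n"
        unfolding Z_def
        by (rule shape_parameter_eq[OF V(1)[OF lift[OF tets[OF G(2)]]] VZ[OF G(2), unfolded Z_def] g(1)])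
          (use G g \<omega> in auto)
      then show ?thesis using G(1) by simp
    qed
    obtain k where k: "k > 0" "?G k = F" "inj_on ?G {..<k}" "{?G n | n. True} = ?G ` {..<k}"
      using finite_injective_orbit[OF finite_flags[OF face_pairing] _ inj_on_rotate_flag[OF face_pairing] F]
        rotate_flag_in_flags[OF face_pairing] by blast
    have "\<omega> k = \<omega> 0" using close[OF k(2)] \<omega>(1) cp1_of_inject by metis
    have "(\<Prod>(i, a, b, c, d)\<in>{?G n | n. True}. shape_parameter (Z i) a b c d) = (\<Prod>n<k. \<omega> (Suc n) / \<omega> n)"
      unfolding k(4) using param by (simp add: prod.reindex[OF k(3)])
    also have "\<dots> = \<omega> k / \<omega> 0" using \<omega>(2) by (intro prod_lessThan_telescope) auto
    finally show ?thesis using \<open>\<omega> k = \<omega> 0\<close> \<omega>(2) by simp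
  qed
  moreover have "Z i \<in> shapes" if "i \<in> tets T" for i
    using V[OF lift[OF that]] unfolding Z_def shapes_def by blast
  ultimately show thesis using that pd unfolding solves_gluing_equations_def by blast
qed

lemma anchoring_of_holonomy:
  assumes \<rho>: "\<rho> \<in> hom (fundamental_group M (p x)) PSL2C"
    and Z: "solves_gluing_equations T Z" and D: "pseudo_developing M C p T h Z D"
    and equivariant: "\<And>\<gamma> c. \<gamma> \<in> carrier (fundamental_group M (p x)) \<Longrightarrow> c \<in> Delta C \<Longrightarrow>
       D (deck_of C p x \<gamma> ` c) = psl_act (\<rho>\<^sub>Z \<gamma>) (D c)"
    and conj: "conjugate_reps (fundamental_group M (p x)) \<rho>\<^sub>Z \<rho>"
  obtains L where "anchoring M C p x \<rho> L" "L_essential M C p T h L"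
proof -
  interpret group PSL2C by (rule group_PSL2C)
  obtain g where g: "g \<in> carrier PSL2C"
    and conj': "\<And>\<gamma>. \<gamma> \<in> carrier (fundamental_group M (p x)) \<Longrightarrow>
        \<rho>\<^sub>Z \<gamma> = g \<otimes>\<^bsub>PSL2C\<^esub> \<rho> \<gamma> \<otimes>\<^bsub>PSL2C\<^esub> inv\<^bsub>PSL2C\<^esub> g"
    using conj unfolding conjugate_reps_def by blast
  \<comment> \<open>The inverse appears because \<open>\<rho>\<^sub>Z\<close> is \<open>g\<close>
    times \<open>\<rho>\<close> times the inverse of \<open>g\<close>: translating \<open>D\<close>
    back by \<open>g\<close> replaces equivariance for \<open>\<rho>\<^sub>Z\<close> by equivariance
    for \<open>\<rho>\<close>.\<close>
  define L where "L c = psl_act (inv\<^bsub>PSL2C\<^esub> g) (D c)" for c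
  have DC: "D c \<in> CP1" if "c \<in> Delta C" for c using D that by (auto simp: pseudo_developing_def)
  have ig: "inv\<^bsub>PSL2C\<^esub> g \<in> carrier PSL2C" using g by simp
  show thesis
  proof (rule that)
    show "anchoring M C p x \<rho> L" unfolding anchoring_def
    proof (intro conjI ballI)
      show "L \<in> Delta C \<rightarrow> CP1" using DC psl_act_CP1[OF ig] by (auto simp: L_def)
      fix \<gamma> c assume \<gamma>: "\<gamma> \<in> carrier (fundamental_group M (p x))" and c: "c \<in> Delta C"
      have r: "\<rho> \<gamma> \<in> carrier PSL2C" using \<rho> \<gamma> by (auto simp: hom_def)
      have "L (deck_of C p x \<gamma> ` c) = psl_act (inv\<^bsub>PSL2C\<^esub> g) (psl_act (g \<otimes>\<^bsub>PSL2C\<^esub> \<rho> \<gamma> \<otimes>\<^bsub>PSL2C\<^esub> inv\<^bsub>PSL2C\<^esub> g) (D c))"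
        unfolding L_def by (simp add: equivariant[OF \<gamma> c] conj'[OF \<gamma>])
      also have "\<dots> = psl_act (\<rho> \<gamma>) (L c)"
        unfolding L_def using g r ig DC[OF c] by (simp add: psl_act_mult psl_act_CP1 psl_act_inv)
      finally show "L (deck_of C p x \<gamma> ` c) = psl_act (\<rho> \<gamma>) (L c)" .
    qed
    show "L_essential M C p T h L" unfolding L_essential_def lifted_edge_ends_def
    proof (intro allI impI, elim exE conjE)
      fix u v i \<tau> a b
      assume \<tau>: "lifted_tet C p T h i \<tau>" and ab: "a \<noteq> b" and uv: "u = ideal_end M C p \<tau> a" "v = ideal_end M C p \<tau> b"
      have "(\<lambda>a. D (ideal_end M C p \<tau> a)) \<in> Z i" using D \<tau> by (auto simp: pseudo_developing_def)
      moreover have "Z i \<in> shapes" using Z \<tau> by (auto simp: solves_gluing_equations_def lifted_tet_def)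
      ultimately have "inj (\<lambda>a. D (ideal_end M C p \<tau> a))" "range (\<lambda>a. D (ideal_end M C p \<tau> a)) \<subseteq> CP1"
        using shape_members by blast+
      then have "D u \<noteq> D v" "D u \<in> CP1" "D v \<in> CP1" unfolding uv using ab by (auto simp: inj_def)
      then show "L u \<noteq> L v" unfolding L_def using psl_act_inj[OF ig] by blast
    qed
  qed
qed

lemma conjugate_reps_refl:
  assumes "\<rho> \<in> hom G PSL2C"
  shows "conjugate_reps G \<rho> \<rho>"
proof -
  interpret group PSL2C by (rule group_PSL2C)
  have "\<rho> \<gamma> \<in> carrier PSL2C" if "\<gamma> \<in> carrier G" for \<gamma> using assms that by (auto simp: hom_def)
  then show ?thesis unfolding conjugate_reps_def by (intro bexI[of _ "\<one>\<^bsub>PSL2C\<^esub>"]) auto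
qed

theorem lemma2p18:
  fixes M :: "'a::topological_space set" and C :: "'b::topological_space set"
    and p :: "'b \<Rightarrow> 'a" and x :: 'b
    and T :: "'t triangulation" and h :: "('t \<times> (real^4)) set \<Rightarrow> 'a"
    and \<rho> :: "(real \<Rightarrow> 'a) set \<Rightarrow> (complex^2^2) set"
  assumes "three_manifold M" and "compact M" and "connected M"
    and "universal_cover C p M" and "x \<in> C"
    and "\<rho> \<in> hom (fundamental_group M (p x)) PSL2C"
    and "ideal_triangulation M T h"
  shows "(\<exists>L. anchoring M C p x \<rho> L \<and> L_essential M C p T h L) \<longleftrightarrow>
    (\<exists>Z. solves_gluing_equations T Z \<and>
      (\<exists>\<rho>\<^sub>Z. holonomy_rep M C p x T h Z \<rho>\<^sub>Z \<and>
         conjugate_reps (fundamental_group M (p x)) \<rho>\<^sub>Z \<rho>))"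
proof
  have tc: "triangulated_cover M C p T h"
    using assms by unfold_locales
      (auto simp: three_manifold_def universal_cover_def locally_half_space_def)
  assume "\<exists>L. anchoring M C p x \<rho> L \<and> L_essential M C p T h L"
  then obtain L where L: "anchoring M C p x \<rho> L" "L_essential M C p T h L" by blast
  obtain Z where Z: "solves_gluing_equations T Z" "pseudo_developing M C p T h Z L"
    using solves_gluing_equations_anchored[OF tc assms(5,6) L] by blast
  \<comment> \<open>The anchoring is itself the pseudo-developing map and is equivariant for
    \<open>\<rho>\<close>, so \<open>\<rho>\<close> already represents the holonomy and the identity
    conjugates.\<close>
  have "holonomy_rep M C p x T h Z \<rho>"
    unfolding holonomy_rep_def using assms(6) Z(2) L(1) by (auto simp: anchoring_def)
  then show "\<exists>Z. solves_gluing_equations T Z \<and>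
      (\<exists>\<rho>\<^sub>Z. holonomy_rep M C p x T h Z \<rho>\<^sub>Z \<and> conjugate_reps (fundamental_group M (p x)) \<rho>\<^sub>Z \<rho>)"
    using Z(1) conjugate_reps_refl[OF assms(6)] by blast
next
  assume "\<exists>Z. solves_gluing_equations T Z \<and>
      (\<exists>\<rho>\<^sub>Z. holonomy_rep M C p x T h Z \<rho>\<^sub>Z \<and> conjugate_reps (fundamental_group M (p x)) \<rho>\<^sub>Z \<rho>)"
  then obtain Z \<rho>\<^sub>Z D where Z: "solves_gluing_equations T Z" "pseudo_developing M C p T h Z D"
    "\<forall>\<gamma>\<in>carrier (fundamental_group M (p x)). \<forall>c\<in>Delta C. D (deck_of C p x \<gamma> ` c) = psl_act (\<rho>\<^sub>Z \<gamma>) (D c)"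
    "conjugate_reps (fundamental_group M (p x)) \<rho>\<^sub>Z \<rho>"
    unfolding holonomy_rep_def by blast
  show "\<exists>L. anchoring M C p x \<rho> L \<and> L_essential M C p T h L"
    by (rule anchoring_of_holonomy[where p = p and x = x and C = C, OF assms(6) Z(1,2) _ Z(4)]) (use Z(3) in blast)+
qed

end
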